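(* For any $n,k>0$, there exists a dynamic algorithm that achieves a $0.3178$-approximation for the problem of monotone submodular maximization under a matroid constraint of rank $k$ on a ground set of size $n$, using $\mathrm{poly}(k,\log n)$ queries per update under the sliding window model.
   Context: A set function $f:2^{N}\to\mathbb{R}_{\ge 0}$ on ground set $N=[n]$ is monotone if $f(A)\ge f(B)$ for $B\subseteq A\subseteq N$, and submodular if $f(A\cup\{u\})-f(A)\le f(B\cup\{u\})-f(B)$ for $B\subseteq A\subseteq N$ and $u\in N$. Submodular maximization under a matroid constraint $\mathcal{M}$ asks for $\max_{S\in\mathcal{M}} f(S)$ (over independent sets of the matroid). In the dynamic version, elements of the ground set are inserted and deleted over time and the algorithm must maintain a feasible (independent) set $S$ of currently present elements whose value is at least $0.3178$ times the optimum over the current elements. Complexity is measured in queries to the value oracle of $f$. In the sliding window model, elements are deleted in the same order they were inserted (FIFO). *)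

theory Defs
  imports "HOL-Probability.Probability" "HOL-Computational_Algebra.Polynomial"
begin

definition submodular_on :: "'a set \<Rightarrow> ('a set \<Rightarrow> real) \<Rightarrow> bool" where
  "submodular_on N f \<longleftrightarrow>
     (\<forall>A B u. B \<subseteq> A \<and> A \<subseteq> N \<and> u \<in> N \<longrightarrow>
        f (A \<union> {u}) - f A \<le> f (B \<union> {u}) - f B)"

text \<open>A matroid is given by its ground set and its family of independent sets.\<close>

definition matroid :: "'a set \<Rightarrow> 'a set set \<Rightarrow> bool" where
  "matroid N M \<longleftrightarrow>
     finite N \<and> M \<subseteq> Pow N \<and> {} \<in> M \<and>
     (\<forall>I\<in>M. \<forall>J. J \<subseteq> I \<longrightarrow> J \<in> M) \<and>
     (\<forall>I\<in>M. \<forall>J\<in>M. card I < card J \<longrightarrow> (\<exists>x\<in>J - I. insert x I \<in> M))"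

definition matroid_rank :: "'a set set \<Rightarrow> nat" where
  "matroid_rank M = Max (card ` M)"

definition opt :: "('a set \<Rightarrow> real) \<Rightarrow> 'a set set \<Rightarrow> 'a set \<Rightarrow> real" where
  "opt f M V = Max (f ` {S \<in> M. S \<subseteq> V})"


datatype update = Insert nat | Delete nat

primrec present_step :: "update \<Rightarrow> nat set \<Rightarrow> nat set" where
  "present_step (Insert e) V = insert e V"
| "present_step (Delete e) V = V - {e}"

definition present :: "update list \<Rightarrow> nat set" where
  "present us = fold present_step us {}"

text \<open>The list \<open>q\<close> holds the elements that are present, oldest first. A stream may have any
  length, and an element that has been deleted may be inserted again.\<close>

fun fifo_from :: "nat set \<Rightarrow> nat list \<Rightarrow> update list \<Rightarrow> bool" where
  "fifo_from N q [] = True"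
| "fifo_from N q (Insert e # us) = (e \<in> N \<and> e \<notin> set q \<and> fifo_from N (q @ [e]) us)"
| "fifo_from N q (Delete e # us) = (q \<noteq> [] \<and> e = hd q \<and> fifo_from N (tl q) us)"

abbreviation sliding_window_stream :: "nat set \<Rightarrow> update list \<Rightarrow> bool" where
  "sliding_window_stream N us \<equiv> fifo_from N [] us"


text \<open>A terminating randomized computation with access to a value oracle, an independence oracle
  and fair coins. Nothing else about the objective or the matroid is available to it; computation
  between oracle calls is unrestricted.\<close>

datatype 'r comp =
    Done 'r
  | Value_Query "nat set" "real \<Rightarrow> 'r comp"
  | Indep_Query "nat set" "bool \<Rightarrow> 'r comp"
  | Coin "bool \<Rightarrow> 'r comp"

text \<open>A dynamic algorithm reacts to an update by a computation that returns the new solution and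
  the algorithm in its new state. The codatatype makes the state space arbitrary: every machine
  with a state type of its own unfolds to an element of it.\<close>

codatatype dyn_alg = Dyn_Alg (on_update: "update \<Rightarrow> (nat set \<times> dyn_alg) comp")

text \<open>The distribution of the result together with the number of value queries.\<close>

primrec exec :: "(nat set \<Rightarrow> real) \<Rightarrow> (nat set \<Rightarrow> bool) \<Rightarrow> 'r comp \<Rightarrow> ('r \<times> nat) pmf" where
  "exec val ind (Done r) = return_pmf (r, 0)"
| "exec val ind (Value_Query S c) = map_pmf (\<lambda>(r, q). (r, Suc q)) (exec val ind (c (val S)))"
| "exec val ind (Indep_Query S c) = exec val ind (c (ind S))"
| "exec val ind (Coin c) = bind_pmf (bernoulli_pmf (1/2)) (\<lambda>b. exec val ind (c b))"

primrec mentioned :: "update \<Rightarrow> nat" where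
  "mentioned (Insert e) = e"
| "mentioned (Delete e) = e"

text \<open>The set \<open>W\<close> collects the elements that have occurred in the stream so far. Oracle calls are
  intersected with it, so that the oracles reveal nothing about elements that have not yet been
  inserted. The result lists, for each update, the solution held after it and the number of value
  queries spent on it.\<close>

primrec run :: "(nat set \<Rightarrow> real) \<Rightarrow> nat set set \<Rightarrow> nat set \<Rightarrow> dyn_alg \<Rightarrow> update list
    \<Rightarrow> (nat set \<times> nat) list pmf" where
  "run f M W A [] = return_pmf []"
| "run f M W A (u # us) =
     (let W' = insert (mentioned u) W in
      bind_pmf (exec (\<lambda>S. f (S \<inter> W')) (\<lambda>S. S \<inter> W' \<in> M) (on_update A u))
        (\<lambda>((S, A'), q). map_pmf (\<lambda>tr. (S, q) # tr) (run f M W' A' us)))"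

text \<open>Feasibility and the query bound hold for every update and every outcome of the coins. For
  every update, the solution held after it is an \<open>\<alpha>\<close>-approximation except with probability at most
  \<open>\<delta>\<close>. Objective, matroid and stream do not depend on the coins (oblivious adversary).\<close>

definition sliding_window_approx ::
    "nat set \<Rightarrow> nat \<Rightarrow> real \<Rightarrow> real \<Rightarrow> real \<Rightarrow> dyn_alg \<Rightarrow> bool" where
  "sliding_window_approx N k \<alpha> \<delta> b A \<longleftrightarrow>
     (\<forall>f M us.
        (\<forall>S\<subseteq>N. 0 \<le> f S) \<and> mono_on (Pow N) f \<and> submodular_on N f \<and>
        matroid N M \<and> matroid_rank M = k \<and> sliding_window_stream N us \<longrightarrow>
        (\<forall>t<length us.
           let V = present (take (Suc t) us) in
           (\<forall>tr\<in>set_pmf (run f M {} A us).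
              fst (tr ! t) \<in> M \<and> fst (tr ! t) \<subseteq> V \<and> real (snd (tr ! t)) \<le> b) \<and>
           measure_pmf.prob (run f M {} A us) {tr. \<alpha> * opt f M V \<le> f (fst (tr ! t))} \<ge> 1 - \<delta>))"

text \<open>A polynomial in two variables, as a polynomial in \<open>y\<close> with coefficients polynomials in \<open>x\<close>.\<close>

definition poly2 :: "real poly poly \<Rightarrow> real \<Rightarrow> real \<Rightarrow> real" where
  "poly2 P x y = poly (map_poly (\<lambda>p. poly p x) P) y"

end

theory Submission imports Defs begin

text \<open>
  In a stream of elements \<open>u\<close> with marginals \<open>w\<close> against a growing fractional point \<open>a\<close>, keep for every
  threshold a greedy independent set of the elements whose marginal exceeds it. An element
  that enters the sets for thresholds of total length \<open>\<theta>\<close> gets the coordinate \<open>\<theta> / (x w)\<close>, so the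
  multilinear extension of \<open>a\<close> is \<open>W / x\<close>, where \<open>W\<close> is the integral of the sizes of the greedy sets,
  while the marginals of an optimal set add up to at most \<open>W\<close>. Merging the greedy sets whose
  thresholds differ by powers of \<open>exp x\<close>, from the top down, gives a convex combination of independent
  sets that still dominates a part of \<open>a\<close> of value \<open>(1 - exp (- x)) W / x\<close>; swap rounding turns it into
  a random independent set. The ratio \<open>(1 - exp (- x)) / (1 + x)\<close> exceeds \<open>0.3178\<close> at \<open>x = 1.146\<close>
  (Feldman, Liu, Norouzi-Fard, Svensson and Zenklusen).

  The streaming algorithm may read the window in any order. An order whose initial parts depend
  only on the ends of the window rounded to powers of two changes slowly, so the states after all
  its prefixes can be computed in advance with a logarithmic number of steps per update
  (Peng and Rubinstein). The random samples depend on the position in the order only and are drawn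
  once, so the table of states is deterministic afterwards.
\<close>

section \<open>The multilinear extension\<close>

text \<open>Only value queries are charged, so independence queries and arithmetic may be
  exhaustive; the cost lies in the samples that estimate marginals. An additive error of order
  \<open>D / k\<close>, for the largest singleton value \<open>D\<close> so far, is affordable,
  because an optimal set has at most \<open>k\<close> elements. The obstacle is adaptivity: the
  state at a position depends on earlier samples. As seeds belong to positions, that state is
  independent of the seed at its own position, and a union bound over the at most \<open>n\<close>
  positions of the current order suffices. The guarantee concerns each update separately, so the
  length of the stream never enters. Probabilities are multiples of \<open>1 / H\<close> with
  \<open>H\<close> a power of two, so that fair coins realise them exactly and the samples are
  unbiased. Rounding gives the ratio in expectation only; a surplus of \<open>1 / 10 ^ 5\<close> in
  the ratio becomes a small constant success probability, which independent repetitions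
  amplify.\<close>

primrec mext :: "('a \<Rightarrow> real) \<Rightarrow> 'a list \<Rightarrow> ('a set \<Rightarrow> real) \<Rightarrow> real" where
  "mext y [] g = g {}"
| "mext y (u # us) g = (1 - y u) * mext y us g + y u * mext y us (\<lambda>S. g (insert u S))"

lemma mext_cong:
  assumes "\<forall>u\<in>set us. y u = y' u" and "\<forall>S. S \<subseteq> set us \<longrightarrow> g S = g' S"
  shows "mext y us g = mext y' us g'"
  using assms
proof (induction us arbitrary: g g')
  case (Cons u us)
  have "mext y us g = mext y' us g'"
    using Cons.prems by (intro Cons.IH) auto
  moreover have "mext y us (\<lambda>S. g (insert u S)) = mext y' us (\<lambda>S. g' (insert u S))"
    using Cons.prems(1) by (intro Cons.IH allI impI Cons.prems(2)[rule_format]) auto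
  ultimately show ?case using Cons.prems(1) by simp
qed simp

lemma mext_add: "mext y us (\<lambda>S. g S + h S) = mext y us g + mext y us h"
  by (induction us arbitrary: g h) (simp_all add: algebra_simps)

lemma mext_uminus: "mext y us (\<lambda>S. - g S) = - mext y us g"
  by (induction us arbitrary: g) (simp_all add: algebra_simps)

lemma mext_diff: "mext y us (\<lambda>S. g S - h S) = mext y us g - mext y us h"
  using mext_add[of y us g "\<lambda>S. - h S"] by (simp add: mext_uminus)

lemma mext_const: "mext y us (\<lambda>S. c) = c"
  by (induction us) (simp_all add: algebra_simps)

lemma mext_mono:
  assumes "\<forall>u\<in>set us. 0 \<le> y u \<and> y u \<le> 1" and "\<forall>S. S \<subseteq> set us \<longrightarrow> g S \<le> g' S"
  shows "mext y us g \<le> mext y us g'"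
  using assms
proof (induction us arbitrary: g g')
  case (Cons u us)
  have "mext y us g \<le> mext y us g'"
    using Cons.prems by (intro Cons.IH) auto
  moreover have "mext y us (\<lambda>S. g (insert u S)) \<le> mext y us (\<lambda>S. g' (insert u S))"
    using Cons.prems(1) by (intro Cons.IH allI impI Cons.prems(2)[rule_format]) auto
  ultimately show ?case using Cons.prems(1) by (simp add: add_mono mult_left_mono)
qed simp

text \<open>The extension is the expected value on a random set that contains each \<open>u\<close>
  independently with probability \<open>y u\<close>. With the newest element at the head, the last
  summand is the gain from its arrival; inductions along the stream use this form.\<close>

lemma mext_step: "mext y (u # us) g = mext y us g + y u * mext y us (\<lambda>S. g (insert u S) - g S)"
  by (simp add: mext_diff algebra_simps)

text \<open>Raising the coordinate of \<open>u\<close> shifts weight from \<open>g S\<close> to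
  \<open>g (insert u S)\<close>, which is no larger. It is meant for marginals: by submodularity
  they are larger at a lower fractional point.\<close>

lemma mext_antitone:
  assumes "\<forall>u\<in>set us. 0 \<le> b u \<and> b u \<le> a u \<and> a u \<le> 1"
    and "\<forall>S T. S \<subseteq> T \<longrightarrow> T \<subseteq> set us \<longrightarrow> g T \<le> g S"
  shows "mext a us g \<le> mext b us g"
  using assms
proof (induction us arbitrary: g)
  case (Cons u us)
  let ?g' = "\<lambda>S. g (insert u S)"
  have 1: "mext a us g \<le> mext b us g"
    using Cons.prems(1) by (intro Cons.IH allI impI Cons.prems(2)[rule_format]) auto
  have 2: "mext a us ?g' \<le> mext b us ?g'"
    using Cons.prems(1) by (intro Cons.IH allI impI Cons.prems(2)[rule_format]) auto
  have 3: "mext a us ?g' \<le> mext a us g"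
  proof (rule mext_mono)
    show "\<forall>S. S \<subseteq> set us \<longrightarrow> ?g' S \<le> g S"
      using Cons.prems(2) by (auto intro!: Cons.prems(2)[rule_format])
    show "\<forall>u\<in>set us. 0 \<le> a u \<and> a u \<le> 1" using Cons.prems(1) by force
  qed
  have ab: "0 \<le> b u" "b u \<le> a u" "a u \<le> 1" using Cons.prems(1) by auto
  have "mext a (u # us) g = mext a us g + a u * (mext a us ?g' - mext a us g)"
    by (simp add: algebra_simps)
  also have "\<dots> \<le> mext a us g + b u * (mext a us ?g' - mext a us g)"
    using 3 ab by (intro add_left_mono mult_right_mono_neg) auto
  also have "\<dots> = (1 - b u) * mext a us g + b u * mext a us ?g'"
    by (simp add: algebra_simps)
  also have "\<dots> \<le> (1 - b u) * mext b us g + b u * mext b us ?g'"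
    using 1 2 ab by (intro add_mono mult_left_mono) auto
  finally show ?case by simp
qed simp

lemma mext_monotone:
  assumes "\<forall>u\<in>set us. 0 \<le> b u \<and> b u \<le> a u \<and> a u \<le> 1"
    and "\<forall>S T. S \<subseteq> T \<longrightarrow> T \<subseteq> set us \<longrightarrow> g S \<le> g T"
  shows "mext b us g \<le> mext a us g"
  using mext_antitone[OF assms(1), of "\<lambda>S. - g S"] assms(2) by (simp add: mext_uminus)

lemma mext_swap: "mext y (u # v # us) g = mext y (v # u # us) g"
  by (simp add: algebra_simps insert_commute)

text \<open>Independent coordinates may be revealed in any order; this brings the two coordinates of
  an exchange to the front.\<close>

lemma mext_front: "u \<in> set us \<Longrightarrow> mext y us g = mext y (u # remove1 u us) g"
proof (induction us arbitrary: g)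
  case (Cons v us)
  show ?case
  proof (cases "u = v")
    case False
    then have "mext y us h = mext y (u # remove1 u us) h" for h
      using Cons by auto
    then have "mext y (v # us) g = mext y (v # u # remove1 u us) g"
      by (simp only: mext.simps(2)[of y v])
    with False show ?thesis by (simp only: mext_swap) simp
  qed simp
qed simp

lemma mext_indicator:
  "set us \<subseteq> N \<Longrightarrow> mext (\<lambda>u. of_bool (u \<in> D)) us g = g (set us \<inter> D)"
proof (induction us arbitrary: g)
  case (Cons u us)
  then show ?case by (cases "u \<in> D") (simp_all add: Int_insert_left)
qed simp

section \<open>Monotone submodular functions\<close>

locale monotone_submodular =
  fixes N :: "'a set" and f :: "'a set \<Rightarrow> real"
  assumes nonneg: "S \<subseteq> N \<Longrightarrow> 0 \<le> f S"
    and mono: "mono_on (Pow N) f"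
    and submod: "submodular_on N f"
begin

lemma f_mono: "A \<subseteq> B \<Longrightarrow> B \<subseteq> N \<Longrightarrow> f A \<le> f B"
  using mono by (auto simp: mono_on_def)

lemma f_submod: "B \<subseteq> A \<Longrightarrow> A \<subseteq> N \<Longrightarrow> u \<in> N \<Longrightarrow> f (insert u A) - f A \<le> f (insert u B) - f B"
  using submod by (auto simp: submodular_on_def)

text \<open>Along the direction \<open>e_b - e_c\<close> the extension is convex.\<close>

lemma mext_exchange:
  assumes us: "distinct us" "set us \<subseteq> N" and bc: "b \<in> set us" "c \<in> set us" "b \<noteq> c"
    and z: "\<forall>u\<in>set us. 0 \<le> z u \<and> z u \<le> 1"
  shows "mext z us f \<le> (mext (z(b := z b + \<beta>, c := z c - \<beta>)) us f
                       + mext (z(b := z b - \<beta>, c := z c + \<beta>)) us f) / 2"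
proof -
  define vs where "vs = remove1 c (remove1 b us)"
  have c: "c \<in> set (remove1 b us)" using bc us by auto
  have vs: "set vs \<subseteq> set us" "b \<notin> set vs" "c \<notin> set vs"
    using us unfolding vs_def by (auto dest: notin_set_remove1)
  have front: "mext y us g = mext y (b # c # vs) g" for y g
  proof -
    have "mext y us g = mext y (b # remove1 b us) g" by (rule mext_front) fact
    also have "\<dots> = mext y (b # c # vs) g"
      unfolding vs_def using mext_front[OF c] by (simp only: mext.simps(2)[of y b])
    finally show ?thesis .
  qed
  let ?z1 = "z(b := z b + \<beta>, c := z c - \<beta>)" and ?z2 = "z(b := z b - \<beta>, c := z c + \<beta>)"
  have v1: "mext ?z1 vs g = mext z vs g" and v2: "mext ?z2 vs g = mext z vs g" for g
    using vs by (auto intro!: mext_cong)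
  define G0 where "G0 = mext z vs f"
  define Gb where "Gb = mext z vs (\<lambda>S. f (insert b S))"
  define Gc where "Gc = mext z vs (\<lambda>S. f (insert c S))"
  define G where "G = mext z vs (\<lambda>S. f (insert b (insert c S)))"
  have "mext z vs (\<lambda>S. f (insert b (insert c S)) - f (insert c S)) \<le>
        mext z vs (\<lambda>S. f (insert b S) - f S)"
  proof (rule mext_mono)
    show "\<forall>S. S \<subseteq> set vs \<longrightarrow> f (insert b (insert c S)) - f (insert c S) \<le> f (insert b S) - f S"
      using vs us bc by (intro allI impI f_submod) auto
    show "\<forall>u\<in>set vs. 0 \<le> z u \<and> z u \<le> 1" using z vs by auto
  qed
  then have K: "G - Gc \<le> Gb - G0" by (simp add: mext_diff G_def Gc_def Gb_def G0_def)
  have val: "mext y us f = (1 - y b) * ((1 - y c) * G0 + y c * Gc) + y b * ((1 - y c) * Gb + y c * G)"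
    if "\<forall>g. mext y vs g = mext z vs g" for y
    unfolding front using that by (simp add: G_def Gc_def Gb_def G0_def)
  \<comment> \<open>In the coordinates of \<open>b\<close> and \<open>c\<close> the extension is
    bilinear, so the linear terms cancel in the average and only the product term remains. Its
    coefficient \<open>G - Gb - Gc + G0\<close> is nonpositive by submodularity.\<close>
  have "(mext ?z1 us f + mext ?z2 us f) / 2 - mext z us f = \<beta>^2 * ((Gb - G0) - (G - Gc))"
    unfolding val[of ?z1, unfolded v1, simplified] val[of ?z2, unfolded v2, simplified] val[of z, simplified]
    using bc(3) by (simp add: field_simps power2_eq_square)
  also have "\<dots> \<ge> 0" using K by simp
  finally show ?thesis by simp
qed

end

section \<open>Matroids\<close>

lemma card_swap:
  assumes "finite B" "b \<in> B" "c \<notin> B"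
  shows "card (insert c (B - {b})) = card B"
  using assms by (metis DiffD1 card.remove card_insert_disjoint finite_Diff)

locale matroid_on =
  fixes N :: "'a set" and M :: "'a set set"
  assumes mat: "matroid N M"
begin

lemma fin_N: "finite N" and indep_sub: "I \<in> M \<Longrightarrow> I \<subseteq> N" and indep_empty: "{} \<in> M"
  and indep_down: "I \<in> M \<Longrightarrow> J \<subseteq> I \<Longrightarrow> J \<in> M"
  and augment: "I \<in> M \<Longrightarrow> J \<in> M \<Longrightarrow> card I < card J \<Longrightarrow> \<exists>x\<in>J - I. insert x I \<in> M"
  using mat by (auto simp: matroid_def)

lemma indep_finite: "I \<in> M \<Longrightarrow> finite I"
  using indep_sub fin_N finite_subset by blast

lemma finite_M: "finite M"
  using mat finite_subset[of M "Pow N"] by (auto simp: matroid_def)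

lemma extend:
  assumes "I \<in> M" "J \<in> M" "card I \<le> card J"
  shows "\<exists>K\<in>M. I \<subseteq> K \<and> K \<subseteq> I \<union> J \<and> card K = card J"
  using assms
proof (induction "card J - card I" arbitrary: I)
  case 0
  then show ?case by (intro bexI[of _ I]) auto
next
  case (Suc d)
  then have "card I < card J" by simp
  with Suc.prems augment[of I J] obtain x where x: "x \<in> J - I" "insert x I \<in> M" by blast
  have c: "card (insert x I) = Suc (card I)" using x indep_finite Suc.prems(1) by simp
  have "\<exists>K\<in>M. insert x I \<subseteq> K \<and> K \<subseteq> insert x I \<union> J \<and> card K = card J"
    using Suc.hyps(2) Suc.prems x c by (intro Suc.hyps(1)) auto
  then show ?case using x by auto
qed

text \<open>The candidates for \<open>c\<close> are the elements of the fundamental circuit of \<open>b\<close> in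
  \<open>C\<close>, here the set \<open>X\<close>; if none worked, \<open>B - {b}\<close> would be a largest
  independent subset of its union with \<open>X\<close>.\<close>

lemma symmetric_exchange:
  assumes B: "B \<in> M" and C: "C \<in> M" and card: "card B = card C" and b: "b \<in> B - C"
  shows "\<exists>c\<in>C - B. insert c (B - {b}) \<in> M \<and> insert b (C - {c}) \<in> M"
\<comment> \<open>\<open>B\<close> and \<open>C\<close> have equal size but need not be bases. If
  \<open>b\<close> extends \<open>C\<close>, any \<open>c\<close> that augments
  \<open>B - {b}\<close> serves, since \<open>insert b (C - {c})\<close> lies in the independent set
  \<open>insert b C\<close>.\<close>
proof (cases "\<exists>c\<in>C. insert b C \<in> M")
  case True
  have fin: "finite B" "finite C" using B C indep_finite by auto
  have "B - {b} \<in> M" by (rule indep_down[OF B]) auto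
  moreover have "card (B - {b}) < card C"
    using b card_Diff1_less[OF fin(1), of b] by (simp add: card)
  ultimately obtain c where c: "c \<in> C - (B - {b})" "insert c (B - {b}) \<in> M"
    using C augment by blast
  moreover have "insert b (C - {c}) \<in> M"
  proof (rule indep_down)
    show "insert b C \<in> M" using True by blast
  qed auto
  ultimately show ?thesis using b by auto
next
  case nC: False
  have fin: "finite B" "finite C" using B C indep_finite by auto
  have "card B > 0" using b fin by (auto simp: card_gt_0_iff)
  then have "C \<noteq> {}" using card by auto
  with nC have nbC: "insert b C \<notin> M" by auto
  define X where "X = {c \<in> C. insert b (C - {c}) \<in> M}"
  have XM: "X \<in> M" by (rule indep_down[OF C]) (auto simp: X_def)
  \<comment> \<open>Otherwise \<open>insert b X\<close> extends inside \<open>insert b C\<close> to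
    an independent \<open>K\<close> of size \<open>card C\<close>, which misses exactly one
    \<open>c\<close> of \<open>C\<close>. That \<open>c\<close> then belongs to \<open>X\<close> by
    definition, although \<open>K\<close> contains \<open>X\<close>.\<close>
  have XbM: "insert b X \<notin> M"
  proof
    assume a: "insert b X \<in> M"
    have "X \<noteq> C" using a nbC by auto
    then have "X \<subset> C" unfolding X_def by auto
    then have "card X < card C" using fin by (simp add: psubset_card_mono)
    moreover have "card (insert b X) = Suc (card X)"
      using b fin X_def by simp
    ultimately have "card (insert b X) \<le> card C" by simp
    then obtain K where K: "K \<in> M" "insert b X \<subseteq> K" "K \<subseteq> insert b X \<union> C" "card K = card C"
      using extend[OF a C] by blast
    have "card (K - {b}) < card C"
      using K(2) card_Diff1_less[OF indep_finite[OF K(1)], of b] by (simp add: K(4))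
    then have "K - {b} \<noteq> C" by auto
    moreover have "K - {b} \<subseteq> C" using K X_def by auto
    ultimately obtain c where c: "c \<in> C" "c \<notin> K" using b by blast
    have Kc: "K \<subseteq> insert b (C - {c})" using K c X_def by auto
    have "card (insert b (C - {c})) = card C"
      using b c fin by (intro card_swap) auto
    then have "K = insert b (C - {c})" using Kc K(4) fin
      by (metis card_subset_eq finite.insertI finite_Diff)
    then have "c \<in> X" using K c X_def by auto
    then show False using c K by auto
  qed
  \<comment> \<open>\<open>X\<close> is extended from \<open>B\<close> to a set \<open>K\<close> of
    size \<open>card B\<close>. As \<open>b\<close> cannot be in \<open>K\<close>, augmenting
    \<open>B - {b}\<close> from \<open>K\<close> has to use an element of \<open>X\<close> outside
    \<open>B\<close>.\<close>
  have cX: "card X \<le> card B" using X_def fin card by (metis (no_types, lifting) card_mono mem_Collect_eq subsetI)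
  then obtain K where K: "K \<in> M" "X \<subseteq> K" "K \<subseteq> X \<union> B" "card K = card B"
    using extend[OF XM B] by blast
  have bK: "b \<notin> K" using XbM indep_down[OF K(1)] K(2) by blast
  have "B - {b} \<in> M" by (rule indep_down[OF B]) auto
  moreover have "card (B - {b}) < card K"
    using b card_Diff1_less[OF fin(1), of b] by (simp add: K(4))
  ultimately obtain c where c: "c \<in> K - (B - {b})" "insert c (B - {b}) \<in> M"
    using augment K(1) by blast
  then have "c \<in> X" "c \<notin> B" using K bK by auto
  then show ?thesis using c X_def by auto
qed

end

section \<open>Swap rounding\<close>

definition swap_pair :: "'a set set \<Rightarrow> 'a set \<Rightarrow> 'a set \<Rightarrow> 'a \<times> 'a" where
  "swap_pair M B C = (SOME (b, c). b \<in> B - C \<and> c \<in> C - B \<and>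
     insert c (B - {b}) \<in> M \<and> insert b (C - {c}) \<in> M)"

text \<open>The fuel \<open>i\<close> is meant to bound \<open>card (B - C)\<close>, which falls
  with every swap. Both swaps have probability 1/2 because \<open>B\<close> and \<open>C\<close>
  carry equal weights; hence the fractional point keeps its mean and one fair coin is
  enough.\<close>

primrec merge :: "'a set set \<Rightarrow> nat \<Rightarrow> 'a set \<Rightarrow> 'a set \<Rightarrow> 'a set pmf" where
  "merge M 0 B C = return_pmf B"
| "merge M (Suc i) B C = (if B = C then return_pmf B else
     (case swap_pair M B C of (b, c) \<Rightarrow>
       bernoulli_pmf (1/2) \<bind> (\<lambda>h. if h then merge M i (insert c (B - {b})) C
                                   else merge M i B (insert b (C - {c})))))"

text \<open>The family \<open>T\<close> on \<open>{j..<j + 2 ^ p}\<close> stands for the fractional point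
  in which each of its members has weight \<open>1 / 2 ^ p\<close>.\<close>

primrec swap_round :: "'a set set \<Rightarrow> nat \<Rightarrow> nat \<Rightarrow> (nat \<Rightarrow> 'a set) \<Rightarrow> nat \<Rightarrow> 'a set pmf" where
  "swap_round M i 0 T j = return_pmf (T j)"
| "swap_round M i (Suc p) T j =
     swap_round M i p T j \<bind> (\<lambda>B. swap_round M i p T (j + 2 ^ p) \<bind> (\<lambda>C. merge M i B C))"

lemma expectation_bernoulli_half:
  fixes h :: "'a \<Rightarrow> real"
  assumes "finite (set_pmf (g True))" "finite (set_pmf (g False))"
  shows "measure_pmf.expectation (bernoulli_pmf (1/2) \<bind> g) h =
    (measure_pmf.expectation (g True) h + measure_pmf.expectation (g False) h) / 2"
proof -
  have "finite (set_pmf (g x))" for x using assms by (cases x) auto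
  then show ?thesis by (subst pmf_expectation_bind[where A = UNIV]) (auto simp: UNIV_bool field_simps)
qed

context matroid_on
begin

lemma swap_pair:
  assumes "B \<in> M" "C \<in> M" "card B = card C" "B \<noteq> C" "swap_pair M B C = (b, c)"
  shows "b \<in> B - C \<and> c \<in> C - B \<and> insert c (B - {b}) \<in> M \<and> insert b (C - {c}) \<in> M"
proof -
  have "\<not> B \<subseteq> C" using assms indep_finite by (metis card_subset_eq)
  then obtain b' where "b' \<in> B - C" by auto
  then obtain c' where "b' \<in> B - C \<and> c' \<in> C - B \<and> insert c' (B - {b'}) \<in> M \<and> insert b' (C - {c'}) \<in> M"
    using symmetric_exchange assms by metis
  then have "\<exists>p. case p of (b, c) \<Rightarrow> b \<in> B - C \<and> c \<in> C - B \<and> insert c (B - {b}) \<in> M \<and> insert b (C - {c}) \<in> M"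
    by auto
  from someI_ex[OF this] show ?thesis using assms(5) unfolding swap_pair_def by auto
qed

lemma finite_set_merge: "finite (set_pmf (merge M i B C))"
proof (induction i arbitrary: B C)
  case (Suc i)
  then have "finite (set_pmf (if h then merge M i B' C' else merge M i B'' C''))" for h B' C' B'' C''
    by simp
  then show ?case by (simp add: case_prod_beta)
qed simp

lemma finite_set_swap_round: "finite (set_pmf (swap_round M i p T j))"
  by (induction p arbitrary: j) (auto simp: finite_set_merge)

lemma set_merge:
  assumes "B \<in> M" "C \<in> M" "card B = card C"
  shows "set_pmf (merge M i B C) \<subseteq> {D \<in> M. card D = card B \<and> D \<subseteq> B \<union> C}"
  using assms
proof (induction i arbitrary: B C)
  case (Suc i)
  show ?case
  proof (cases "B = C")
    case False
    obtain b c where p: "swap_pair M B C = (b, c)" by force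
    note bc = swap_pair[OF Suc.prems False p]
    have fin: "finite B" "finite C" using Suc.prems indep_finite by auto
    have cb: "card (insert c (B - {b})) = card B" "card (insert b (C - {c})) = card C"
      using bc by (simp_all only: card_swap[OF fin(1)] card_swap[OF fin(2)] Diff_iff not_False_eq_True)
    have "set_pmf (merge M i (insert c (B - {b})) C) \<subseteq> {D \<in> M. card D = card B \<and> D \<subseteq> B \<union> C}"
      using Suc.IH[of "insert c (B - {b})" C] bc Suc.prems cb by auto
    moreover have "set_pmf (merge M i B (insert b (C - {c}))) \<subseteq> {D \<in> M. card D = card B \<and> D \<subseteq> B \<union> C}"
      using Suc.IH[of B "insert b (C - {c})"] bc Suc.prems cb by auto
    moreover have "set_pmf (merge M (Suc i) B C) =
        set_pmf (merge M i (insert c (B - {b})) C) \<union> set_pmf (merge M i B (insert b (C - {c})))"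
      using False p by (auto split: if_splits)
    ultimately show ?thesis by (simp only: Un_least)
  qed (use Suc.prems in auto)
qed auto

lemma set_swap_round:
  assumes "\<forall>l\<in>{j..<j + 2^p}. T l \<in> M \<and> card (T l) = r \<and> T l \<subseteq> U"
  shows "set_pmf (swap_round M i p T j) \<subseteq> {D \<in> M. card D = r \<and> D \<subseteq> U}"
  using assms
proof (induction p arbitrary: j)
  case (Suc p)
  have 1: "set_pmf (swap_round M i p T j) \<subseteq> {D \<in> M. card D = r \<and> D \<subseteq> U}"
    using Suc.prems by (intro Suc.IH) auto
  have 2: "set_pmf (swap_round M i p T (j + 2^p)) \<subseteq> {D \<in> M. card D = r \<and> D \<subseteq> U}"
    using Suc.prems by (intro Suc.IH) auto
  show ?case
  proof
    fix D assume "D \<in> set_pmf (swap_round M i (Suc p) T j)"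
    then obtain B C where "B \<in> set_pmf (swap_round M i p T j)"
      "C \<in> set_pmf (swap_round M i p T (j + 2^p))" "D \<in> set_pmf (merge M i B C)" by auto
    then show "D \<in> {D \<in> M. card D = r \<and> D \<subseteq> U}"
      using 1 2 set_merge[of B C i] by fastforce
  qed
qed simp

end

locale submodular_matroid = monotone_submodular N f + matroid_on N M
  for N :: "'a set" and f M
begin

text \<open>A swap moves the fractional point by \<open>\<beta>\<close> along an exchange direction,
  forwards or backwards with equal probability, so by convexity in that direction the expected value
  does not fall. The point \<open>y\<close> holds the weight of all other sets.\<close>

lemma merge_expectation:
  assumes "B \<in> M" "C \<in> M" "card B = card C" "card (B - C) \<le> i" "B \<subseteq> set us" "C \<subseteq> set us"
    and us: "distinct us" "set us \<subseteq> N" and y: "\<forall>u. 0 \<le> y u \<and> y u + 2 * \<beta> \<le> 1" and \<beta>: "0 \<le> \<beta>"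
  shows "mext (\<lambda>u. y u + \<beta> * of_bool (u \<in> B) + \<beta> * of_bool (u \<in> C)) us f \<le>
    measure_pmf.expectation (merge M i B C) (\<lambda>D. mext (\<lambda>u. y u + 2 * \<beta> * of_bool (u \<in> D)) us f)"
  using assms(1-6)
proof (induction i arbitrary: B C)
  case 0
  have "finite B" "finite C" using 0 indep_finite by auto
  with 0 have "B = C" by (metis card_subset_eq Diff_eq_empty_iff card_0_eq finite_Diff le_zero_eq)
  then show ?case by (simp add: algebra_simps)
next
  case (Suc i)
  show ?case
  proof (cases "B = C")
    case True
    then show ?thesis by (simp add: algebra_simps)
  next
    case False
    obtain b c where p: "swap_pair M B C = (b, c)" by force
    note bc = swap_pair[OF Suc.prems(1-3) False p]
    let ?B = "insert c (B - {b})" and ?C = "insert b (C - {c})"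
    let ?E = "\<lambda>B C. measure_pmf.expectation (merge M i B C) (\<lambda>D. mext (\<lambda>u. y u + 2 * \<beta> * of_bool (u \<in> D)) us f)"
    let ?z = "\<lambda>B C u. y u + \<beta> * of_bool (u \<in> B) + \<beta> * of_bool (u \<in> C)"
    have fin: "finite B" "finite C" using Suc.prems indep_finite by auto
    have cb: "card ?B = card B" "card ?C = card C"
      using bc by (simp_all only: card_swap[OF fin(1)] card_swap[OF fin(2)] Diff_iff not_False_eq_True)
    have "?B - C \<subset> B - C" "B - ?C \<subset> B - C" using bc by auto
    then have "card (?B - C) < card (B - C)" "card (B - ?C) < card (B - C)"
      using fin by (simp_all only: psubset_card_mono finite_Diff)
    with Suc.prems(4) have le: "card (?B - C) \<le> i" "card (B - ?C) \<le> i" by linarith+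
    have B: "?B \<in> M" "?B \<subseteq> set us" "card ?B = card C"
      and C: "?C \<in> M" "?C \<subseteq> set us" "card B = card ?C"
      using bc Suc.prems(5,6) by (auto simp only: cb Suc.prems(3))
    have E: "mext (?z ?B C) us f \<le> ?E ?B C" "mext (?z B ?C) us f \<le> ?E B ?C"
      by (rule Suc.IH; fact B C le Suc.prems)+
    have z1: "?z ?B C = (?z B C)(b := ?z B C b - \<beta>, c := ?z B C c + \<beta>)"
      and z2: "?z B ?C = (?z B C)(b := ?z B C b + \<beta>, c := ?z B C c - \<beta>)"
      using bc by (auto simp: fun_eq_iff)
    have "mext (?z B C) us f \<le> (mext (?z B ?C) us f + mext (?z ?B C) us f) / 2"
      unfolding z1 z2
    proof (rule mext_exchange[OF us])
      show "\<forall>u\<in>set us. 0 \<le> ?z B C u \<and> ?z B C u \<le> 1"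
      proof
        fix u show "0 \<le> ?z B C u \<and> ?z B C u \<le> 1"
          using y[rule_format, of u] \<beta> by (auto simp: of_bool_def)
      qed
    qed (use bc Suc.prems in auto)
    also have "\<dots> \<le> (?E B ?C + ?E ?B C) / 2" using E by simp
    also have "\<dots> = measure_pmf.expectation (merge M (Suc i) B C) (\<lambda>D. mext (\<lambda>u. y u + 2 * \<beta> * of_bool (u \<in> D)) us f)"
      using False p by (simp add: expectation_bernoulli_half finite_set_merge add.commute)
    finally show ?thesis .
  qed
qed

text \<open>The statement is general in \<open>y\<close> for the induction: while the first half is
  rounded, \<open>y\<close> absorbs the still fractional second half, and while the second half is
  rounded, it absorbs the rounded set \<open>B\<close> with weight
  \<open>2 ^ p * \<beta>\<close>.\<close>

lemma swap_round_expectation_aux: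
  assumes T: "\<forall>l\<in>{j..<j + 2^p}. T l \<in> M \<and> card (T l) = r \<and> T l \<subseteq> set us" and i: "r \<le> i"
    and us: "distinct us" "set us \<subseteq> N" and y: "\<forall>u. 0 \<le> y u \<and> y u + 2^p * \<beta> \<le> 1" and \<beta>: "0 \<le> \<beta>"
  shows "mext (\<lambda>u. y u + \<beta> * (\<Sum>l=j..<j+2^p. of_bool (u \<in> T l))) us f \<le>
    measure_pmf.expectation (swap_round M i p T j) (\<lambda>D. mext (\<lambda>u. y u + 2^p * \<beta> * of_bool (u \<in> D)) us f)"
  using T y
proof (induction p arbitrary: j y)
  case (Suc p)
  let ?c = "\<lambda>j u. \<beta> * (\<Sum>l=j..<j+2^p. of_bool (u \<in> T l))"
  let ?X = "swap_round M i p T j" and ?Y = "swap_round M i p T (j + 2^p)"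
  have c: "0 \<le> ?c j u" "?c j u \<le> 2^p * \<beta>" for j u
  proof -
    show "0 \<le> ?c j u" using \<beta> by (intro mult_nonneg_nonneg sum_nonneg) auto
    have "(\<Sum>l=j..<j+2^p. of_bool (u \<in> T l) :: real) \<le> (\<Sum>l=j..<j+2^p. 1)" by (intro sum_mono) auto
    then show "?c j u \<le> 2^p * \<beta>" using \<beta> by (simp add: mult_left_mono mult.commute[of _ \<beta>])
  qed
  have spl: "(\<Sum>l=j..<j+2^Suc p. of_bool (u \<in> T l) :: real) =
      (\<Sum>l=j..<j+2^p. of_bool (u \<in> T l)) + (\<Sum>l=j+2^p..<j+2^p+2^p. of_bool (u \<in> T l))" for u
    by (subst sum.atLeastLessThan_concat) (auto simp: add.assoc mult_2)
  have y2: "0 \<le> y u" "y u + 2 * (2^p * \<beta>) \<le> 1" for u using Suc.prems(2) by (auto simp: mult.assoc)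
  have X: "set_pmf ?X \<subseteq> {D \<in> M. card D = r \<and> D \<subseteq> set us}"
    using Suc.prems(1) by (intro set_swap_round) auto
  have Y: "set_pmf ?Y \<subseteq> {D \<in> M. card D = r \<and> D \<subseteq> set us}"
    using Suc.prems(1) by (intro set_swap_round) auto
  let ?F = "\<lambda>D. mext (\<lambda>u. y u + 2^Suc p * \<beta> * of_bool (u \<in> D)) us f"
  have pb: "0 \<le> 2^p * \<beta>" using \<beta> by simp
  have aux: "0 \<le> z + K * of_bool b \<and> z + K * of_bool b + K \<le> 1"
    if "0 \<le> K" "0 \<le> z" "z + 2 * K \<le> 1" for z K :: real and b
    using that by (cases b) auto
  have "mext (\<lambda>u. y u + \<beta> * (\<Sum>l=j..<j+2^Suc p. of_bool (u \<in> T l))) us f =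
     mext (\<lambda>u. (y u + ?c (j+2^p) u) + ?c j u) us f"
    by (intro mext_cong ballI allI impI) (simp_all only: spl distrib_left ac_simps)
  also have "\<dots> \<le> measure_pmf.expectation ?X (\<lambda>B. mext (\<lambda>u. (y u + ?c (j+2^p) u) + 2^p * \<beta> * of_bool (u \<in> B)) us f)"
  proof (rule Suc.IH)
    show "\<forall>u. 0 \<le> y u + ?c (j+2^p) u \<and> y u + ?c (j+2^p) u + 2^p * \<beta> \<le> 1"
    proof
      fix u show "0 \<le> y u + ?c (j+2^p) u \<and> y u + ?c (j+2^p) u + 2^p * \<beta> \<le> 1"
        using y2[of u] c[where j = "j+2^p" and u = u] by linarith
    qed
  qed (use Suc.prems in auto)
  also have "\<dots> \<le> measure_pmf.expectation ?X (\<lambda>B. measure_pmf.expectation (?Y \<bind> (\<lambda>C. merge M i B C)) ?F)"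
  proof (rule integral_mono_AE)
    show "AE B in ?X. mext (\<lambda>u. (y u + ?c (j+2^p) u) + 2^p * \<beta> * of_bool (u \<in> B)) us f \<le>
       measure_pmf.expectation (?Y \<bind> (\<lambda>C. merge M i B C)) ?F"
    proof (rule AE_pmfI)
      fix B assume "B \<in> set_pmf ?X"
      then have B: "B \<in> M" "card B = r" "B \<subseteq> set us" using X by auto
      have "mext (\<lambda>u. (y u + ?c (j+2^p) u) + 2^p * \<beta> * of_bool (u \<in> B)) us f =
         mext (\<lambda>u. (y u + 2^p * \<beta> * of_bool (u \<in> B)) + ?c (j+2^p) u) us f"
        by (intro mext_cong) auto
      also have "\<dots> \<le> measure_pmf.expectation ?Y (\<lambda>C. mext (\<lambda>u. (y u + 2^p * \<beta> * of_bool (u \<in> B)) + 2^p * \<beta> * of_bool (u \<in> C)) us f)"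
      proof (rule Suc.IH)
        show "\<forall>u. 0 \<le> y u + 2^p * \<beta> * of_bool (u \<in> B) \<and> y u + 2^p * \<beta> * of_bool (u \<in> B) + 2^p * \<beta> \<le> 1"
        proof
          fix u show "0 \<le> y u + 2^p * \<beta> * of_bool (u \<in> B) \<and> y u + 2^p * \<beta> * of_bool (u \<in> B) + 2^p * \<beta> \<le> 1"
            using aux[OF pb y2] .
        qed
      qed (use Suc.prems in auto)
      also have "\<dots> \<le> measure_pmf.expectation ?Y (\<lambda>C. measure_pmf.expectation (merge M i B C) ?F)"
      proof (rule integral_mono_AE)
        show "AE C in ?Y. mext (\<lambda>u. (y u + 2^p * \<beta> * of_bool (u \<in> B)) + 2^p * \<beta> * of_bool (u \<in> C)) us f
               \<le> measure_pmf.expectation (merge M i B C) ?F"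
        proof (rule AE_pmfI)
          fix C assume "C \<in> set_pmf ?Y"
          then have C: "C \<in> M" "card C = r" "C \<subseteq> set us" using Y by auto
          have "card (B - C) \<le> i"
            using card_mono[OF indep_finite[OF B(1)], of "B - C"] B(2) i by auto
          then show "mext (\<lambda>u. (y u + 2^p * \<beta> * of_bool (u \<in> B)) + 2^p * \<beta> * of_bool (u \<in> C)) us f
               \<le> measure_pmf.expectation (merge M i B C) ?F"
            using merge_expectation[of B C i us y "2^p * \<beta>"] B C us y2 pb
            by (simp add: mult.assoc)
        qed
      qed (auto intro!: integrable_measure_pmf_finite finite_set_swap_round)
      also have "\<dots> = measure_pmf.expectation (?Y \<bind> (\<lambda>C. merge M i B C)) ?F"
        by (subst pmf_expectation_bind[where A = "set_pmf ?Y"])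
           (auto simp: finite_set_merge finite_set_swap_round integral_measure_pmf[of "set_pmf ?Y"])
      finally show "mext (\<lambda>u. (y u + ?c (j+2^p) u) + 2^p * \<beta> * of_bool (u \<in> B)) us f \<le>
       measure_pmf.expectation (?Y \<bind> (\<lambda>C. merge M i B C)) ?F" .
    qed
  qed (auto intro!: integrable_measure_pmf_finite finite_set_swap_round)
  also have "\<dots> = measure_pmf.expectation (swap_round M i (Suc p) T j) ?F"
    by (simp only: swap_round.simps, subst (2) pmf_expectation_bind[where A = "set_pmf ?X"])
       (auto simp: finite_set_merge finite_set_swap_round integral_measure_pmf[of "set_pmf ?X"])
  finally show ?case .
next
  case 0
  have "(\<Sum>l=j..<j+2^0. of_bool (u \<in> T l) :: real) = of_bool (u \<in> T j)" for u
    by (simp del: sum_of_bool_eq)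
  then show ?case by (simp only: swap_round.simps) simp
qed

lemma swap_round_expectation:
  assumes T: "\<forall>l<2^p. T l \<in> M \<and> card (T l) = r \<and> T l \<subseteq> set us" and i: "r \<le> i"
    and us: "distinct us" "set us \<subseteq> N"
  shows "mext (\<lambda>u. (\<Sum>l<2^p. of_bool (u \<in> T l)) / 2^p) us f \<le>
    measure_pmf.expectation (swap_round M i p T 0) f"
proof -
  have "mext (\<lambda>u. (\<Sum>l<2^p. of_bool (u \<in> T l)) / 2^p) us f \<le>
    measure_pmf.expectation (swap_round M i p T 0) (\<lambda>D. mext (\<lambda>u. of_bool (u \<in> D)) us f)"
  proof -
    have "mext (\<lambda>u. 0 + 1 / 2^p * (\<Sum>l=0..<0+2^p. of_bool (u \<in> T l))) us f \<le>
      measure_pmf.expectation (swap_round M i p T 0) (\<lambda>D. mext (\<lambda>u. 0 + 2^p * (1 / 2^p) * of_bool (u \<in> D)) us f)"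
      by (rule swap_round_expectation_aux[where r = r]) (use assms in auto)
    then show ?thesis by (simp only: atLeast0LessThan add_0 times_divide_eq_left mult_1) simp
  qed
  also have "\<dots> = measure_pmf.expectation (swap_round M i p T 0) f"
  proof (rule integral_cong_AE)
    show "AE D in swap_round M i p T 0. mext (\<lambda>u. of_bool (u \<in> D)) us f = f D"
    proof (rule AE_pmfI)
      fix D assume "D \<in> set_pmf (swap_round M i p T 0)"
      then have "D \<subseteq> set us" using set_swap_round[of 0 p T r "set us" i] T by auto
      then show "mext (\<lambda>u. of_bool (u \<in> D)) us f = f D"
        by (simp add: mext_indicator[OF us(2)] Int_absorb1)
    qed
  qed auto
  finally show ?thesis .
qed

end

declare sum_of_bool_eq [simp del] sum_mult_of_bool_eq [simp del] sum_of_bool_mult_eq [simp del]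

lemma sum_of_bool_card: "finite I \<Longrightarrow> (\<Sum>u\<in>I. of_bool (P u)) = real (card {u \<in> I. P u})"
  by (simp add: sum_of_bool_eq Int_def)

section \<open>Greedy layers\<close>

primrec layer :: "'a set set \<Rightarrow> ('a \<Rightarrow> nat) \<Rightarrow> nat \<Rightarrow> 'a list \<Rightarrow> 'a set" where
  "layer M lv i [] = {}"
| "layer M lv i (u # us) = (let A = layer M lv i us in
     if i \<le> lv u \<and> insert u A \<in> M then insert u A else A)"

text \<open>With thresholds measured in units of \<open>w0\<close>, this is the total length of the
  threshold intervals between \<open>1\<close> and \<open>q ^ l\<close> whose greedy sets accept
  \<open>u\<close>, divided by \<open>q ^ l\<close>, which stands for the marginal of
  \<open>u\<close>. The coordinate of \<open>u\<close> is about \<open>lam\<close> times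
  this.\<close>

definition share :: "real \<Rightarrow> 'a set set \<Rightarrow> ('a \<Rightarrow> nat) \<Rightarrow> 'a list \<Rightarrow> 'a \<Rightarrow> nat \<Rightarrow> real" where
  "share q M lv us u l =
     (\<Sum>i=1..l. (q ^ i - q ^ (i - 1)) * of_bool (insert u (layer M lv i us) \<in> M)) / q ^ l"

definition marg :: "('a set \<Rightarrow> real) \<Rightarrow> ('a \<Rightarrow> real) \<Rightarrow> 'a list \<Rightarrow> 'a \<Rightarrow> real" where
  "marg f a us u = mext a us (\<lambda>S. f (insert u S) - f S)"

text \<open>The list holds the elements processed so far, newest first. An element of level \<open>l \<ge> 1\<close>
  has weight about \<open>w0 * q ^ l\<close>; elements of level \<open>0\<close> are negligible.\<close>

definition good_at :: "real \<Rightarrow> real \<Rightarrow> real \<Rightarrow> real \<Rightarrow> real \<Rightarrow> real \<Rightarrow> ('a set \<Rightarrow> real) \<Rightarrow> 'a set set \<Rightarrow>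
    ('a \<Rightarrow> nat) \<Rightarrow> ('a \<Rightarrow> real) \<Rightarrow> 'a list \<Rightarrow> 'a \<Rightarrow> bool" where
  "good_at q lam mu e e0 w0 f M lv a us u \<longleftrightarrow>
     ({u} \<in> M \<and> lv u = 0 \<longrightarrow> marg f a us u \<le> e0) \<and>
     (lv u \<ge> 1 \<longrightarrow> {u} \<in> M \<and> (1 - e) * w0 * q ^ lv u \<le> marg f a us u \<and>
        marg f a us u \<le> (1 + e) * w0 * q ^ (lv u + 1)) \<and>
     0 \<le> a u \<and> lam * share q M lv us u (lv u) - mu \<le> a u \<and> a u \<le> lam * share q M lv us u (lv u)"

primrec good :: "real \<Rightarrow> real \<Rightarrow> real \<Rightarrow> real \<Rightarrow> real \<Rightarrow> real \<Rightarrow> ('a set \<Rightarrow> real) \<Rightarrow> 'a set set \<Rightarrow>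
    ('a \<Rightarrow> nat) \<Rightarrow> ('a \<Rightarrow> real) \<Rightarrow> 'a list \<Rightarrow> bool" where
  "good q lam mu e e0 w0 f M lv a [] = True"
| "good q lam mu e e0 w0 f M lv a (u # us) =
     (good_at q lam mu e e0 w0 f M lv a us u \<and> good q lam mu e e0 w0 f M lv a us)"

text \<open>The merging from the top level \<open>L\<close> down: \<open>B i\<close> is
  \<open>B (i + m)\<close> augmented from \<open>A i\<close>. Thus \<open>B i - B (i + m)\<close>
  lies in \<open>A i\<close>, and along a residue class modulo \<open>m\<close> these differences
  are disjoint.\<close>

definition chain :: "'a set set \<Rightarrow> (nat \<Rightarrow> 'a set) \<Rightarrow> nat \<Rightarrow> nat \<Rightarrow> (nat \<Rightarrow> 'a set) \<Rightarrow> bool" where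
  "chain M A L m B \<longleftrightarrow> (\<forall>i. B i \<in> M \<and> B (i + m) \<subseteq> B i \<and> B i \<subseteq> B (i + m) \<union> A i \<and>
     card (A i) \<le> card (B i) \<and> (L < i \<longrightarrow> B i = {}))"

text \<open>One merged set per residue class modulo \<open>m\<close>. They are padded to a common
  size \<open>r\<close> because swap rounding exchanges elements between sets of equal size.\<close>

definition family_of :: "'a set set \<Rightarrow> ('a \<Rightarrow> nat) \<Rightarrow> 'a list \<Rightarrow> nat \<Rightarrow> (nat \<Rightarrow> 'a set) \<Rightarrow> bool" where
  "family_of M lv us m T \<longleftrightarrow> (\<exists>B r L. (\<forall>u\<in>set us. lv u \<le> L) \<and> chain M (\<lambda>i. layer M lv i us) L m B \<and>
     (\<forall>j<m. T j \<in> M \<and> B j \<subseteq> T j \<and> T j \<subseteq> set us \<and> card (T j) = r))"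

lemma layer_subset: "layer M lv i us \<subseteq> {u \<in> set us. i \<le> lv u}"
  by (induction us) (auto simp: Let_def)

lemma layer_cong:
  "\<forall>u\<in>set us. lv u = lv' u \<Longrightarrow> layer M lv i us = layer M lv' i us"
  by (induction us) (auto simp: Let_def)

text \<open>Only sets of processed elements are tested for independence. So the analysis may use the
  matroid restricted to the window, and the algorithm may use any family that agrees with
  \<open>M\<close> on the elements seen so far.\<close>

lemma layer_restrict: "set us \<subseteq> V \<Longrightarrow> layer {S \<in> M. S \<subseteq> V} lv i us = layer M lv i us"
proof (induction us)
  case (Cons u us)
  then have "insert u (layer M lv i us) \<subseteq> V" using layer_subset[of M lv i us] by auto
  then show ?case using Cons by (simp add: Let_def)
qed simp

lemma share_cong:
  assumes "\<forall>v\<in>set us. lv v = lv' v"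
  shows "share q M lv us u l = share q M lv' us u l"
  unfolding share_def layer_cong[OF assms] ..

lemma share_restrict:
  assumes "insert u (set us) \<subseteq> V"
  shows "share q {S \<in> M. S \<subseteq> V} lv us u l = share q M lv us u l"
proof -
  have "insert u (layer M lv i us) \<subseteq> V" for i using assms layer_subset[of M lv i us] by auto
  then show ?thesis using assms by (auto simp: share_def layer_restrict)
qed

lemma marg_cong:
  assumes "\<forall>v\<in>set us. a v = a' v" shows "marg f a us u = marg f a' us u"
  unfolding marg_def using assms by (intro mext_cong) auto

lemma good_at_cong:
  assumes "\<forall>v\<in>insert u (set us). lv v = lv' v" "\<forall>v\<in>insert u (set us). a v = a' v"
  shows "good_at q lam mu e e0 w0 f M lv a us u = good_at q lam mu e e0 w0 f M lv' a' us u"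
proof -
  have "share q M lv us u l = share q M lv' us u l" for l using assms by (intro share_cong) auto
  moreover have "marg f a us u = marg f a' us u" using assms by (intro marg_cong) auto
  moreover have "lv u = lv' u" "a u = a' u" using assms by auto
  ultimately show ?thesis by (simp only: good_at_def)
qed

lemma good_cong:
  assumes "\<forall>v\<in>set us. lv v = lv' v" "\<forall>v\<in>set us. a v = a' v"
  shows "good q lam mu e e0 w0 f M lv a us = good q lam mu e e0 w0 f M lv' a' us"
  using assms
proof (induction us)
  case (Cons u us)
  have "good_at q lam mu e e0 w0 f M lv a us u = good_at q lam mu e e0 w0 f M lv' a' us u"
    using Cons.prems by (intro good_at_cong) simp_all
  moreover have "good q lam mu e e0 w0 f M lv a us = good q lam mu e e0 w0 f M lv' a' us"
    using Cons.prems by (intro Cons.IH) simp_all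
  ultimately show ?case by (simp only: good.simps)
qed simp

text \<open>The weight \<open>w0\<close> enters only at positive levels; this allows
  \<open>w0\<close> to be fixed late, when the first element of positive value arrives.\<close>

lemma good_level0_cong:
  assumes "\<forall>v\<in>set us. lv v = 0"
  shows "good q lam mu e e0 w0 f M lv a us = good q lam mu e e0 w1 f M lv a us"
  using assms by (induction us) (auto simp: good_at_def)

lemma telescope_pow: "(\<Sum>i=1..l. q ^ i - q ^ (i - 1)) = q ^ l - (1::real)"
  by (induction l) auto

lemma share_bounds:
  assumes "1 < q"
  shows "0 \<le> share q M lv us u l" "share q M lv us u l \<le> 1"
proof -
  have d: "0 \<le> q ^ i - q ^ (i - 1)" for i using assms by (simp add: power_increasing)
  then show "0 \<le> share q M lv us u l"
    unfolding share_def using assms by (intro divide_nonneg_nonneg sum_nonneg) auto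
  have "(\<Sum>i=1..l. (q ^ i - q ^ (i - 1)) * of_bool (insert u (layer M lv i us) \<in> M)) \<le>
     (\<Sum>i=1..l. q ^ i - q ^ (i - 1))"
    using d by (intro sum_mono) (auto simp: of_bool_def)
  also have "\<dots> = q ^ l - 1" by (rule telescope_pow)
  also have "\<dots> \<le> q ^ l" by simp
  finally show "share q M lv us u l \<le> 1" unfolding share_def using assms by (simp add: divide_le_eq)
qed

context matroid_on
begin

lemma layer_indep: "layer M lv i us \<in> M"
  by (induction us) (auto simp: Let_def indep_empty)

lemma layer_maximal:
  assumes "u \<in> set us" "i \<le> lv u" "insert u (layer M lv i us) \<in> M"
  shows "u \<in> layer M lv i us"
  using assms
proof (induction us)
  case (Cons v us)
  show ?case
  proof (cases "u = v")
    case True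
    then show ?thesis using Cons.prems by (auto simp: Let_def split: if_splits)
  next
    case False
    have "insert u (layer M lv i us) \<in> M"
      by (rule indep_down[OF Cons.prems(3)]) (auto simp: Let_def)
    then show ?thesis using Cons False by (auto simp: Let_def)
  qed
qed simp

text \<open>A rejected element stays dependent because layers only grow, so a layer is maximal among
  the elements of level at least \<open>i\<close>; in a matroid maximal independent sets are
  maximum.\<close>

lemma card_le_layer:
  assumes "I \<in> M" "I \<subseteq> {u \<in> set us. i \<le> lv u}"
  shows "card I \<le> card (layer M lv i us)"
proof (rule ccontr)
  assume "\<not> ?thesis"
  then obtain x where "x \<in> I - layer M lv i us" "insert x (layer M lv i us) \<in> M"
    using augment[OF layer_indep assms(1)] by (meson not_le)
  then show False using layer_maximal assms(2) by blast
qed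

text \<open>Constructed downwards from level \<open>Suc L\<close>, where all sets are empty. If
  \<open>B (i + m)\<close> is already larger than \<open>A i\<close>, it is kept unchanged.\<close>

lemma chain_exists:
  assumes A: "\<forall>i. A i \<in> M" "\<forall>i. L < i \<longrightarrow> A i = {}" and m: "0 < m"
  shows "\<exists>B. chain M A L m B"
proof -
  let ?P = "\<lambda>i B. B i \<in> M \<and> B (i + m) \<subseteq> B i \<and> B i \<subseteq> B (i + m) \<union> A i \<and>
     card (A i) \<le> card (B i) \<and> (L < i \<longrightarrow> B i = {})"
  have "\<exists>B. \<forall>i\<ge>i0. ?P i B" if "i0 \<le> Suc L" for i0
    using that
  proof (induction i0 rule: inc_induct)
    case base
    show ?case by (rule exI[of _ "\<lambda>_. {}"]) (use A indep_empty in auto)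
  next
    case (step i0)
    then obtain B where B: "\<forall>i\<ge>Suc i0. ?P i B" by blast
    have Bm: "B (i0 + m) \<in> M" using B m by simp
    obtain K where K: "K \<in> M" "B (i0 + m) \<subseteq> K" "K \<subseteq> B (i0 + m) \<union> A i0" "card (A i0) \<le> card K"
    proof (cases "card (B (i0 + m)) \<le> card (A i0)")
      case True
      then show ?thesis using extend[OF Bm A(1)[rule_format, of i0]] that by auto
    next
      case False
      then show ?thesis using that[of "B (i0 + m)"] Bm by auto
    qed
    have "?P i (B(i0 := K))" if i: "i0 \<le> i" for i
    proof (cases "i = i0")
      case True
      then show ?thesis using K m step.hyps by auto
    next
      case False
      then have "Suc i0 \<le> i" using i by simp
      then have "?P i B" using B by blast
      then show ?thesis using False i m by auto
    qed
    then show ?case by blast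
  qed
  from this[of 0] show ?thesis unfolding chain_def by auto
qed

lemma family_exists:
  assumes m: "0 < m"
  shows "\<exists>T. family_of M lv us m T"
proof -
  define L where "L = Max (insert 0 (lv ` set us))"
  have L: "\<forall>u\<in>set us. lv u \<le> L" unfolding L_def by auto
  have "layer M lv i us = {}" if "L < i" for i
    using layer_subset[of M lv i us] L that by fastforce
  then obtain B where B: "chain M (\<lambda>i. layer M lv i us) L m B"
    using chain_exists[of "\<lambda>i. layer M lv i us" L m] layer_indep m by auto
  have Bsub: "B j \<subseteq> set us" for j
  proof (induction "Suc L - j" arbitrary: j rule: less_induct)
    case less
    show ?case
    proof (cases "L < j")
      case True
      then show ?thesis using B by (auto simp: chain_def)
    next
      case False
      then have "B (j + m) \<subseteq> set us" using less m by auto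
      moreover have "B j \<subseteq> B (j + m) \<union> layer M lv j us"
        using B unfolding chain_def by blast
      ultimately show ?thesis using layer_subset[of M lv j us] by auto
    qed
  qed
  have fin: "finite {I \<in> M. I \<subseteq> set us}" using finite_M by simp
  define r where "r = Max (card ` {I \<in> M. I \<subseteq> set us})"
  have "r \<in> card ` {I \<in> M. I \<subseteq> set us}"
    unfolding r_def using fin indep_empty by (intro Max_in) auto
  then obtain I where I: "I \<in> M" "I \<subseteq> set us" "card I = r" by auto
  have le: "card J \<le> r" if "J \<in> M" "J \<subseteq> set us" for J
    unfolding r_def using fin that by (intro Max_ge) auto
  have "\<exists>K. K \<in> M \<and> B j \<subseteq> K \<and> K \<subseteq> set us \<and> card K = r" for j
  proof -
    have "B j \<in> M" using B by (auto simp: chain_def)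
    then obtain K where K: "K \<in> M" "B j \<subseteq> K" "K \<subseteq> B j \<union> I" "card K = card I"
      using extend[of "B j" I] le[of "B j"] Bsub[of j] I by auto
    then have "K \<subseteq> set us" using I Bsub[of j] by blast
    with K I show ?thesis by blast
  qed
  then obtain T where "\<forall>j. T j \<in> M \<and> B j \<subseteq> T j \<and> T j \<subseteq> set us \<and> card (T j) = r" by metis
  then show ?thesis using L B unfolding family_of_def by blast
qed

end

section \<open>The value of the fractional solution\<close>

text \<open>In the application \<open>lam\<close> is \<open>1 / xpar\<close>, \<open>mu\<close> is
  the error \<open>1 / H\<close> of rounding coordinates down, \<open>e\<close> is the relative
  error of the marginals, and \<open>e0\<close> bounds the marginals of the elements on level
  0.\<close>

locale streaming_analysis = submodular_matroid N f M
  for N :: "'a set" and f M +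
  fixes q lam mu e e0 w0 :: real and lv :: "'a \<Rightarrow> nat" and a :: "'a \<Rightarrow> real"
  assumes q: "1 < q" and lam: "0 \<le> lam" "lam \<le> 1" and e: "0 \<le> e" "e \<le> 1" and w0: "0 \<le> w0" and mu: "0 \<le> mu"
begin

abbreviation "good_list us \<equiv> good q lam mu e e0 w0 f M lv a us"

definition c :: "nat \<Rightarrow> real" where "c i = w0 * (q ^ i - q ^ (i - 1))"

text \<open>The integral \<open>W\<close> of the overview as a sum: \<open>c i\<close> is the length
  of the interval of thresholds represented by layer \<open>i\<close>. Thresholds below
  \<open>w0\<close> are left out.\<close>

definition weight :: "nat \<Rightarrow> 'a list \<Rightarrow> real" where
  "weight L us = (\<Sum>i=1..L. c i * card (layer M lv i us))"

lemma c_nonneg: "0 \<le> c i"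
  unfolding c_def using q w0 by (simp add: power_increasing)

lemma good_unit: "good_list us \<Longrightarrow> u \<in> set us \<Longrightarrow> 0 \<le> a u \<and> a u \<le> 1"
proof (induction us)
  case (Cons v us)
  have "lam * share q M lv us v (lv v) \<le> 1"
    using share_bounds[OF q] lam by (intro mult_le_one) auto
  then have "0 \<le> a v \<and> a v \<le> 1" using Cons.prems(1) by (auto simp: good_at_def)
  then show ?case using Cons by auto
qed simp

lemma weight_Cons:
  assumes "u \<notin> set us" "lv u \<le> L"
  shows "weight L (u # us) = weight L us + w0 * q ^ lv u * share q M lv us u (lv u)"
proof -
  have fin: "finite (layer M lv i us)" "u \<notin> layer M lv i us" for i
    using layer_subset[of M lv i us] assms by (auto intro: finite_subset)
  have "weight L (u # us) = (\<Sum>i=1..L. c i * card (layer M lv i us) +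
      (if i \<le> lv u then c i * of_bool (insert u (layer M lv i us) \<in> M) else 0))"
    unfolding weight_def using fin by (intro sum.cong) (auto simp: Let_def algebra_simps)
  also have "\<dots> = weight L us + (\<Sum>i=1..L. if i \<le> lv u then c i * of_bool (insert u (layer M lv i us) \<in> M) else 0)"
    by (simp add: sum.distrib weight_def)
  also have "(\<Sum>i=1..L. if i \<le> lv u then c i * of_bool (insert u (layer M lv i us) \<in> M) else 0) =
     (\<Sum>i=1..lv u. c i * of_bool (insert u (layer M lv i us) \<in> M))"
    using assms(2) by (intro sum.mono_neutral_cong_right) auto
  also have "\<dots> = w0 * q ^ lv u * share q M lv us u (lv u)"
  proof -
    have Q: "q ^ lv u \<noteq> 0" using q by simp
    have "(\<Sum>i=1..lv u. c i * of_bool (insert u (layer M lv i us) \<in> M)) = w0 *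
        (\<Sum>i=1..lv u. (q ^ i - q ^ (i - 1)) * of_bool (insert u (layer M lv i us) \<in> M))"
      unfolding c_def by (simp only: sum_distrib_left mult.assoc)
    moreover have "w0 * X = w0 * R * (X / R)" if "R \<noteq> 0" for X R using that by simp
    from this[OF Q] have "w0 * X = w0 * q ^ lv u * (X / q ^ lv u)" for X .
    ultimately show ?thesis unfolding share_def by (rule trans)
  qed
  finally show ?thesis .
qed

text \<open>The arrival of \<open>u\<close> gains \<open>a u\<close> times its marginal. The weight
  \<open>q ^ lv u\<close> in the denominator of the share cancels against the marginal, leaving a
  constant times the increase of \<open>weight\<close>.\<close>

lemma mext_le_weight:
  assumes "good_list us" "distinct us" "\<forall>u\<in>set us. lv u \<le> L"
  shows "mext a us f \<le> f {} + (1 + e) * q * lam * weight L us"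
  using assms
proof (induction us)
  case Nil
  then show ?case by (simp add: weight_def)
next
  case (Cons u us)
  let ?s = "share q M lv us u (lv u)"
  have g: "good_at q lam mu e e0 w0 f M lv a us u" using Cons.prems by simp
  have "a u * marg f a us u \<le> lam * ?s * ((1 + e) * w0 * q ^ (lv u + 1))"
  proof (cases "lv u = 0")
    case True
    then have "a u = 0" using g by (simp add: good_at_def share_def)
    then show ?thesis using True by (simp add: share_def)
  next
    case False
    then have "a u * marg f a us u \<le> a u * ((1 + e) * w0 * q ^ (lv u + 1))"
      using g by (intro mult_left_mono) (auto simp: good_at_def)
    also have "\<dots> \<le> lam * ?s * ((1 + e) * w0 * q ^ (lv u + 1))"
      using g e w0 q by (intro mult_right_mono) (auto simp: good_at_def)
    finally show ?thesis .
  qed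
  also have "\<dots> = (1 + e) * q * lam * (w0 * q ^ lv u * ?s)" by simp
  also have "w0 * q ^ lv u * ?s = weight L (u # us) - weight L us"
    using Cons.prems by (simp add: weight_Cons)
  finally have "mext a (u # us) f \<le> mext a us f + (1 + e) * q * lam * (weight L (u # us) - weight L us)"
    unfolding mext_step marg_def by simp
  also have "\<dots> \<le> f {} + (1 + e) * q * lam * weight L (u # us)"
    using Cons by (simp add: algebra_simps)
  finally show ?case .
qed

section \<open>Bounding the optimum by the layers\<close>

definition ub :: "'a \<Rightarrow> real" where
  "ub u = (if lv u = 0 then e0 else (1 + e) * w0 * q ^ (lv u + 1))"

lemma marg_le_ub: "good_at q lam mu e e0 w0 f M lv a us u \<Longrightarrow> {u} \<in> M \<Longrightarrow> marg f a us u \<le> ub u"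
  unfolding good_at_def ub_def by (metis One_nat_def Suc_leI neq0_conv)

text \<open>An element of \<open>O'\<close> adds at most its marginal on arrival, by submodularity.
  For an arriving \<open>u\<close> outside \<open>O'\<close>, its gain in the presence of
  \<open>O'\<close> is at most its gain in \<open>mext a (u # us) f\<close>.\<close>

lemma mext_union_le:
  assumes "good_list us" "distinct us" "set us \<subseteq> N" "O' \<subseteq> set us" "\<forall>u\<in>O'. {u} \<in> M"
  shows "mext a us (\<lambda>R. f (R \<union> O')) \<le> mext a us f + (\<Sum>u\<in>O'. ub u)"
  using assms
proof (induction us arbitrary: O')
  case (Cons u us)
  let ?O = "O' - {u}"
  have "\<forall>v\<in>set (u # us). 0 \<le> a v \<and> a v \<le> 1"
    using good_unit[OF Cons.prems(1)] by blast
  then have unit: "\<forall>v\<in>set us. 0 \<le> a v \<and> a v \<le> 1" and au: "0 \<le> a u" "a u \<le> 1"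
    by simp_all
  have IH: "mext a us (\<lambda>R. f (R \<union> ?O)) \<le> mext a us f + (\<Sum>v\<in>?O. ub v)"
    using Cons.prems by (intro Cons.IH) auto
  have m0: "mext a us (\<lambda>R. f (insert u R \<union> ?O) - f (R \<union> ?O)) \<le> marg f a us u"
    unfolding marg_def
  proof (rule mext_mono[OF unit], intro allI impI)
    fix S assume "S \<subseteq> set us"
    then show "f (insert u S \<union> ?O) - f (S \<union> ?O) \<le> f (insert u S) - f S"
      using f_submod[of S "S \<union> ?O" u] Cons.prems by auto
  qed
  have pos: "0 \<le> marg f a us u"
  proof -
    have "mext a us (\<lambda>_. 0) \<le> marg f a us u" unfolding marg_def
      using Cons.prems by (intro mext_mono[OF unit]) (auto intro!: f_mono)
    then show ?thesis by (simp add: mext_const)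
  qed
  have fo: "finite O'" using Cons.prems(4) finite_subset by blast
  show ?case
  proof (cases "u \<in> O'")
    case True
    have "mext a (u # us) (\<lambda>R. f (R \<union> O')) = mext a us (\<lambda>R. f (insert u R \<union> ?O))"
    proof -
      have "insert u R \<union> ?O = R \<union> O'" "insert u R \<union> O' = R \<union> O'" for R using True by auto
      then show ?thesis by (simp add: algebra_simps)
    qed
    also have "\<dots> \<le> mext a us (\<lambda>R. f (R \<union> ?O)) + marg f a us u"
      using m0 by (simp add: mext_diff)
    also have "\<dots> \<le> mext a us f + (\<Sum>v\<in>?O. ub v) + ub u"
      using IH marg_le_ub[of us u] Cons.prems True by auto
    also have "\<dots> = mext a us f + (\<Sum>v\<in>O'. ub v)" using True fo by (simp add: sum.remove)
    also have "\<dots> \<le> mext a (u # us) f + (\<Sum>v\<in>O'. ub v)"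
      using pos au unfolding mext_step marg_def by simp
    finally show ?thesis .
  next
    case False
    then have [simp]: "?O = O'" by auto
    have "mext a (u # us) (\<lambda>R. f (R \<union> O')) =
       mext a us (\<lambda>R. f (R \<union> O')) + a u * mext a us (\<lambda>R. f (insert u R \<union> ?O) - f (R \<union> ?O))"
      unfolding mext_step by simp
    also have "\<dots> \<le> mext a us f + (\<Sum>v\<in>O'. ub v) + a u * marg f a us u"
      using IH m0 au by (intro add_mono mult_left_mono) auto
    also have "\<dots> = mext a (u # us) f + (\<Sum>v\<in>O'. ub v)" unfolding mext_step marg_def by simp
    finally show ?thesis .
  qed
qed simp

lemma f_le_mext:
  assumes "good_list us" "distinct us" "set us \<subseteq> N" "O' \<subseteq> set us" "\<forall>u\<in>O'. {u} \<in> M"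
  shows "f O' \<le> mext a us f + (\<Sum>u\<in>O'. ub u)"
proof -
  have "f O' = mext a us (\<lambda>_. f O')" by (simp add: mext_const)
  also have "\<dots> \<le> mext a us (\<lambda>R. f (R \<union> O'))"
    using assms good_unit by (intro mext_mono) (auto intro!: f_mono)
  finally show ?thesis using mext_union_le[OF assms] by simp
qed

text \<open>A layer-cake argument: \<open>w0 * q ^ l\<close> is \<open>w0\<close> plus the intervals
  \<open>c i\<close> up to level \<open>l\<close>. Exchanging the sums counts the elements of
  \<open>I\<close> of level at least \<open>i\<close>, and the greedy layer has at least as
  many.\<close>

lemma sum_ub_le:
  assumes I: "I \<in> M" "I \<subseteq> set us" and L: "\<forall>u\<in>set us. lv u \<le> L" and k: "card I \<le> k" and e0: "0 \<le> e0"
  shows "(\<Sum>u\<in>I. ub u) \<le> k * e0 + (1 + e) * q * (k * w0 + weight L us)"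
proof -
  have fin: "finite I" using I indep_finite by blast
  have 1: "ub u \<le> e0 + (1 + e) * q * (w0 + (\<Sum>i=1..L. c i * of_bool (i \<le> lv u)))" if "u \<in> I" for u
  proof (cases "lv u = 0")
    case True
    have "0 \<le> (1 + e) * q * (w0 + (\<Sum>i=1..L. c i * of_bool (i \<le> lv u)))"
      using e q w0 c_nonneg by (intro mult_nonneg_nonneg add_nonneg_nonneg sum_nonneg) auto
    then show ?thesis using True by (simp add: ub_def)
  next
    case False
    have "(\<Sum>i=1..L. c i * of_bool (i \<le> lv u)) = (\<Sum>i=1..lv u. c i)"
      using L I that by (intro sum.mono_neutral_cong_right) auto
    also have "\<dots> = w0 * (\<Sum>i=1..lv u. q ^ i - q ^ (i - 1))"
      by (simp add: c_def sum_distrib_left)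
    also have "\<dots> = w0 * (q ^ lv u - 1)" by (simp only: telescope_pow)
    finally have "w0 * q ^ lv u = w0 + (\<Sum>i=1..L. c i * of_bool (i \<le> lv u))"
      by (simp add: algebra_simps)
    then have "(1 + e) * q * (w0 * q ^ lv u) = (1 + e) * q * (w0 + (\<Sum>i=1..L. c i * of_bool (i \<le> lv u)))"
      by simp
    then have "ub u = (1 + e) * q * (w0 + (\<Sum>i=1..L. c i * of_bool (i \<le> lv u)))"
      using False by (simp add: ub_def mult_ac)
    then show ?thesis using e0 by simp
  qed
  have "(\<Sum>u\<in>I. ub u) \<le> (\<Sum>u\<in>I. e0 + (1 + e) * q * (w0 + (\<Sum>i=1..L. c i * of_bool (i \<le> lv u))))"
    by (rule sum_mono) (rule 1)
  also have "\<dots> = card I * e0 + (1 + e) * q * (card I * w0 + (\<Sum>u\<in>I. \<Sum>i=1..L. c i * of_bool (i \<le> lv u)))"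
    by (simp add: sum.distrib sum_distrib_left[symmetric])
  also have "(\<Sum>u\<in>I. \<Sum>i=1..L. c i * of_bool (i \<le> lv u)) = (\<Sum>i=1..L. c i * card {u \<in> I. i \<le> lv u})"
    by (subst sum.swap) (simp only: sum_distrib_left[symmetric] sum_of_bool_card[OF fin])
  also have "card I * e0 + (1 + e) * q * (card I * w0 + (\<Sum>i=1..L. c i * card {u \<in> I. i \<le> lv u})) \<le>
     k * e0 + (1 + e) * q * (k * w0 + weight L us)"
  proof -
    have "card {u \<in> I. i \<le> lv u} \<le> card (layer M lv i us)" for i
      using I by (intro card_le_layer indep_down[OF I(1)]) auto
    then have "(\<Sum>i=1..L. c i * card {u \<in> I. i \<le> lv u}) \<le> weight L us"
      unfolding weight_def using c_nonneg by (intro sum_mono mult_left_mono) auto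
    then show ?thesis using k e0 e q w0
      by (intro add_mono mult_left_mono mult_right_mono) auto
  qed
  finally show ?thesis .
qed

lemma opt_le_weight:
  assumes "good_list us" "distinct us" "set us \<subseteq> N" "I \<in> M" "I \<subseteq> set us"
    "\<forall>u\<in>set us. lv u \<le> L" "card I \<le> k" "0 \<le> e0"
  shows "f I \<le> f {} + k * e0 + (1 + e) * q * k * w0 + (1 + e) * q * (1 + lam) * weight L us"
proof -
  have "\<forall>u\<in>I. {u} \<in> M" using indep_down[OF assms(4)] by auto
  then have "f I \<le> mext a us f + (\<Sum>u\<in>I. ub u)" using assms by (intro f_le_mext) auto
  also have "\<dots> \<le> (f {} + (1 + e) * q * lam * weight L us) +
      (k * e0 + (1 + e) * q * (k * w0 + weight L us))"
    using assms by (intro add_mono mext_le_weight sum_ub_le) auto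
  finally show ?thesis by (simp add: algebra_simps)
qed

section \<open>The value kept by the merged sets\<close>

lemma good_share_layer:
  assumes "good_list us" "distinct us" "u \<in> set us"
  shows "lam * ((\<Sum>i=1..lv u. (q ^ i - q ^ (i - 1)) * of_bool (u \<in> layer M lv i us)) / q ^ lv u) - mu \<le> a u"
  using assms
proof (induction us)
  case (Cons v us)
  show ?case
  proof (cases "u = v")
    case True
    have nu: "u \<notin> layer M lv i us" for i using layer_subset[of M lv i us] Cons.prems True by auto
    have "of_bool (u \<in> layer M lv i (v # us)) \<le> (of_bool (insert u (layer M lv i us) \<in> M) :: real)" for i
      using nu[of i] True by (cases "insert u (layer M lv i us) \<in> M") (simp_all add: Let_def)
    then have "(\<Sum>i=1..lv u. (q ^ i - q ^ (i - 1)) * of_bool (u \<in> layer M lv i (v # us))) \<le>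
      (\<Sum>i=1..lv u. (q ^ i - q ^ (i - 1)) * of_bool (insert u (layer M lv i us) \<in> M))"
      using q by (intro sum_mono mult_left_mono) (simp_all add: power_increasing del: layer.simps)
    then have "(\<Sum>i=1..lv u. (q ^ i - q ^ (i - 1)) * of_bool (u \<in> layer M lv i (v # us))) / q ^ lv u
        \<le> share q M lv us u (lv u)"
      unfolding share_def using q by (intro divide_right_mono) (assumption, simp)
    then have "lam * ((\<Sum>i=1..lv u. (q ^ i - q ^ (i - 1)) * of_bool (u \<in> layer M lv i (v # us))) / q ^ lv u)
        \<le> lam * share q M lv us u (lv u)"
      using lam by (intro mult_left_mono)
    moreover have "lam * share q M lv us v (lv v) - mu \<le> a v"
      using Cons.prems(1) by (simp add: good_at_def)
    ultimately show ?thesis unfolding True by linarith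
  next
    case False
    then have eq: "u \<in> layer M lv i (v # us) \<longleftrightarrow> u \<in> layer M lv i us" for i by (simp add: Let_def)
    have "good_list us" "distinct us" "u \<in> set us" using Cons.prems False by simp_all
    from Cons.IH[OF this] show ?thesis unfolding eq .
  qed
qed simp

text \<open>Marginals recorded against the growing point \<open>a\<close> are also lower bounds
  against the smaller point \<open>b\<close>, by submodularity. So the part of \<open>a\<close> that
  survives merging keeps its share of the value.\<close>

lemma mext_ge_lower:
  assumes "good_list us" "distinct us" "set us \<subseteq> N"
    and b: "\<forall>u\<in>set us. 0 \<le> b u \<and> b u \<le> a u"
  shows "f {} + (\<Sum>u\<in>set us. b u * ((1 - e) * w0 * q ^ lv u * of_bool (lv u \<ge> 1))) \<le> mext b us f"
  using assms
proof (induction us)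
  case (Cons u us)
  have unit: "\<forall>v\<in>set us. 0 \<le> b v \<and> b v \<le> a v \<and> a v \<le> 1"
    using good_unit[OF Cons.prems(1)] Cons.prems by auto
  have mono: "marg f a us u \<le> mext b us (\<lambda>S. f (insert u S) - f S)"
    unfolding marg_def
    using Cons.prems by (intro mext_antitone[OF unit] allI impI f_submod) auto
  have "mext a us (\<lambda>_. 0) \<le> marg f a us u" unfolding marg_def
    using Cons.prems unit by (intro mext_mono) (fastforce intro!: f_mono)+
  then have pos: "0 \<le> marg f a us u" by (simp add: mext_const)
  have "(1 - e) * w0 * q ^ lv u * of_bool (lv u \<ge> 1) \<le> marg f a us u"
    using Cons.prems pos by (auto simp: good_at_def)
  then have "b u * ((1 - e) * w0 * q ^ lv u * of_bool (lv u \<ge> 1)) \<le> b u * mext b us (\<lambda>S. f (insert u S) - f S)"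
    using mono Cons.prems by (intro mult_left_mono) auto
  then show ?case using Cons unfolding mext_step by auto
qed simp

text \<open>As \<open>c (i + m) = q ^ m * c i\<close>, the sum over the sets
  \<open>B (i + m)\<close> is at most \<open>1 / q ^ m\<close> of the sum over the
  \<open>B i\<close>. The rest is carried by the differences, and \<open>B i\<close> is at least as
  large as layer \<open>i\<close>.\<close>

lemma weight_chain:
  assumes B: "chain M (\<lambda>i. layer M lv i us) L m B"
  shows "(1 - 1 / q ^ m) * weight L us \<le> (\<Sum>i=1..L. c i * card (B i - B (i + m)))"
proof -
  let ?S = "\<Sum>i=1..L. c i * card (B i)"
  have fin: "finite (B i)" and sub: "B (i + m) \<subseteq> B i" for i
    using B indep_finite unfolding chain_def by auto
  have cm: "c i = c (i + m) / q ^ m" if "1 \<le> i" for i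
  proof -
    have "i + m - 1 = (i - 1) + m" using that by simp
    then show ?thesis using q by (simp add: c_def power_add field_simps)
  qed
  have "(\<Sum>i=1..L. c i * card (B (i + m))) = (\<Sum>i=1..L. c (i + m) * card (B (i + m))) / q ^ m"
    unfolding sum_divide_distrib
  proof (rule sum.cong)
    fix i assume "i \<in> {1..L}"
    then have "c i = c (i + m) / q ^ m" by (intro cm) simp
    then show "c i * card (B (i + m)) = c (i + m) * card (B (i + m)) / q ^ m" by simp
  qed simp
  also have "(\<Sum>i=1..L. c (i + m) * card (B (i + m))) = (\<Sum>i=1+m..L+m. c i * card (B i))"
    by (subst sum.shift_bounds_cl_nat_ivl) simp
  also have "\<dots> = (\<Sum>i\<in>{1+m..L+m} \<inter> {..L}. c i * card (B i))"
    using B by (intro sum.mono_neutral_right) (auto simp: chain_def)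
  also have "\<dots> \<le> ?S"
    using c_nonneg by (intro sum_mono2) auto
  finally have 1: "(\<Sum>i=1..L. c i * card (B (i + m))) \<le> ?S / q ^ m"
    using q by (simp add: divide_right_mono)
  have "(\<Sum>i=1..L. c i * card (B i - B (i + m))) = ?S - (\<Sum>i=1..L. c i * card (B (i + m)))"
    unfolding sum_subtractf[symmetric]
    using fin sub by (intro sum.cong) (auto simp: card_Diff_subset card_mono of_nat_diff algebra_simps)
  with 1 have 2: "(1 - 1 / q ^ m) * ?S \<le> (\<Sum>i=1..L. c i * card (B i - B (i + m)))"
    by (simp add: algebra_simps)
  have "weight L us \<le> ?S"
    unfolding weight_def using B c_nonneg by (intro sum_mono mult_left_mono) (auto simp: chain_def)
  moreover have "0 \<le> 1 - 1 / q ^ m" using q by simp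
  ultimately have "(1 - 1 / q ^ m) * weight L us \<le> (1 - 1 / q ^ m) * ?S" by (rule mult_left_mono)
  with 2 show ?thesis by linarith
qed

text \<open>The intermediate point \<open>b\<close> gives \<open>u\<close> only the thresholds at
  which \<open>u\<close> lies in a difference \<open>D i\<close>. It is below \<open>a\<close>, so
  its value is at least linear in its coordinates, and below the average of the sets
  \<open>T j\<close>, so monotonicity transfers the value to them.\<close>

lemma mext_family:
  assumes good: "good_list us" and us: "distinct us" "set us \<subseteq> N"
    and L: "\<forall>u\<in>set us. lv u \<le> L" and B: "chain M (\<lambda>i. layer M lv i us) L m B"
    and T: "\<forall>j<m. B j \<subseteq> T j" and m: "0 < m" "lam * (1 - 1 / q) * m \<le> 1"
    and E: "\<forall>u\<in>set us. {u} \<in> M \<longrightarrow> f {u} \<le> E" "0 \<le> E"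
  shows "f {} + (1 - e) * lam * (1 - 1 / q ^ m) * weight L us - length us * mu * E \<le>
    mext (\<lambda>u. (\<Sum>j<m. of_bool (u \<in> T j)) / m) us f"
proof -
  define D where "D i = B i - B (i + m)" for i
  define S where "S u = (\<Sum>i=1..L. (q ^ i - q ^ (i - 1)) * of_bool (u \<in> D i)) / q ^ lv u" for u
  define b where "b u = max 0 (lam * S u - mu)" for u
  let ?s = "\<lambda>u. (\<Sum>j<m. of_bool (u \<in> T j)) / real m"
  have Dl: "D i \<subseteq> layer M lv i us" for i using B unfolding chain_def D_def by auto
  then have Di: "i \<le> lv u" "u \<in> set us" if "u \<in> D i" for i u
    using that layer_subset[of M lv i us] by auto
  have d: "0 \<le> q ^ i - q ^ (i - 1)" for i using q by (simp add: power_increasing)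
  have ba: "0 \<le> b u \<and> b u \<le> a u" if u: "u \<in> set us" for u
  proof -
    have "(\<Sum>i=1..L. (q ^ i - q ^ (i - 1)) * of_bool (u \<in> D i)) =
       (\<Sum>i=1..lv u. (q ^ i - q ^ (i - 1)) * of_bool (u \<in> D i))"
      using L u Di by (intro sum.mono_neutral_cong_right) (auto simp: of_bool_def)
    also have "\<dots> \<le> (\<Sum>i=1..lv u. (q ^ i - q ^ (i - 1)) * of_bool (u \<in> layer M lv i us))"
      using d Dl by (intro sum_mono mult_left_mono) (auto simp: of_bool_def)
    finally have "S u \<le> (\<Sum>i=1..lv u. (q ^ i - q ^ (i - 1)) * of_bool (u \<in> layer M lv i us)) / q ^ lv u"
      unfolding S_def using q by (intro divide_right_mono) auto
    then have "lam * S u - mu \<le> a u"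
      using good_share_layer[OF good us(1) u] lam mult_left_mono[of _ _ lam] by (smt (verit))
    then show ?thesis using good_unit[OF good u] by (auto simp: b_def)
  qed
  have bs: "b u \<le> ?s u \<and> ?s u \<le> 1" if u: "u \<in> set us" for u
  proof -
    \<comment> \<open>The indicators of \<open>D i\<close> telescope along each residue class modulo
      \<open>m\<close>, leaving the first \<open>m\<close> sets \<open>B i\<close>; above
      \<open>L\<close> everything is empty.\<close>
    have "(\<Sum>i=1..L. of_bool (u \<in> D i) :: real) \<le> (\<Sum>i<Suc L. of_bool (u \<in> D i))"
      by (intro sum_mono2) auto
    also have "(\<Sum>i<Suc L. of_bool (u \<in> D i) :: real) =
       (\<Sum>i<Suc L. of_bool (u \<in> B i) - of_bool (u \<in> B (i + m)))"
      using B unfolding D_def chain_def by (intro sum.cong) (auto simp: of_bool_def)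
    also have "\<dots> = (\<Sum>i<Suc L. of_bool (u \<in> B i)) - (\<Sum>i<Suc L. of_bool (u \<in> B (i + m)))"
      by (rule sum_subtractf)
    also have "(\<Sum>i<Suc L. of_bool (u \<in> B (i + m)) :: real) = (\<Sum>i=m..<Suc L+m. of_bool (u \<in> B i))"
      using sum.shift_bounds_nat_ivl[of "\<lambda>i. of_bool (u \<in> B i) :: real" 0 m "Suc L"]
      by (simp add: atLeast0LessThan)
    also have "(\<Sum>i<Suc L. of_bool (u \<in> B i) :: real) = (\<Sum>i<Suc L+m. of_bool (u \<in> B i))"
      using B unfolding chain_def by (intro sum.mono_neutral_left) auto
    also have "\<dots> = (\<Sum>i<m. of_bool (u \<in> B i)) + (\<Sum>i=m..<Suc L+m. of_bool (u \<in> B i))"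
      using sum.atLeastLessThan_concat[of 0 m "Suc L+m" "\<lambda>i. of_bool (u \<in> B i) :: real"]
      by (simp add: atLeast0LessThan)
    finally have DB: "(\<Sum>i=1..L. of_bool (u \<in> D i) :: real) \<le> (\<Sum>i<m. of_bool (u \<in> B i))"
      by simp
    \<comment> \<open>Each single interval is at most the fraction \<open>1 - 1 / q\<close> of
      \<open>q ^ lv u\<close>. The assumption on \<open>lam\<close> and \<open>m\<close> makes
      \<open>lam\<close> times this fraction at most \<open>1 / m\<close>, the weight of one set in
      the average.\<close>
    have "(\<Sum>i=1..L. (q ^ i - q ^ (i - 1)) * of_bool (u \<in> D i)) \<le>
       (\<Sum>i=1..L. (1 - 1 / q) * q ^ lv u * of_bool (u \<in> D i))"
    proof (rule sum_mono)
      fix i assume i: "i \<in> {1..L}"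
      show "(q ^ i - q ^ (i - 1)) * of_bool (u \<in> D i) \<le> (1 - 1 / q) * q ^ lv u * of_bool (u \<in> D i)"
      proof (cases "u \<in> D i")
        case True
        have "q ^ i = q * q ^ (i - 1)" using i by (cases i) auto
        then have "q ^ i - q ^ (i - 1) = (1 - 1 / q) * q ^ i" using q by (simp add: field_simps)
        also have "\<dots> \<le> (1 - 1 / q) * q ^ lv u" using q Di[OF True]
          by (intro mult_left_mono power_increasing) auto
        finally show ?thesis using True by simp
      qed simp
    qed
    also have "\<dots> = (1 - 1 / q) * q ^ lv u * (\<Sum>i=1..L. of_bool (u \<in> D i))"
      by (simp add: sum_distrib_left)
    finally have "S u \<le> (1 - 1 / q) * (\<Sum>i=1..L. of_bool (u \<in> D i))"
      unfolding S_def using q by (simp add: divide_le_eq mult_ac)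
    then have "lam * S u \<le> lam * (1 - 1 / q) * (\<Sum>i=1..L. of_bool (u \<in> D i))"
      using lam by (metis mult.assoc mult_left_mono)
    also have "\<dots> \<le> (1 / m) * (\<Sum>i=1..L. of_bool (u \<in> D i))"
      using m by (intro mult_right_mono sum_nonneg) (auto simp: field_simps)
    also have "\<dots> \<le> (1 / m) * (\<Sum>i<m. of_bool (u \<in> B i))"
      using DB by (intro mult_left_mono) simp_all
    also have "\<dots> \<le> (1 / m) * (\<Sum>i<m. of_bool (u \<in> T i))"
      using T by (intro mult_left_mono sum_mono) (auto simp: of_bool_def)
    finally have "lam * S u \<le> ?s u" by simp
    moreover have "0 \<le> ?s u" by (intro divide_nonneg_nonneg sum_nonneg) auto
    moreover have "(\<Sum>j<m. of_bool (u \<in> T j) :: real) \<le> (\<Sum>j<m. 1)" by (intro sum_mono) auto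
    ultimately show ?thesis using mu m by (auto simp: b_def divide_le_eq)
  qed
  \<comment> \<open>Rounding a coordinate down loses at most \<open>mu\<close> times the marginal
    scale of \<open>u\<close>, which is bounded by \<open>f {u}\<close> and so by
    \<open>E\<close>.\<close>
  have bound: "lam * ((1 - e) * w0 * (q ^ lv u * S u)) - mu * E \<le> b u * ((1 - e) * w0 * q ^ lv u * of_bool (lv u \<ge> 1))"
    if u: "u \<in> set us" for u
  proof (cases "lv u = 0")
    case True
    have "u \<notin> D i" if "i \<in> {1..L}" for i using Di[of u i] True that by auto
    then have "S u = 0" unfolding S_def by simp
    then show ?thesis using True mu E(2) by simp
  next
    case False
    have "\<exists>vs. good_at q lam mu e e0 w0 f M lv a vs u \<and> set vs \<subseteq> N \<and> good_list vs"
      using good u us(2) by (induction us) auto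
    then obtain vs where vs: "good_at q lam mu e e0 w0 f M lv a vs u" "set vs \<subseteq> N" "good_list vs" by blast
    have uM: "{u} \<in> M" "(1 - e) * w0 * q ^ lv u \<le> marg f a vs u"
      using vs False by (auto simp: good_at_def)
    have "marg f a vs u \<le> mext a vs (\<lambda>_. f {u} - f {})"
      unfolding marg_def using vs good_unit u us
      by (intro mext_mono) (auto intro!: f_submod)
    also have "\<dots> \<le> E" using E(1) uM u nonneg[of "{}"] by (fastforce simp: mext_const)
    finally have "(1 - e) * w0 * q ^ lv u \<le> E" using uM by simp
    then have "mu * ((1 - e) * w0 * q ^ lv u) \<le> mu * E" using mu by (rule mult_left_mono)
    moreover have "(lam * S u - mu) * ((1 - e) * w0 * q ^ lv u) \<le> b u * ((1 - e) * w0 * q ^ lv u)"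
      using e w0 q by (intro mult_right_mono) (auto simp: b_def)
    ultimately show ?thesis using False by (simp add: algebra_simps)
  qed
  have "(1 - e) * lam * (1 - 1 / q ^ m) * weight L us \<le> (1 - e) * lam * (\<Sum>i=1..L. c i * card (D i))"
    using weight_chain[OF B] e lam unfolding D_def
    by (metis (no_types, lifting) diff_ge_0_iff_ge mult.assoc mult_left_mono mult_nonneg_nonneg)
  also have "(\<Sum>i=1..L. c i * card (D i)) = (\<Sum>u\<in>set us. w0 * (q ^ lv u * S u))"
  proof -
    have "(\<Sum>u\<in>set us. w0 * (q ^ lv u * S u)) = (\<Sum>u\<in>set us. \<Sum>i=1..L. c i * of_bool (u \<in> D i))"
    proof (rule sum.cong)
      fix u
      have Q: "q ^ lv u \<noteq> 0" using q by simp
      have "R * (Z / R) = Z" if "R \<noteq> 0" for R Z :: real using that by simp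
      from this[OF Q] have "q ^ lv u * S u = (\<Sum>i=1..L. (q ^ i - q ^ (i - 1)) * of_bool (u \<in> D i))"
        unfolding S_def .
      then show "w0 * (q ^ lv u * S u) = (\<Sum>i=1..L. c i * of_bool (u \<in> D i))"
        by (simp only: c_def sum_distrib_left mult.assoc)
    qed simp
    also have "\<dots> = (\<Sum>i=1..L. c i * (\<Sum>u\<in>set us. of_bool (u \<in> D i)))"
      by (subst sum.swap) (simp only: sum_distrib_left)
    also have "\<dots> = (\<Sum>i=1..L. c i * card (D i))"
    proof (intro sum.cong arg_cong2[of _ _ _ _ "(*)"] refl)
      fix i
      have "{u \<in> set us. u \<in> D i} = D i" using Di by auto
      then show "(\<Sum>u\<in>set us. of_bool (u \<in> D i)) = real (card (D i))"
        by (simp only: sum_of_bool_card[OF finite_set])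
    qed
    finally show ?thesis by simp
  qed
  also have "(1 - e) * lam * (\<Sum>u\<in>set us. w0 * (q ^ lv u * S u)) =
     (\<Sum>u\<in>set us. lam * ((1 - e) * w0 * (q ^ lv u * S u)))"
    by (simp add: sum_distrib_left mult_ac)
  also have "\<dots> = (\<Sum>u\<in>set us. lam * ((1 - e) * w0 * (q ^ lv u * S u)) - mu * E) + length us * mu * E"
    using us by (simp add: sum_subtractf distinct_card)
  also have "\<dots> \<le> (\<Sum>u\<in>set us. b u * ((1 - e) * w0 * q ^ lv u * of_bool (lv u \<ge> 1))) + length us * mu * E"
    by (intro add_right_mono sum_mono bound)
  finally have "f {} + (1 - e) * lam * (1 - 1 / q ^ m) * weight L us - length us * mu * E \<le>
     f {} + (\<Sum>u\<in>set us. b u * ((1 - e) * w0 * q ^ lv u * of_bool (lv u \<ge> 1)))" by simp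
  also have "\<dots> \<le> mext b us f" using ba by (intro mext_ge_lower good us) auto
  also have "\<dots> \<le> mext ?s us f"
    using ba bs us by (intro mext_monotone) (auto intro!: f_mono)
  finally show ?thesis .
qed

end

section \<open>Constants\<close>

text \<open>With \<open>x = 1.146\<close> close to the root of \<open>exp x = x + 2\<close>, the ratio
  \<open>(1 - exp (- x)) / (1 + x)\<close> is \<open>0.31784...\<close>; the surplus over \<open>0.3178\<close> absorbs the errors.\<close>

definition xpar :: real where "xpar = 1146 / 1000"
text \<open>The number of merged sets is a power of two because swap rounding halves the family; 21
  is the least exponent for which \<open>ratio\<close> is at most \<open>1 + eps\<close>.\<close>

definition win_exp :: nat where "win_exp = 21"
text \<open>Chosen so that \<open>(1 / xpar) * (1 - 1 / ratio) * 2 ^ win_exp\<close> is exactly 1,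
  the condition under which the average of the merged sets dominates; then
  \<open>ratio ^ (2 ^ win_exp)\<close> is close to \<open>exp xpar\<close>.\<close>

definition ratio :: real where "ratio = 1 / (1 - xpar / 2 ^ win_exp)"
definition eps :: real where "eps = 1 / 10 ^ 6"

lemma exp_xpar: "exp (- xpar) \<le> 31791 / 100000"
proof -
  have "(\<Sum>i<12. xpar ^ i /\<^sub>R fact i) \<le> exp xpar"
    unfolding exp_def by (rule sum_le_suminf[OF summable_exp_generic]) (auto simp: xpar_def)
  moreover have "100000 / 31791 \<le> (\<Sum>i<12. xpar ^ i /\<^sub>R fact i)"
    by (simp add: xpar_def eval_nat_numeral)
  ultimately have "100000 / 31791 \<le> exp xpar" by linarith
  then have "inverse (exp xpar) \<le> inverse (100000 / 31791)"
    by (intro le_imp_inverse_le) auto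
  then show ?thesis by (simp add: exp_minus)
qed

lemma ratio_gt_1: "1 < ratio" and ratio_le: "ratio \<le> 1 + eps"
  by (simp_all add: ratio_def xpar_def win_exp_def eps_def)

lemma inverse_ratio: "1 / ratio = 1 - xpar / 2 ^ win_exp"
  by (simp add: ratio_def)

lemma ratio_power: "1 / ratio ^ (2 ^ win_exp) \<le> 31791 / 100000"
proof -
  have "1 / ratio ^ (2 ^ win_exp) = (1 - xpar / 2 ^ win_exp) ^ (2 ^ win_exp)"
    by (simp add: power_one_over[symmetric] inverse_ratio)
  also have "\<dots> \<le> (exp (- (xpar / 2 ^ win_exp))) ^ (2 ^ win_exp)"
    using exp_ge_add_one_self[of "- (xpar / 2 ^ win_exp)"]
    by (intro power_mono) (simp_all add: xpar_def win_exp_def)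
  also have "\<dots> = exp (- xpar)"
    by (simp add: exp_of_nat_mult[symmetric])
  finally show ?thesis using exp_xpar by linarith
qed

text \<open>Numerically \<open>0.68209 / 2.146\<close> is \<open>0.31784...\<close>. The estimation
  errors lower this to \<open>0.31782\<close> and the last \<open>eps * E\<close> to
  \<open>0.31781\<close>; the distance \<open>1 / 10 ^ 5\<close> from \<open>0.3178\<close> is
  reserved for the success probability of rounding.\<close>

lemma final_ratio:
  fixes E W f0 :: real
  assumes nonneg: "0 \<le> E" "0 \<le> W" "0 \<le> f0"
    and upper: "E \<le> f0 + 3 * eps * E + (1 + eps) * ratio * eps * E + (1 + eps) * ratio * (1 + 1 / xpar) * W"
  shows "31781 / 100000 * E \<le> f0 + (1 - eps) * (1 / xpar) * (1 - 1 / ratio ^ (2 ^ win_exp)) * W - eps * E"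
proof -
  define A where "A = (1 - eps) * (1 / xpar) * (1 - 1 / ratio ^ (2 ^ win_exp))"
  define B where "B = (1 + eps) * (1 + eps) * (1 + 1 / xpar)"
  have "(1 - eps) * (1 / xpar) * (1 - 31791 / 100000) \<le> A"
    unfolding A_def using ratio_power by (intro mult_left_mono) (simp_all add: eps_def xpar_def)
  then have A: "(1 - eps) * (1 / xpar) * (68209 / 100000) \<le> A" by simp
  have B: "0 < B" by (simp add: B_def eps_def xpar_def)
  have r: "31782 / 100000 * B \<le> (1 - 6 * eps) * ((1 - eps) * (1 / xpar) * (68209 / 100000))"
    by (simp add: B_def eps_def xpar_def)
  have 1: "(1 + eps) * ratio * eps * E \<le> 2 * eps * E"
    using ratio_le nonneg by (intro mult_right_mono) (simp_all add: eps_def)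
  have "(1 + eps) * ratio * (1 + 1 / xpar) * W \<le> B * W"
    unfolding B_def using ratio_le nonneg by (intro mult_right_mono mult_left_mono) (simp_all add: eps_def xpar_def)
  with upper 1 have 2: "(1 - 5 * eps) * E \<le> f0 + B * W" by (simp add: algebra_simps)
  show ?thesis
  proof -
    have "(1 - 5 * eps) * E - f0 \<le> B * W" using 2 by simp
    then have W: "((1 - 5 * eps) * E - f0) / B \<le> W" using B by (simp add: divide_le_eq mult.commute)
    define a where "a = (1 - eps) * (1 / xpar) * (68209 / 100000 :: real)"
    have a: "0 < a" "a \<le> B" by (simp_all add: a_def B_def eps_def xpar_def)
    have "a / B * ((1 - 5 * eps) * E - f0) \<le> a * W"
      using mult_left_mono[OF W, of a] a by simp
    also have "\<dots> \<le> A * W" using A nonneg unfolding a_def by (intro mult_right_mono)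
    finally have 3: "a / B * ((1 - 5 * eps) * E) \<le> a / B * f0 + A * W" by (simp add: algebra_simps)
    have "a / B * f0 \<le> 1 * f0" using a B nonneg by (intro mult_right_mono) (simp_all add: divide_le_eq)
    with 3 have 4: "a / B * ((1 - 5 * eps) * E) \<le> f0 + A * W" by simp
    have "31782 / 100000 \<le> (1 - 6 * eps) * a / B"
      using r unfolding a_def by (simp only: pos_le_divide_eq[OF B])
    then have "31782 / 100000 \<le> (1 - 6 * eps) * (a / B)" by simp
    also have "\<dots> \<le> (1 - 5 * eps) * (a / B)" using a B by (intro mult_right_mono) (simp_all add: eps_def)
    finally have "31782 / 100000 * E \<le> (1 - 5 * eps) * (a / B) * E"
      using nonneg by (intro mult_right_mono)
    also have "(1 - 5 * eps) * (a / B) * E = a / B * ((1 - 5 * eps) * E)" by (simp only: mult_ac)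
    also note 4
    finally have "31782 / 100000 * E \<le> f0 + A * W" .
    moreover have "31781 / 100000 * E \<le> 31782 / 100000 * E - eps * E"
      using nonneg by (simp add: eps_def)
    ultimately show ?thesis unfolding A_def by linarith
  qed
qed

section \<open>The streaming algorithm\<close>

type_synonym state = "nat list \<times> (nat \<Rightarrow> nat) \<times> (nat \<Rightarrow> real) \<times> real \<times> real"

definition sample_set :: "nat \<Rightarrow> (nat \<Rightarrow> real) \<Rightarrow> nat list \<Rightarrow> (nat \<Rightarrow> nat) \<Rightarrow> nat set" where
  "sample_set H a us z = {v \<in> set us. real (z v) < real H * a v}"

definition estimate :: "nat \<Rightarrow> nat \<Rightarrow> (nat set \<Rightarrow> real) \<Rightarrow> (nat \<Rightarrow> real) \<Rightarrow> nat list \<Rightarrow> (nat \<Rightarrow> nat \<Rightarrow> nat) \<Rightarrow> nat \<Rightarrow> real" where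
  "estimate H s f a us zs u =
     (\<Sum>r<s. f (insert u (sample_set H a us (zs r))) - f (sample_set H a us (zs r))) / s"

definition level_of :: "real \<Rightarrow> real \<Rightarrow> nat" where
  "level_of w w0 = nat \<lfloor>log ratio (w / w0)\<rfloor>"

text \<open>Rounded down to a multiple of \<open>1 / H\<close>. Then comparing a uniform number
  below \<open>H\<close> with \<open>H * a v\<close>, as \<open>sample_set\<close> does, includes
  \<open>v\<close> with probability exactly \<open>a v\<close>.\<close>

definition prob_of :: "nat \<Rightarrow> real \<Rightarrow> real" where
  "prob_of H s = \<lfloor>H * ((1 / xpar) * s)\<rfloor> / H"

text \<open>The components of a state are the processed elements, their levels and probabilities, the
  largest value of a singleton, and the weight of level \<open>0\<close>, which is fixed when the first element
  of positive value arrives.\<close>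

fun step :: "nat \<Rightarrow> nat \<Rightarrow> nat \<Rightarrow> (nat set \<Rightarrow> real) \<Rightarrow> nat set set \<Rightarrow> (nat \<Rightarrow> nat \<Rightarrow> nat) \<Rightarrow> state \<Rightarrow> nat \<Rightarrow> state" where
  "step k H s f M zs (us, lv, a, D, w0) u =
     (if {u} \<notin> M then (u # us, lv(u := 0), a(u := 0), D, w0) else
      let D' = max D (f {u});
          w0' = (if w0 = 0 then eps * D' / k else w0);
          w = estimate H s f a us zs u;
          l = (if 0 < D' \<and> eps * D' / k \<le> w then level_of w w0' else 0)
      in (u # us, lv(u := l), a(u := prob_of H (share ratio M lv us u l)), D', w0'))"

definition init :: state where "init = ([], (\<lambda>_. 0), (\<lambda>_. 0), 0, 0)"

text \<open>The seed of a step is selected by its position in the order, not by the element. Orders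
  with a common initial part therefore share the states along it.\<close>

definition process :: "nat \<Rightarrow> nat \<Rightarrow> nat \<Rightarrow> (nat set \<Rightarrow> real) \<Rightarrow> nat set set \<Rightarrow> (nat \<Rightarrow> nat \<Rightarrow> nat \<Rightarrow> nat) \<Rightarrow> nat list \<Rightarrow> state" where
  "process k H s f M \<omega> es = foldl (\<lambda>st u. step k H s f M (\<omega> (length (fst st))) st u) init es"

fun dyadic :: "nat \<Rightarrow> state \<Rightarrow> bool" where
  "dyadic H (us, lv, a, D, w0) \<longleftrightarrow> (\<forall>v\<in>set us. \<exists>j\<le>H. a v = real j / real H)"

lemma level_of_bounds:
  assumes "0 < w0" "w0 \<le> w \<or> 1 \<le> level_of w w0" "0 < w"
  shows "w0 * ratio ^ level_of w w0 \<le> w" "w < w0 * ratio ^ (level_of w w0 + 1)"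
proof -
  let ?x = "log ratio (w / w0)"
  have "0 \<le> \<lfloor>?x\<rfloor>"
  proof (cases "w0 \<le> w")
    case True
    then show ?thesis using assms ratio_gt_1 by simp
  next
    case False
    then show ?thesis using assms(2) unfolding level_of_def by linarith
  qed
  then have l: "real (level_of w w0) = \<lfloor>?x\<rfloor>" by (simp add: level_of_def)
  have x: "ratio powr ?x = w / w0" using assms ratio_gt_1 by simp
  have pos: "0 < ratio" using ratio_gt_1 by simp
  have "ratio ^ level_of w w0 = ratio powr real (level_of w w0)" by (rule powr_realpow[OF pos, symmetric])
  also have "\<dots> = ratio powr \<lfloor>?x\<rfloor>" by (simp only: l)
  also have "\<dots> \<le> ratio powr ?x" using ratio_gt_1 by (intro powr_mono) auto
  finally show "w0 * ratio ^ level_of w w0 \<le> w" using assms(1) unfolding x by (simp add: field_simps)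
  have "ratio powr ?x < ratio powr (\<lfloor>?x\<rfloor> + 1)" using ratio_gt_1 by (intro powr_less_mono) linarith+
  then have "w / w0 < ratio powr (\<lfloor>?x\<rfloor> + 1)" by (simp only: x)
  also have "\<lfloor>?x\<rfloor> + 1 = real (level_of w w0 + 1)" by (simp only: l of_nat_add of_nat_1)
  also have "ratio powr \<dots> = ratio ^ (level_of w w0 + 1)" by (rule powr_realpow[OF pos])
  finally show "w < w0 * ratio ^ (level_of w w0 + 1)" using assms(1) by (simp add: field_simps)
qed

lemma prob_of:
  assumes "0 < H" "0 \<le> s" "s \<le> 1"
  shows "\<exists>j\<le>H. prob_of H s = real j / real H" "0 \<le> prob_of H s"
    "1 / xpar * s - 1 / H \<le> prob_of H s" "prob_of H s \<le> 1 / xpar * s"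
proof -
  let ?y = "H * ((1 / xpar) * s)"
  have "(1 / xpar) * s \<le> 1 * 1" using assms by (intro mult_mono) (auto simp: xpar_def)
  then have y: "0 \<le> ?y" "?y \<le> H" using assms mult_left_mono[of "(1 / xpar) * s" 1 H] by (auto simp: xpar_def)
  have "\<lfloor>?y\<rfloor> = int (nat \<lfloor>?y\<rfloor>)" using y by simp
  then have f: "prob_of H s = real (nat \<lfloor>?y\<rfloor>) / real H" unfolding prob_of_def using y by simp
  moreover have "nat \<lfloor>?y\<rfloor> \<le> H" using y by linarith
  ultimately show "\<exists>j\<le>H. prob_of H s = real j / real H" by blast
  show "0 \<le> prob_of H s" using f by simp
  have "?y - 1 \<le> \<lfloor>?y\<rfloor>" "\<lfloor>?y\<rfloor> \<le> ?y" by linarith+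
  then have "(?y - 1) / H \<le> prob_of H s" "prob_of H s \<le> ?y / H"
    unfolding prob_of_def using assms by (intro divide_right_mono; simp)+
  then show "1 / xpar * s - 1 / H \<le> prob_of H s" "prob_of H s \<le> 1 / xpar * s"
    using assms by (simp_all add: diff_divide_distrib)
qed

lemma fst_step: "fst (step k H s f M zs st u) = u # fst st"
  by (cases st) (simp add: Let_def)

lemma process_Nil: "process k H s f M \<omega> [] = init"
  by (simp add: process_def)

lemma fst_process: "fst (process k H s f M \<omega> es) = rev es"
  unfolding process_def by (induction es rule: rev_induct) (simp_all add: init_def fst_step)

lemma process_snoc:
  "process k H s f M \<omega> (es @ [u]) = step k H s f M (\<omega> (length es)) (process k H s f M \<omega> es) u"
  using fst_process[of k H s f M \<omega> es] by (simp add: process_def)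

lemma process_cong:
  "(\<forall>j<length es. \<omega> j = \<omega>' j) \<Longrightarrow> process k H s f M \<omega> es = process k H s f M \<omega>' es"
  by (induction es rule: rev_induct) (simp_all add: process_Nil process_snoc)

lemma dyadic_step:
  assumes "0 < H" "dyadic H st" "u \<notin> set (fst st)"
  shows "dyadic H (step k H s f M zs st u)"
proof -
  obtain us lv a D w0 where st: "st = (us, lv, a, D, w0)" by (cases st)
  have p: "\<exists>j\<le>H. prob_of H (share ratio M lv us u l) = real j / real H" for l
    using share_bounds[OF ratio_gt_1] assms by (intro prob_of) auto
  have z: "\<exists>j\<le>H. 0 = real j / real H" by (rule exI[of _ 0]) simp
  show ?thesis using assms(2,3) p z unfolding st by (auto simp: Let_def)
qed

lemma dyadic_process: "0 < H \<Longrightarrow> distinct es \<Longrightarrow> dyadic H (process k H s f M \<omega> es)"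
proof (induction es rule: rev_induct)
  case Nil
  then show ?case by (simp add: process_Nil init_def)
next
  case (snoc u es)
  then show ?case unfolding process_snoc by (intro dyadic_step) (auto simp: fst_process)
qed

lemma step_restrict:
  assumes "insert u (set (fst st)) \<subseteq> V"
  shows "step k H s f {S \<in> M. S \<subseteq> V} zs st u = step k H s f M zs st u"
proof -
  obtain us lv a D w0 where st: "st = (us, lv, a, D, w0)" by (cases st)
  have "share ratio {S \<in> M. S \<subseteq> V} lv us u l = share ratio M lv us u l" for l
    using assms st by (intro share_restrict) auto
  then show ?thesis using assms unfolding st by (simp add: Let_def)
qed

text \<open>The queries of a step are fixed by the state and the samples before any answer is known,
  so they can be asked as one list.\<close>

definition step_queries :: "nat \<Rightarrow> nat \<Rightarrow> (nat \<Rightarrow> nat \<Rightarrow> nat) \<Rightarrow> state \<Rightarrow> nat \<Rightarrow> nat set list" where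
  "step_queries H s zs st u = (case st of (us, lv, a, D, w0) \<Rightarrow>
     {u} # map (\<lambda>r. insert u (sample_set H a us (zs r))) [0..<s] @ map (\<lambda>r. sample_set H a us (zs r)) [0..<s])"

lemma length_step_queries: "length (step_queries H s zs st u) = 1 + 2 * s"
  by (cases st) (simp add: step_queries_def)

lemma step_queries_subset: "S \<in> set (step_queries H s zs st u) \<Longrightarrow> S \<subseteq> insert u (set (fst st))"
  by (cases st) (auto simp: step_queries_def sample_set_def)

lemma step_cong:
  assumes "\<forall>S\<in>set (step_queries H s zs st u). g S = f S"
  shows "step k H s g M zs st u = step k H s f M zs st u"
proof -
  obtain us lv a D w0 where st: "st = (us, lv, a, D, w0)" by (cases st)
  have "estimate H s g a us zs u = estimate H s f a us zs u"
    unfolding estimate_def using assms st by (auto simp: step_queries_def intro!: arg_cong2[of _ _ _ _ "(/)"] sum.cong)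
  moreover have "g {u} = f {u}" using assms st by (simp add: step_queries_def)
  ultimately show ?thesis unfolding st by (simp add: Let_def)
qed

section \<open>Accurate estimates suffice\<close>

locale streaming = submodular_matroid N f M
  for N :: "nat set" and f :: "nat set \<Rightarrow> real" and M :: "nat set set" +
  fixes k H s :: nat
  assumes k: "0 < k" "\<And>I. I \<in> M \<Longrightarrow> card I \<le> k" and H: "0 < H"
begin

text \<open>Elements on a positive level have an estimate of at least
  \<open>eps * max D (f {u}) / k\<close>; for them this additive tolerance is a relative error of at
  most \<open>eps\<close>.\<close>

fun accurate :: "(nat \<Rightarrow> nat \<Rightarrow> nat) \<Rightarrow> state \<Rightarrow> nat \<Rightarrow> bool" where
  "accurate zs (us, lv, a, D, w0) u \<longleftrightarrow> ({u} \<in> M \<longrightarrow>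
     \<bar>estimate H s f a us zs u - marg f a us u\<bar> \<le> eps ^ 2 * max D (f {u}) / k)"

fun inv :: "real \<Rightarrow> state \<Rightarrow> bool" where
  "inv E (us, lv, a, D, w0) \<longleftrightarrow> distinct us \<and> set us \<subseteq> N \<and> 0 \<le> D \<and> D \<le> E \<and> 0 \<le> w0 \<and> w0 \<le> eps * D / k \<and>
     (w0 = 0 \<longrightarrow> D = 0 \<and> (\<forall>v\<in>set us. lv v = 0)) \<and>
     good ratio (1 / xpar) (1 / H) eps (3 * eps * E / k) w0 f M lv a us"

lemma inv_step:
  assumes inv: "inv E st" and acc: "accurate zs st u" and u: "u \<in> N" "u \<notin> set (fst st)"
    and E: "{u} \<in> M \<Longrightarrow> f {u} \<le> E"
  shows "inv E (step k H s f M zs st u)"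
proof -
  obtain us lv a D w0 where st: "st = (us, lv, a, D, w0)" by (cases st)
  note I = inv[unfolded st inv.simps]
  have uu: "u \<notin> set us" using u st by simp
  have good_upd: "good ratio lam mu e e0 w f M (lv(u := l)) (a(u := p)) us =
      good ratio lam mu e e0 w f M lv a us" for lam mu e e0 w l p
    using uu by (intro good_cong) auto
  have marg_upd: "marg f (a(u := p)) us u = marg f a us u" for p
    using uu by (intro marg_cong) auto
  have share_upd: "share ratio M (lv(u := l)) us u m = share ratio M lv us u m" for l m
    using uu by (intro share_cong) auto
  show ?thesis
  proof (cases "{u} \<in> M")
    case False
    have "insert u (layer M lv i us) \<notin> M" for i
      using False indep_down[of "insert u (layer M lv i us)" "{u}"] by auto
    then have "good_at ratio (1 / xpar) (1 / H) eps (3 * eps * E / k) w0 f M (lv(u := 0)) (a(u := 0)) us u"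
      using False H by (simp add: good_at_def share_def)
    then show ?thesis using I False u uu unfolding st by (auto simp: good_upd)
  next
    case True
    define D' where "D' = max D (f {u})"
    define w0' where "w0' = (if w0 = 0 then eps * D' / k else w0)"
    define w where "w = estimate H s f a us zs u"
    define l where "l = (if 0 < D' \<and> eps * D' / k \<le> w then level_of w w0' else 0)"
    define p where "p = prob_of H (share ratio M lv us u l)"
    have st': "step k H s f M zs st u = (u # us, lv(u := l), a(u := p), D', w0')"
      using True unfolding st by (simp add: Let_def D'_def w0'_def w_def l_def p_def)
    have D': "0 \<le> D'" "D' \<le> E" "D \<le> D'" using I E[OF True] by (auto simp: D'_def)
    define t where "t = eps * D' / k"
    define eE where "eE = eps * E / k"
    have acc': "\<bar>w - marg f a us u\<bar> \<le> eps * t"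
      using acc True unfolding st by (simp add: w_def D'_def t_def power2_eq_square mult.assoc)
    have t0: "t = 0" if "D' = 0" using that by (simp add: t_def)
    have e3: "3 * eps * E / k = 3 * eE" by (simp add: eE_def)
    have ek: "0 < eps / k" using k by (simp add: eps_def)
    have w0': "0 \<le> w0'" "w0' \<le> t" "0 < D' \<longrightarrow> 0 < w0'"
    proof -
      have "eps * D / k \<le> t" unfolding t_def using D' by (intro divide_right_mono mult_left_mono) (auto simp: eps_def)
      then show "w0' \<le> t" using I by (auto simp: w0'_def t_def)
      show "0 \<le> w0'" using I D' k by (auto simp: w0'_def eps_def)
      show "0 < D' \<longrightarrow> 0 < w0'" using I k by (auto simp: w0'_def eps_def)
    qed
    have good': "good ratio (1 / xpar) (1 / H) eps (3 * eps * E / k) w0' f M lv a us"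
    proof (cases "w0 = 0")
      case True
      then show ?thesis using I good_level0_cong[of us lv] by metis
    next
      case False
      then show ?thesis using I by (simp add: w0'_def)
    qed
    have DE: "t \<le> eE" unfolding t_def eE_def using D' by (intro divide_right_mono mult_left_mono) (auto simp: eps_def)
    have eD: "0 \<le> t" using D' k by (simp add: eps_def t_def)
    have "good_at ratio (1 / xpar) (1 / H) eps (3 * eps * E / k) w0' f M (lv(u := l)) (a(u := p)) us u"
    proof -
      \<comment> \<open>Level 0 means that the estimate is below the cut-off \<open>t\<close> or
        below \<open>w0' * ratio\<close>, hence at most \<open>2 * t\<close> in either case; with
        the tolerance \<open>eps * t\<close> the marginal is at most \<open>3 * t\<close>.\<close>
      have "marg f a us u \<le> 3 * eps * E / k" if "l = 0"
      proof -
        have "w \<le> 2 * t"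
        proof (cases "0 < D' \<and> t \<le> w")
          case T: True
          then have "0 < w0'" "w0' \<le> w" using w0' by auto
          then have "w < w0' * ratio ^ (level_of w w0' + 1)" by (intro level_of_bounds) auto
          also have "level_of w w0' = 0" using that T by (simp add: l_def t_def)
          also have "w0' * ratio ^ (0 + 1) \<le> t * 2"
            using w0' ratio_le ratio_gt_1 by (intro mult_mono) (auto simp: eps_def)
          also have "t * 2 = 2 * t" by (rule mult.commute)
          finally show ?thesis by (rule less_imp_le)
        next
          case F: False
          show ?thesis
          proof (cases "0 < D'")
            case True
            then show ?thesis using F eD by auto
          next
            case False
            \<comment> \<open>No singleton of positive value has arrived, so the marginal of
              \<open>u\<close> cannot be positive, and the permitted error is 0.\<close>
            then have D0: "D' = 0" using D' by simp
            then have "w - marg f a us u \<le> 0" using acc' t0[OF D0] by simp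
            moreover have "marg f a us u \<le> 0"
            proof -
              have "marg f a us u \<le> mext a us (\<lambda>_. 0)" unfolding marg_def
              proof (rule mext_mono)
                show "\<forall>v\<in>set us. 0 \<le> a v \<and> a v \<le> 1"
                proof -
                  interpret S: streaming_analysis N f M ratio "1 / xpar" "1 / H" eps "3 * eps * E / k" w0' lv a
                    using ratio_gt_1 w0' by unfold_locales (auto simp: xpar_def eps_def)
                  show ?thesis using S.good_unit[OF good'] by blast
                qed
                show "\<forall>S. S \<subseteq> set us \<longrightarrow> f (insert u S) - f S \<le> 0"
                proof (intro allI impI)
                  fix S assume S: "S \<subseteq> set us"
                  have "f (insert u S) - f S \<le> f (insert u {}) - f {}"
                    using S I u by (intro f_submod) auto
                  also have "\<dots> \<le> 0" using D0 nonneg[of "{}"] by (simp add: D'_def max_def split: if_splits)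
                  finally show "f (insert u S) - f S \<le> 0" .
                qed
              qed
              then show ?thesis by (simp add: mext_const)
            qed
            ultimately show ?thesis using acc' t0[OF D0] eD by linarith
          qed
        qed
        then have "marg f a us u \<le> 2 * t + eps * t"
          using acc' by linarith
        also have "\<dots> \<le> 3 * t" using eD by (simp add: eps_def)
        also have "\<dots> \<le> 3 * eE" using DE by simp
        finally show ?thesis unfolding e3 .
      qed
      \<comment> \<open>A positive level requires \<open>t \<le> w\<close>, which turns the error
        \<open>eps * t\<close> into at most \<open>eps * w\<close>.\<close>
      moreover have "(1 - eps) * w0' * ratio ^ l \<le> marg f a us u \<and>
          marg f a us u \<le> (1 + eps) * w0' * ratio ^ (l + 1)" if "1 \<le> l"
      proof -
        have T: "0 < D'" "t \<le> w" and l: "l = level_of w w0'"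
          using that by (auto simp: l_def t_def split: if_splits)
        have w: "0 < w0'" "w0' \<le> w" using T w0' by auto
        have b: "w0' * ratio ^ l \<le> w" "w < w0' * ratio ^ (l + 1)"
          unfolding l using level_of_bounds[of w0' w] w by simp_all
        have "eps * t \<le> eps * w" using T by (intro mult_left_mono) (auto simp: eps_def)
        then have m: "\<bar>w - marg f a us u\<bar> \<le> eps * w" using acc' by linarith
        have "(1 - eps) * (w0' * ratio ^ l) \<le> (1 - eps) * w" using b by (intro mult_left_mono) (auto simp: eps_def)
        moreover have "(1 + eps) * w \<le> (1 + eps) * (w0' * ratio ^ (l + 1))"
          using b by (intro mult_left_mono) (auto simp: eps_def)
        ultimately show ?thesis using m by (auto simp: algebra_simps abs_le_iff)
      qed
      moreover have "0 \<le> p" "1 / xpar * share ratio M lv us u l - 1 / H \<le> p" "p \<le> 1 / xpar * share ratio M lv us u l"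
        unfolding p_def using prob_of[OF H share_bounds[OF ratio_gt_1]] by auto
      ultimately show ?thesis using True
        unfolding good_at_def marg_upd share_upd by (auto simp: share_upd)
    qed
    moreover have "w0' \<le> eps * D' / k" using w0'(2) unfolding t_def .
    moreover have "w0' = 0 \<longrightarrow> D' = 0 \<and> (\<forall>v\<in>set (u # us). (lv(u := l)) v = 0)"
    proof
      assume z: "w0' = 0"
      then have "D' = 0" using w0'(3) D'(1) by linarith
      moreover from this have "l = 0" by (simp add: l_def)
      moreover have "w0 = 0" using z unfolding w0'_def by (cases "w0 = 0") simp_all
      ultimately show "D' = 0 \<and> (\<forall>v\<in>set (u # us). (lv(u := l)) v = 0)" using I by simp
    qed
    ultimately show ?thesis
      unfolding st' inv.simps using I u(1) uu D' w0'(1) good' by (simp add: good_upd) metis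
  qed
qed

lemma inv_process:
  assumes "distinct es" "set es \<subseteq> N" "\<forall>u\<in>set es. {u} \<in> M \<longrightarrow> f {u} \<le> E" "0 \<le> E"
    and "\<forall>j<length es. accurate (\<omega> j) (process k H s f M \<omega> (take j es)) (es ! j)"
  shows "inv E (process k H s f M \<omega> es)"
  using assms
proof (induction es rule: rev_induct)
  case Nil
  then show ?case by (simp add: process_Nil init_def)
next
  case (snoc u es)
  have acc: "accurate (\<omega> j) (process k H s f M \<omega> (take j es)) (es ! j)" if "j < length es" for j
    using snoc.prems(5)[rule_format, of j] that by (simp add: nth_append)
  have "inv E (process k H s f M \<omega> es)" using snoc acc by auto
  moreover have "accurate (\<omega> (length es)) (process k H s f M \<omega> es) u"
    using snoc.prems(5)[rule_format, of "length es"] by simp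
  ultimately show ?case
    unfolding process_snoc using snoc.prems by (intro inv_step) (auto simp: fst_process)
qed

text \<open>The optimum \<open>E\<close> dominates \<open>D\<close>, which makes all losses
  relative: level 0 elements cost \<open>3 * eps * E\<close> in total, the missing thresholds are
  covered by \<open>k * w0 \<le> eps * E\<close>, and rounding coordinates costs
  \<open>length us / H * E \<le> eps * E\<close>.\<close>

lemma inv_mext:
  assumes inv: "inv E (us, lv, a, D, w0)" and H': "length us \<le> eps * H"
    and E: "\<forall>u\<in>set us. {u} \<in> M \<longrightarrow> f {u} \<le> E" and I: "I \<in> M" "I \<subseteq> set us" "E = f I"
    and T: "family_of M lv us (2 ^ win_exp) T"
  shows "31781 / 100000 * E \<le> mext (\<lambda>u. (\<Sum>j<2 ^ win_exp. of_bool (u \<in> T j)) / 2 ^ win_exp) us f"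
proof -
  note J = inv[unfolded inv.simps]
  have E0: "0 \<le> E" using J by linarith
  interpret S: streaming_analysis N f M ratio "1 / xpar" "1 / H" eps "3 * eps * E / k" w0 lv a
    using ratio_gt_1 J by unfold_locales (auto simp: xpar_def eps_def)
  obtain B r L where L: "\<forall>u\<in>set us. lv u \<le> L" and B: "chain M (\<lambda>i. layer M lv i us) L (2 ^ win_exp) B"
    and BT: "\<forall>j<2 ^ win_exp. B j \<subseteq> T j"
    using T unfolding family_of_def by blast
  define W where "W = S.weight L us"
  have W: "0 \<le> W" unfolding W_def S.weight_def using S.c_nonneg by (intro sum_nonneg) simp
  have up: "f I \<le> f {} + k * (3 * eps * E / k) + (1 + eps) * ratio * k * w0 + (1 + eps) * ratio * (1 + 1 / xpar) * W"
    unfolding W_def using J I L E0 k by (intro S.opt_le_weight) (auto simp: eps_def)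
  have kw: "k * w0 \<le> eps * E"
  proof -
    have "k * w0 \<le> k * (eps * D / k)" using J by (intro mult_left_mono) auto
    also have "\<dots> = eps * D" using k by simp
    also have "\<dots> \<le> eps * E" using J by (intro mult_left_mono) (auto simp: eps_def)
    finally show ?thesis .
  qed
  have "(1 + eps) * ratio * (k * w0) \<le> (1 + eps) * ratio * (eps * E)"
    using kw ratio_gt_1 by (intro mult_left_mono) (auto simp: eps_def)
  then have up': "E \<le> f {} + 3 * eps * E + (1 + eps) * ratio * eps * E + (1 + eps) * ratio * (1 + 1 / xpar) * W"
    using up I k by (simp add: mult.assoc)
  have "f {} + (1 - eps) * (1 / xpar) * (1 - 1 / ratio ^ (2 ^ win_exp)) * W - length us * (1 / H) * E \<le>
     mext (\<lambda>u. (\<Sum>j<2 ^ win_exp. of_bool (u \<in> T j)) / real (2 ^ win_exp)) us f"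
    unfolding W_def
  proof (rule S.mext_family)
    show "1 / xpar * (1 - 1 / ratio) * real (2 ^ win_exp) \<le> 1"
      unfolding inverse_ratio by (simp add: xpar_def)
  qed (use J L B BT E E0 in auto)
  moreover have "length us * (1 / H) * E \<le> eps * E"
    using H' H E0 by (intro mult_right_mono) (auto simp: field_simps)
  ultimately have "f {} + (1 - eps) * (1 / xpar) * (1 - 1 / ratio ^ (2 ^ win_exp)) * W - eps * E \<le>
     mext (\<lambda>u. (\<Sum>j<2 ^ win_exp. of_bool (u \<in> T j)) / 2 ^ win_exp) us f" by simp
  moreover have "0 \<le> f {}" by (simp add: nonneg)
  ultimately show ?thesis using final_ratio[OF E0 W _ up'] by linarith
qed

end

section \<open>Probability estimates\<close>

lemma prob_bind_le_mult:
  assumes "\<And>x. x \<in> set_pmf p \<Longrightarrow> x \<in> B \<Longrightarrow> measure_pmf.prob (g x) A \<le> c"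
    and "\<And>x. x \<in> set_pmf p \<Longrightarrow> x \<notin> B \<Longrightarrow> measure_pmf.prob (g x) A = 0" and "0 \<le> c"
  shows "measure_pmf.prob (bind_pmf p g) A \<le> c * measure_pmf.prob p B"
proof -
  have "emeasure (bind_pmf p g) A = (\<integral>\<^sup>+x. emeasure (g x) A \<partial>p)" by simp
  also have "\<dots> \<le> (\<integral>\<^sup>+x. ennreal c * indicator B x \<partial>p)"
  proof (rule nn_integral_mono_AE, rule AE_pmfI)
    fix x assume "x \<in> set_pmf p"
    then show "emeasure (g x) A \<le> ennreal c * indicator B x"
      using assms(1)[of x] assms(2)[of x]
      by (cases "x \<in> B") (auto simp: measure_pmf.emeasure_eq_measure intro: ennreal_leI)
  qed
  also have "\<dots> = ennreal c * emeasure p B" by (simp add: nn_integral_cmult)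
  finally show ?thesis
    using assms(3) by (simp add: measure_pmf.emeasure_eq_measure flip: ennreal_mult)
qed

lemma prob_bind_le:
  assumes "\<And>x. x \<in> set_pmf p \<Longrightarrow> measure_pmf.prob (g x) A \<le> c"
  shows "measure_pmf.prob (bind_pmf p g) A \<le> c"
proof -
  obtain x where "x \<in> set_pmf p" using set_pmf_not_empty[of p] by blast
  then have "0 \<le> c" using assms[of x] measure_nonneg order_trans by blast
  then show ?thesis using prob_bind_le_mult[of p UNIV g A c] assms by simp
qed

lemma prob_bind_le_add:
  assumes "\<And>x. x \<in> set_pmf p \<Longrightarrow> x \<notin> B \<Longrightarrow> measure_pmf.prob (g x) A \<le> c" and "0 \<le> c"
  shows "measure_pmf.prob (bind_pmf p g) A \<le> measure_pmf.prob p B + c"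
proof -
  have "emeasure (bind_pmf p g) A = (\<integral>\<^sup>+x. emeasure (g x) A \<partial>p)" by simp
  also have "\<dots> \<le> (\<integral>\<^sup>+x. indicator B x + ennreal c \<partial>p)"
  proof (rule nn_integral_mono_AE, rule AE_pmfI)
    fix x assume "x \<in> set_pmf p"
    then show "emeasure (g x) A \<le> indicator B x + ennreal c"
      using assms(1)[of x] measure_pmf.prob_le_1[of "g x" A]
      by (cases "x \<in> B") (auto simp: measure_pmf.emeasure_eq_measure add_increasing2 intro: ennreal_leI)
  qed
  also have "\<dots> = emeasure p B + ennreal c" by (simp add: nn_integral_add)
  finally show ?thesis
    using assms(2) by (simp add: measure_pmf.emeasure_eq_measure flip: ennreal_plus)
qed

lemma finite_set_Pi_pmf:
  assumes "finite A" "\<And>x. x \<in> A \<Longrightarrow> finite (set_pmf (p x))"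
  shows "finite (set_pmf (Pi_pmf A d p))"
  using assms by (simp add: set_Pi_pmf finite_PiE_dflt)

section \<open>Random seeds and unbiased samples\<close>

definition point_pmf :: "nat set \<Rightarrow> nat \<Rightarrow> (nat \<Rightarrow> nat) pmf" where
  "point_pmf N H = Pi_pmf N 0 (\<lambda>_. pmf_of_set {..<H})"

definition sample_pmf :: "nat set \<Rightarrow> nat \<Rightarrow> nat \<Rightarrow> (nat \<Rightarrow> nat \<Rightarrow> nat) pmf" where
  "sample_pmf N H s = Pi_pmf {..<s} (\<lambda>_. 0) (\<lambda>_. point_pmf N H)"

definition seed_pmf :: "nat set \<Rightarrow> nat \<Rightarrow> nat \<Rightarrow> nat \<Rightarrow> (nat \<Rightarrow> nat \<Rightarrow> nat \<Rightarrow> nat) pmf" where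
  "seed_pmf N H s n = Pi_pmf {..<n} (\<lambda>_ _. 0) (\<lambda>_. sample_pmf N H s)"

lemma finite_set_point_pmf: "finite N \<Longrightarrow> 0 < H \<Longrightarrow> finite (set_pmf (point_pmf N H))"
  unfolding point_pmf_def by (intro finite_set_Pi_pmf) (auto simp: set_pmf_of_set lessThan_empty_iff)

text \<open>With \<open>a u = j / H\<close>, exactly \<open>j\<close> of the \<open>H\<close> values
  of the coordinate \<open>u\<close> put \<open>u\<close> into the sample, so discretisation causes
  no bias.\<close>

lemma sample_expectation:
  assumes "finite N" "set us \<subseteq> N" "distinct us" "0 < H" "\<forall>v\<in>set us. \<exists>j\<le>H. a v = real j / real H"
  shows "measure_pmf.expectation (point_pmf N H) (\<lambda>z. g (sample_set H a us z)) = mext a us g"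
  using assms
proof (induction us arbitrary: g N)
  case Nil
  then show ?case by (simp add: sample_set_def)
next
  case (Cons u us)
  define N' where "N' = N - {u}"
  have N: "N = insert u N'" "u \<notin> N'" "finite N'" using Cons.prems by (auto simp: N'_def)
  obtain j where j: "j \<le> H" "a u = real j / real H" using Cons.prems by auto
  have IH: "measure_pmf.expectation (point_pmf N' H) (\<lambda>z. h (sample_set H a us z)) = mext a us h" for h
    using Cons.prems N by (intro Cons.IH) auto
  have s: "sample_set H a (u # us) (z(u := x)) =
      (if x < j then insert u (sample_set H a us z) else sample_set H a us z)" for z x
  proof -
    have "real x < real H * a u \<longleftrightarrow> x < j" using j Cons.prems(4) by simp
    then show ?thesis using Cons.prems(3) by (auto simp: sample_set_def)
  qed
  have "measure_pmf.expectation (point_pmf N H) (\<lambda>z. g (sample_set H a (u # us) z)) =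
    measure_pmf.expectation (pmf_of_set {..<H} \<bind> (\<lambda>x. map_pmf (\<lambda>z. z(u := x)) (point_pmf N' H)))
      (\<lambda>z. g (sample_set H a (u # us) z))"
    using N by (simp add: point_pmf_def Pi_pmf_insert' map_pmf_def)
  also have "\<dots> = (\<Sum>x<H. measure_pmf.expectation (map_pmf (\<lambda>z. z(u := x)) (point_pmf N' H))
      (\<lambda>z. g (sample_set H a (u # us) z)) /\<^sub>R real (card {..<H}))"
    using Cons.prems(4) N by (intro pmf_expectation_bind_pmf_of_set) (auto simp: finite_set_point_pmf)
  also have "\<dots> = (\<Sum>x<H. (if x < j then mext a us (\<lambda>S. g (insert u S)) else mext a us g) / H)"
    unfolding integral_map_pmf s
    by (intro sum.cong) (auto simp: IH[of g] IH[of "\<lambda>S. g (insert u S)"] field_simps)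
  also have "\<dots> = (\<Sum>x<H. if x < j then mext a us (\<lambda>S. g (insert u S)) / H else mext a us g / H)"
    by (intro sum.cong) auto
  also have "\<dots> = (\<Sum>x\<in>{..<j}. mext a us (\<lambda>S. g (insert u S)) / H) + (\<Sum>x\<in>{j..<H}. mext a us g / H)"
  proof -
    have 1: "{..<H} \<inter> {x. x < j} = {..<j}" "{..<H} \<inter> - {x. x < j} = {j..<H}" using j by auto
    show ?thesis by (subst sum.If_cases) (simp_all only: 1 finite_lessThan)
  qed
  also have "\<dots> = mext a (u # us) g"
    using j(1) Cons.prems(4) by (simp add: j(2) of_nat_diff field_simps)
  finally show ?case .
qed

context streaming
begin

text \<open>For a fixed state the \<open>s\<close> sampled marginals are independent, have mean
  \<open>marg f a us u\<close> and lie between 0 and \<open>max D (f {u})\<close>. The tolerance is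
  proportional to the same number, so it cancels in Hoeffding's bound.\<close>

lemma not_accurate_prob:
  assumes st: "dyadic H st" "distinct (fst st)" "set (fst st) \<subseteq> N" and u: "u \<in> N" and s: "0 < s"
  shows "measure_pmf.prob (sample_pmf N H s) {zs. \<not> accurate zs st u} \<le> 2 * exp (- (2 * s * eps ^ 4 / k ^ 2))"
proof -
  let ?Z = "sample_pmf N H s"
  obtain us lv a D w0 where st_eq: "st = (us, lv, a, D, w0)" by (cases st)
  have us: "\<forall>v\<in>set us. \<exists>j\<le>H. a v = real j / real H" "distinct us" "set us \<subseteq> N"
    using st unfolding st_eq by auto
  define D' where "D' = max D (f {u})"
  define X where "X r zs = f (insert u (sample_set H a us (zs r))) - f (sample_set H a us (zs r))" for r :: nat and zs
  have sub: "sample_set H a us z \<subseteq> N" for z using us by (auto simp: sample_set_def)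
  have X: "0 \<le> X r zs" "X r zs \<le> f {u} - f {}" for r zs
  proof -
    show "0 \<le> X r zs" unfolding X_def using f_mono[of "sample_set H a us (zs r)"] sub u by auto
    show "X r zs \<le> f {u} - f {}"
      unfolding X_def using f_submod[of "{}" "sample_set H a us (zs r)" u] sub u by auto
  qed
  have f0: "0 \<le> f {}" by (simp add: nonneg)
  have est: "estimate H s f a us zs u = (\<Sum>r<s. X r zs) / s" for zs by (simp add: estimate_def X_def)
  have "measure_pmf.expectation (?Z) (X r) = marg f a us u" if "r < s" for r
  proof -
    have "measure_pmf.expectation (?Z) (X r) =
        measure_pmf.expectation (map_pmf (\<lambda>zs. zs r) (?Z))
          (\<lambda>z. f (insert u (sample_set H a us z)) - f (sample_set H a us z))"
      by (simp add: X_def[abs_def])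
    also have "map_pmf (\<lambda>zs. zs r) (?Z) = point_pmf N H"
      unfolding sample_pmf_def using that by (subst Pi_pmf_component) auto
    also have "measure_pmf.expectation (point_pmf N H)
          (\<lambda>z. f (insert u (sample_set H a us z)) - f (sample_set H a us z)) = marg f a us u"
      unfolding marg_def by (rule sample_expectation[OF fin_N us(3) us(2) H us(1)])
    finally show ?thesis .
  qed
  then have mean: "(\<Sum>r<s. measure_pmf.expectation (?Z) (X r)) = s * marg f a us u" by simp
  show ?thesis
  proof (cases "{u} \<in> M \<and> 0 < D'")
    case True
    interpret Hoeffding_ineq "measure_pmf (?Z)" "{..<s}" X "\<lambda>_. 0" "\<lambda>_. D'"
      "\<Sum>r<s. measure_pmf.expectation (?Z) (X r)"
    proof unfold_locales
      have "prob_space.indep_vars (measure_pmf (?Z)) (\<lambda>_. count_space UNIV) (\<lambda>r zs. zs r) {..<s}"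
        unfolding sample_pmf_def by (rule indep_vars_Pi_pmf) simp
      then have "prob_space.indep_vars (measure_pmf (?Z)) (\<lambda>_. borel)
          (\<lambda>r zs. (\<lambda>z. f (insert u (sample_set H a us z)) - f (sample_set H a us z)) (zs r)) {..<s}"
        by (rule prob_space.indep_vars_compose2[OF measure_pmf.prob_space_axioms]) auto
      then show "prob_space.indep_vars (measure_pmf (?Z)) (\<lambda>_. borel) X {..<s}"
        by (simp add: X_def[abs_def])
      show "AE zs in ?Z. X r zs \<in> {0..D'}" for r
      proof (rule AE_pmfI)
        fix zs show "X r zs \<in> {0..D'}" using X[of r zs] f0 by (simp add: D'_def)
      qed
    qed simp_all
    define t where "t = s * (eps ^ 2 * D' / k)"
    have "{zs. \<not> accurate zs st u} \<subseteq> {zs \<in> space (measure_pmf (?Z)). \<bar>(\<Sum>r<s. X r zs) - s * marg f a us u\<bar> \<ge> t}"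
    proof
      fix zs assume "zs \<in> {zs. \<not> accurate zs st u}"
      then have "eps ^ 2 * D' / k \<le> \<bar>estimate H s f a us zs u - marg f a us u\<bar>"
        by (simp add: st_eq D'_def)
      then have "t \<le> real s * \<bar>estimate H s f a us zs u - marg f a us u\<bar>"
        unfolding t_def by (rule mult_left_mono) simp
      also have "\<dots> = \<bar>real s * (estimate H s f a us zs u - marg f a us u)\<bar>"
        by (simp only: abs_mult abs_of_nat)
      also have "real s * (estimate H s f a us zs u - marg f a us u) = (\<Sum>r<s. X r zs) - s * marg f a us u"
        using s by (simp add: est right_diff_distrib)
      finally show "zs \<in> {zs \<in> space (measure_pmf (?Z)). \<bar>(\<Sum>r<s. X r zs) - s * marg f a us u\<bar> \<ge> t}" by simp
    qed
    then have "measure_pmf.prob (?Z) {zs. \<not> accurate zs st u} \<le>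
        measure_pmf.prob (?Z) {zs \<in> space (measure_pmf (?Z)). \<bar>(\<Sum>r<s. X r zs) - s * marg f a us u\<bar> \<ge> t}"
      by (intro measure_pmf.finite_measure_mono) auto
    also have "\<dots> \<le> 2 * exp (- 2 * t\<^sup>2 / (\<Sum>r<s. (D' - 0)\<^sup>2))"
      unfolding mean[symmetric]
      by (rule Hoeffding_ineq_abs_ge) (use True s in \<open>auto simp: t_def eps_def\<close>)
    also have "- 2 * t\<^sup>2 / (\<Sum>r<s. (D' - 0)\<^sup>2) = - (2 * s * eps ^ 4 / k ^ 2)"
      using True s k by (simp add: t_def field_simps power2_eq_square power4_eq_xxxx)
    finally show ?thesis .
  next
    case False
    \<comment> \<open>Hoeffding's inequality is applied with a positive range only; for range 0 all
      sampled marginals vanish and the estimate is exact.\<close>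
    have "accurate zs st u" for zs
    proof (cases "{u} \<in> M")
      case True
      then have D': "D' \<le> 0" using False by simp
      have "0 \<le> f {u}" using u by (simp add: nonneg)
      then have "f {u} = 0" "D' = 0" using D' by (auto simp: D'_def)
      then have X0: "X r zs = 0" for r zs using X[of r zs] f0 by linarith
      have "(\<Sum>r<s. measure_pmf.expectation (?Z) (X r)) = 0"
      proof (intro sum.neutral ballI)
        fix r
        have "X r = (\<lambda>_. 0)" using X0 by (simp add: fun_eq_iff)
        then show "measure_pmf.expectation (?Z) (X r) = 0" by simp
      qed
      then have "marg f a us u = 0" using mean s by simp
      then show ?thesis using \<open>D' = 0\<close> by (simp add: st_eq est X0 D'_def[symmetric])
    qed (simp add: st_eq)
    then show ?thesis by simp
  qed
qed

text \<open>The state before position \<open>j\<close> depends on earlier seeds only. With all seeds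
  but the one at \<open>j\<close> fixed, that one is still a fresh sample for a fixed state; a union
  bound over the positions finishes.\<close>

lemma inv_prob:
  assumes es: "distinct es" "set es \<subseteq> N" "length es \<le> n" and s: "0 < s"
    and E: "\<forall>u\<in>set es. {u} \<in> M \<longrightarrow> f {u} \<le> E" "0 \<le> E"
  shows "measure_pmf.prob (seed_pmf N H s n) {\<omega>. \<not> inv E (process k H s f M \<omega> es)} \<le>
    n * (2 * exp (- (2 * s * eps ^ 4 / k ^ 2)))"
proof -
  let ?c = "2 * exp (- (2 * s * eps ^ 4 / k ^ 2))"
  define Bad where "Bad j = {\<omega>. \<not> accurate (\<omega> j) (process k H s f M \<omega> (take j es)) (es ! j)}" for j
  have Bad: "measure_pmf.prob (seed_pmf N H s n) (Bad j) \<le> ?c" if j: "j < length es" for j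
  proof -
    define I where "I = {..<n} - {j}"
    have I: "{..<n} = insert j I" "j \<notin> I" "finite I" using j es by (auto simp: I_def)
    have "seed_pmf N H s n = sample_pmf N H s \<bind> (\<lambda>zs. Pi_pmf I (\<lambda>_ _. 0) (\<lambda>_. sample_pmf N H s) \<bind> (\<lambda>\<omega>. return_pmf ((fun_upd \<omega> j zs))))"
      unfolding seed_pmf_def I(1) using I by (simp add: Pi_pmf_insert')
    also have "\<dots> = Pi_pmf I (\<lambda>_ _. 0) (\<lambda>_. sample_pmf N H s) \<bind> (\<lambda>\<omega>. sample_pmf N H s \<bind> (\<lambda>zs. return_pmf ((fun_upd \<omega> j zs))))"
      by (rule bind_commute_pmf)
    finally have eq: "seed_pmf N H s n =
      Pi_pmf I (\<lambda>_ _. 0) (\<lambda>_. sample_pmf N H s) \<bind> (\<lambda>\<omega>. map_pmf (\<lambda>zs. (fun_upd \<omega> j zs)) (sample_pmf N H s))"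
      by (simp add: map_pmf_def)
    show ?thesis unfolding eq
    proof (rule prob_bind_le)
      fix \<omega>
      let ?st = "process k H s f M \<omega> (take j es)"
      have "process k H s f M ((fun_upd \<omega> j zs)) (take j es) = ?st" for zs
        using j by (intro process_cong) auto
      then have "(\<lambda>zs. (fun_upd \<omega> j zs)) -` Bad j = {zs. \<not> accurate zs ?st (es ! j)}"
        by (auto simp: Bad_def)
      then have "measure_pmf.prob (map_pmf (\<lambda>zs. (fun_upd \<omega> j zs)) (sample_pmf N H s)) (Bad j) =
         measure_pmf.prob (sample_pmf N H s) {zs. \<not> accurate zs ?st (es ! j)}" by simp
      also have "\<dots> \<le> ?c"
        using es j s H set_take_subset[of j es]
        by (intro not_accurate_prob dyadic_process) (auto simp: fst_process)
      finally show "measure_pmf.prob (map_pmf (\<lambda>zs. (fun_upd \<omega> j zs)) (sample_pmf N H s)) (Bad j) \<le> ?c" .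
    qed
  qed
  have "measure_pmf.prob (seed_pmf N H s n) {\<omega>. \<not> inv E (process k H s f M \<omega> es)} \<le>
      measure_pmf.prob (seed_pmf N H s n) (\<Union>j<length es. Bad j)"
    using inv_process[OF es(1,2) E] by (intro measure_pmf.finite_measure_mono) (auto simp: Bad_def)
  also have "\<dots> \<le> (\<Sum>j<length es. measure_pmf.prob (seed_pmf N H s n) (Bad j))"
    by (intro measure_pmf.finite_measure_subadditive_finite) auto
  also have "\<dots> \<le> (\<Sum>j<length es. ?c)" by (intro sum_mono Bad) simp
  also have "\<dots> \<le> n * ?c" using es(3) by (simp add: mult_right_mono)
  finally show ?thesis .
qed

end

section \<open>Rounding a state and amplifying its success probability\<close>

definition round_pmf :: "nat \<Rightarrow> nat set set \<Rightarrow> state \<Rightarrow> nat set pmf" where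
  "round_pmf k M st = (case st of (us, lv, a, D, w0) \<Rightarrow>
     swap_round M k win_exp (SOME T. family_of M lv us (2 ^ win_exp) T) 0)"

primrec best :: "('a \<Rightarrow> real) \<Rightarrow> 'a list \<Rightarrow> 'a" where
  "best g [] = undefined"
| "best g (S # Ss) = (if Ss = [] \<or> g (best g Ss) \<le> g S then S else best g Ss)"

lemma best_in: "Ss \<noteq> [] \<Longrightarrow> best g Ss \<in> set Ss"
  by (induction Ss) auto

lemma best_ge: "S \<in> set Ss \<Longrightarrow> g S \<le> g (best g Ss)"
  by (induction Ss) force+

lemma best_cong: "(\<And>S. S \<in> set Ss \<Longrightarrow> g S = h S) \<Longrightarrow> best g Ss = best h Ss"
proof (induction Ss)
  case (Cons S Ss)
  then have "best g Ss = best h Ss" by simp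
  moreover have "Ss \<noteq> [] \<Longrightarrow> g (best g Ss) = h (best g Ss)" using best_in[of Ss g] Cons.prems by auto
  ultimately show ?case using Cons.prems[of S] by auto
qed simp

lemma prob_replicate_none:
  assumes "c \<le> measure_pmf.prob p X"
  shows "measure_pmf.prob (replicate_pmf m p) {xs. \<forall>x\<in>set xs. x \<notin> X} \<le> (1 - c) ^ m"
proof (induction m)
  case (Suc m)
  have c: "0 \<le> 1 - c" using assms measure_pmf.prob_le_1[of p X] by linarith
  have "measure_pmf.prob (replicate_pmf (Suc m) p) {xs. \<forall>x\<in>set xs. x \<notin> X} \<le>
     (1 - c) ^ m * measure_pmf.prob p (- X)"
    unfolding replicate_pmf.simps
  proof (rule prob_bind_le_mult)
    fix x
    have eq: "replicate_pmf m p \<bind> (\<lambda>xs. return_pmf (x # xs)) = map_pmf ((#) x) (replicate_pmf m p)"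
      by (simp add: map_pmf_def)
    show "measure_pmf.prob (replicate_pmf m p \<bind> (\<lambda>xs. return_pmf (x # xs))) {xs. \<forall>x\<in>set xs. x \<notin> X} \<le> (1 - c) ^ m"
      if "x \<in> - X"
    proof -
      have "(#) x -` {xs. \<forall>x\<in>set xs. x \<notin> X} = {xs. \<forall>x\<in>set xs. x \<notin> X}" using that by auto
      then show ?thesis using Suc unfolding eq by (simp only: measure_map_pmf)
    qed
    show "measure_pmf.prob (replicate_pmf m p \<bind> (\<lambda>xs. return_pmf (x # xs))) {xs. \<forall>x\<in>set xs. x \<notin> X} = 0"
      if "x \<notin> - X"
    proof -
      have "(#) x -` {xs. \<forall>x\<in>set xs. x \<notin> X} = {}" using that by auto
      then show ?thesis unfolding eq by (simp only: measure_map_pmf measure_empty)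
    qed
  qed (use c in auto)
  also have "\<dots> \<le> (1 - c) ^ m * (1 - c)"
    using assms c measure_pmf.prob_compl[of X p] by (intro mult_left_mono) (simp_all add: Compl_eq_Diff_UNIV)
  finally show ?case by (simp only: power_Suc2)
qed simp

context streaming
begin

lemma family: "family_of M lv us (2 ^ win_exp) (SOME T. family_of M lv us (2 ^ win_exp) T)"
proof -
  have "\<exists>T. family_of M lv us (2 ^ win_exp) T" by (rule family_exists) simp
  then show ?thesis by (rule someI_ex)
qed

lemma set_round_pmf:
  "set_pmf (round_pmf k M st) \<subseteq> {S \<in> M. S \<subseteq> set (fst st)}"
proof -
  obtain us lv a D w0 where st: "st = (us, lv, a, D, w0)" by (cases st)
  define T where "T = (SOME T. family_of M lv us (2 ^ win_exp) T)"
  have T: "family_of M lv us (2 ^ win_exp) T" unfolding T_def by (rule family)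
  then obtain r where r: "\<forall>j<2 ^ win_exp. T j \<in> M \<and> T j \<subseteq> set us \<and> card (T j) = r"
    unfolding family_of_def by blast
  have "set_pmf (swap_round M k win_exp T 0) \<subseteq> {S \<in> M. card S = r \<and> S \<subseteq> set us}"
    using r by (intro set_swap_round) simp
  moreover have "round_pmf k M st = swap_round M k win_exp T 0"
    by (simp only: round_pmf_def st T_def prod.case)
  ultimately show ?thesis unfolding st by auto
qed

text \<open>A reverse Markov inequality: no outcome exceeds \<open>E\<close> and the mean is at
  least \<open>0.31781 * E\<close>, so the value \<open>0.3178 * E\<close> is reached with
  probability at least the difference of the two factors.\<close>

lemma round_success:
  assumes inv: "inv E st" and H': "length (fst st) \<le> eps * H"
    and E: "\<forall>I\<in>M. I \<subseteq> set (fst st) \<longrightarrow> f I \<le> E" and I: "I \<in> M" "I \<subseteq> set (fst st)" "E = f I"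
  shows "1 / 10 ^ 5 \<le> measure_pmf.prob (round_pmf k M st) {S. 3178 / 10000 * E \<le> f S}"
proof -
  obtain us lv a D w0 where st: "st = (us, lv, a, D, w0)" by (cases st)
  define T where "T = (SOME T. family_of M lv us (2 ^ win_exp) T)"
  have T: "family_of M lv us (2 ^ win_exp) T" unfolding T_def by (rule family)
  have us: "distinct us" "set us \<subseteq> N" using inv unfolding st by auto
  obtain r where r: "\<forall>j<2 ^ win_exp. T j \<in> M \<and> card (T j) = r \<and> T j \<subseteq> set us"
    using T unfolding family_of_def by blast
  have rk: "r \<le> k" using r k(2)[of "T 0"] by auto
  let ?p = "round_pmf k M st" and ?X = "{S. 3178 / 10000 * E \<le> f S}"
  have p: "?p = swap_round M k win_exp T 0" by (simp only: round_pmf_def st T_def prod.case)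
  have fin: "finite (set_pmf ?p)" unfolding p by (rule finite_set_swap_round)
  have "31781 / 100000 * E \<le> mext (\<lambda>u. (\<Sum>j<2 ^ win_exp. of_bool (u \<in> T j)) / 2 ^ win_exp) us f"
  proof (rule inv_mext[OF inv[unfolded st] _ _ I(1) _ I(3) T])
    show "\<forall>u\<in>set us. {u} \<in> M \<longrightarrow> f {u} \<le> E" using E st by simp
  qed (use H' I(2) st in simp_all)
  also have "\<dots> \<le> measure_pmf.expectation ?p f"
    unfolding p by (rule swap_round_expectation[OF r rk us])
  finally have 1: "31781 / 100000 * E \<le> measure_pmf.expectation ?p f" .
  have E0: "0 \<le> E" using I indep_sub nonneg by auto
  show ?thesis
  proof (cases "E = 0")
    case True
    have "AE S in ?p. S \<in> ?X"
    proof (rule AE_pmfI)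
      fix S assume "S \<in> set_pmf ?p"
      then have "S \<subseteq> N" using set_round_pmf[of st] indep_sub by blast
      then show "S \<in> ?X" using nonneg[of S] True by simp
    qed
    then have "measure_pmf.prob ?p ?X = 1" by (simp add: measure_pmf.prob_eq_1)
    then show ?thesis by simp
  next
    case False
    then have E1: "0 < E" using E0 by simp
    have "measure_pmf.expectation ?p f \<le> measure_pmf.expectation ?p (\<lambda>S. E * indicator ?X S + 3178 / 10000 * E)"
    proof (rule integral_mono_AE)
      show "AE S in ?p. f S \<le> E * indicator ?X S + 3178 / 10000 * E"
      proof (rule AE_pmfI)
        fix S assume "S \<in> set_pmf ?p"
        then have "f S \<le> E" using set_round_pmf[of st] E by auto
        then show "f S \<le> E * indicator ?X S + 3178 / 10000 * E" using E0 by (auto simp: indicator_def)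
      qed
    qed (auto intro!: integrable_measure_pmf_finite fin)
    also have "\<dots> = E * measure_pmf.prob ?p ?X + 3178 / 10000 * E"
      by (subst Bochner_Integration.integral_add) (auto intro!: integrable_measure_pmf_finite fin)
    finally have "1 / 10 ^ 5 * E \<le> measure_pmf.prob ?p ?X * E" using 1 by (simp add: algebra_simps)
    then show ?thesis using E1 by simp
  qed
qed

lemma output_success:
  assumes es: "distinct es" "set es \<subseteq> N" "length es \<le> n" and s: "0 < s" and H': "n \<le> eps * H"
    and E: "\<forall>I\<in>M. I \<subseteq> set es \<longrightarrow> f I \<le> E" and I: "I \<in> M" "I \<subseteq> set es" "E = f I" and m: "0 < m"
  shows "measure_pmf.prob (seed_pmf N H s n \<bind> (\<lambda>\<omega>. map_pmf (best f) (replicate_pmf m (round_pmf k M (process k H s f M \<omega> es)))))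
     {S. \<not> 3178 / 10000 * E \<le> f S} \<le> n * (2 * exp (- (2 * s * eps ^ 4 / k ^ 2))) + (1 - 1 / 10 ^ 5) ^ m"
proof -
  let ?B = "{\<omega>. \<not> inv E (process k H s f M \<omega> es)}"
  have E0: "0 \<le> E" using I indep_sub nonneg by auto
  have "measure_pmf.prob (seed_pmf N H s n \<bind> (\<lambda>\<omega>. map_pmf (best f) (replicate_pmf m (round_pmf k M (process k H s f M \<omega> es)))))
     {S. \<not> 3178 / 10000 * E \<le> f S} \<le> measure_pmf.prob (seed_pmf N H s n) ?B + (1 - 1 / 10 ^ 5) ^ m"
  proof (rule prob_bind_le_add)
    fix \<omega> assume "\<omega> \<notin> ?B"
    then have inv: "inv E (process k H s f M \<omega> es)" by simp
    let ?st = "process k H s f M \<omega> es" and ?X = "{S. 3178 / 10000 * E \<le> f S}"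
    have c: "1 / 10 ^ 5 \<le> measure_pmf.prob (round_pmf k M ?st) ?X"
      using E I H' es by (intro round_success[OF inv]) (auto simp: fst_process)
    have "measure_pmf.prob (map_pmf (best f) (replicate_pmf m (round_pmf k M ?st))) {S. \<not> 3178 / 10000 * E \<le> f S} =
      measure_pmf.prob (replicate_pmf m (round_pmf k M ?st)) {Ss. \<not> 3178 / 10000 * E \<le> f (best f Ss)}"
      by (simp add: vimage_def)
    also have "\<dots> \<le> measure_pmf.prob (replicate_pmf m (round_pmf k M ?st)) {Ss. \<forall>S\<in>set Ss. S \<notin> ?X}"
    proof (rule measure_pmf.finite_measure_mono)
      show "{Ss. \<not> 3178 / 10000 * E \<le> f (best f Ss)} \<subseteq> {Ss. \<forall>S\<in>set Ss. S \<notin> ?X}"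
      proof
        fix Ss assume "Ss \<in> {Ss. \<not> 3178 / 10000 * E \<le> f (best f Ss)}"
        then have "f (best f Ss) < 3178 / 10000 * E" by simp
        then have "\<not> 3178 / 10000 * E \<le> f S" if "S \<in> set Ss" for S
          using best_ge[OF that, of f] by linarith
        then show "Ss \<in> {Ss. \<forall>S\<in>set Ss. S \<notin> ?X}" by blast
      qed
    qed simp
    also have "\<dots> \<le> (1 - 1 / 10 ^ 5) ^ m" by (rule prob_replicate_none[OF c])
    finally show "measure_pmf.prob (map_pmf (best f) (replicate_pmf m (round_pmf k M ?st))) {S. \<not> 3178 / 10000 * E \<le> f S} \<le> (1 - 1 / 10 ^ 5) ^ m" .
  qed simp
  moreover have "measure_pmf.prob (seed_pmf N H s n) ?B \<le> n * (2 * exp (- (2 * s * eps ^ 4 / k ^ 2)))"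
    using E E0 by (intro inv_prob es s) auto
  ultimately show ?thesis by linarith
qed

end

section \<open>Processing orders for a sliding window\<close>

text \<open>Elements are named by their arrival numbers, and the window is \<open>{l..<r}\<close>. On level \<open>i\<close> the order
  starts with a part of the window that only depends on \<open>l\<close> and \<open>r\<close> up to multiples of \<open>2 ^ i\<close>.
  The margin of about \<open>2 ^ i\<close> on both sides leaves time to compute it in advance.\<close>

definition lo :: "nat \<Rightarrow> nat \<Rightarrow> nat" where
  "lo i l = (if i = 0 then l else 2 ^ i * (l div 2 ^ i + 2))"

definition hi :: "nat \<Rightarrow> nat \<Rightarrow> nat" where
  "hi i r = (if i = 0 then r else 2 ^ i * (r div 2 ^ i - 1))"

text \<open>The order of level \<open>Suc i\<close> is an initial part of the order of level
  \<open>i\<close>, which appends the elements added at both ends. At level 0 the whole window is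
  listed.\<close>

function order_upto :: "nat \<Rightarrow> nat \<Rightarrow> nat \<Rightarrow> nat \<Rightarrow> nat list" where
  "order_upto h i l r = (if h \<le> i then [] else
     (let p = order_upto h (Suc i) l r in p @ filter (\<lambda>x. x \<notin> set p) [lo i l..<hi i r]))"
  by auto
termination by (relation "inv_image less_than (\<lambda>(h, i, l, r). h - i)") auto

declare order_upto.simps [simp del]

lemma order_upto_top: "order_upto h h l r = []"
  by (simp add: order_upto.simps)

lemma order_upto_step: "i < h \<Longrightarrow> order_upto h i l r =
   order_upto h (Suc i) l r @ filter (\<lambda>x. x \<notin> set (order_upto h (Suc i) l r)) [lo i l..<hi i r]"
  by (subst order_upto.simps) (simp add: Let_def)

lemma lo_bounds: "i \<ge> 1 \<Longrightarrow> l + 2 ^ i < lo i l" "i \<ge> 1 \<Longrightarrow> lo i l \<le> l + 2 * 2 ^ i"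
proof -
  have d: "2 ^ i * (l div 2 ^ i) + l mod 2 ^ i = l" "l mod 2 ^ i < 2 ^ i" for i :: nat by simp_all
  assume "i \<ge> 1"
  then have "lo i l = 2 ^ i * (l div 2 ^ i) + 2 * 2 ^ i" by (simp add: lo_def add_mult_distrib2)
  then show "l + 2 ^ i < lo i l" "lo i l \<le> l + 2 * 2 ^ i" using d[of i] by linarith+
qed

lemma hi_bounds: "i \<ge> 1 \<Longrightarrow> hi i r \<le> r - 2 ^ i" "i \<ge> 1 \<Longrightarrow> r < hi i r + 2 * 2 ^ i"
proof -
  have d: "2 ^ i * (r div 2 ^ i) + r mod 2 ^ i = r" "r mod 2 ^ i < 2 ^ i" by simp_all
  assume "i \<ge> 1"
  then have "hi i r = 2 ^ i * (r div 2 ^ i) - 2 ^ i" by (simp add: hi_def diff_mult_distrib2)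
  then show "hi i r \<le> r - 2 ^ i" "r < hi i r + 2 * 2 ^ i" using d by linarith+
qed

lemma lo_mono: "lo i l \<le> lo (Suc i) l"
proof (cases "i = 0")
  case True
  then show ?thesis using lo_bounds(1)[of 1 l] by (simp add: lo_def)
next
  case False
  then show ?thesis using lo_bounds(2)[of i l] lo_bounds(1)[of "Suc i" l] by simp
qed

lemma hi_mono: "hi (Suc i) r \<le> hi i r"
proof (cases "i = 0")
  case True
  then show ?thesis using hi_bounds(1)[of 1 r] by (simp add: hi_def)
next
  case False
  show ?thesis
  proof (cases "2 * 2 ^ i \<le> r")
    case True
    then show ?thesis using False hi_bounds(2)[of i r] hi_bounds(1)[of "Suc i" r] by simp
  next
    case F: False
    then show ?thesis using hi_bounds(1)[of "Suc i" r] by simp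
  qed
qed

text \<open>The margin at level \<open>i\<close> is more than \<open>2 ^ i\<close>, and that at
  level \<open>Suc i\<close> at most \<open>4 * 2 ^ i\<close>. Level 0 has no margin and therefore
  the weaker bound.\<close>

lemma lo_gap:
  shows "lo (Suc i) l \<le> lo i l + 4 * 2 ^ i" and "i \<ge> 1 \<Longrightarrow> lo (Suc i) l \<le> lo i l + 3 * 2 ^ i"
proof -
  have 1: "lo (Suc i) l \<le> l + 4 * 2 ^ i" using lo_bounds(2)[of "Suc i" l] by simp
  have "l \<le> lo i l"
  proof (cases "i = 0")
    case False
    then show ?thesis using lo_bounds(1)[of i l] by linarith
  qed (simp add: lo_def)
  with 1 show "lo (Suc i) l \<le> lo i l + 4 * 2 ^ i" by linarith
  show "lo (Suc i) l \<le> lo i l + 3 * 2 ^ i" if "i \<ge> 1"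
    using 1 lo_bounds(1)[OF that, of l] by linarith
qed

lemma hi_gap:
  shows "hi i r \<le> hi (Suc i) r + 4 * 2 ^ i" and "i \<ge> 1 \<Longrightarrow> hi i r \<le> hi (Suc i) r + 3 * 2 ^ i"
proof -
  have 1: "r < hi (Suc i) r + 4 * 2 ^ i" using hi_bounds(2)[of "Suc i" r] by simp
  have "hi i r \<le> r"
  proof (cases "i = 0")
    case False
    then show ?thesis using hi_bounds(1)[of i r] by linarith
  qed (simp add: hi_def)
  with 1 show "hi i r \<le> hi (Suc i) r + 4 * 2 ^ i" by linarith
  show "hi i r \<le> hi (Suc i) r + 3 * 2 ^ i" if "i \<ge> 1"
  proof (cases "2 ^ i \<le> r")
    case True
    then show ?thesis using 1 hi_bounds(1)[OF that, of r] by linarith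
  next
    case False
    then show ?thesis using hi_bounds(1)[OF that, of r] by simp
  qed
qed

text \<open>At level \<open>h\<close> the two margins use up the window. The width may reach
  \<open>2 * 2 ^ h\<close> because orders prepared in advance can have a right end beyond the
  present one.\<close>

lemma top_empty:
  assumes "r \<le> l + 2 * 2 ^ h" "1 \<le> h" shows "{lo h l..<hi h r} = {}"
  using lo_bounds(1)[of h l] hi_bounds(1)[of h r] assms by auto

lemma set_order_upto:
  assumes "r \<le> l + 2 * 2 ^ h" "1 \<le> h" "i \<le> h"
  shows "set (order_upto h i l r) = {lo i l..<hi i r}"
  using assms(3)
proof (induction i rule: inc_induct)
  case base
  show ?case unfolding top_empty[OF assms(1,2)] by (simp add: order_upto_top)
next
  case (step i)
  have "{lo (Suc i) l..<hi (Suc i) r} \<subseteq> {lo i l..<hi i r}"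
  proof
    fix x assume "x \<in> {lo (Suc i) l..<hi (Suc i) r}"
    then show "x \<in> {lo i l..<hi i r}" using lo_mono[of i l] hi_mono[of i r] by simp
  qed
  moreover have "set (order_upto h i l r) = set (order_upto h (Suc i) l r) \<union>
      ({lo i l..<hi i r} - set (order_upto h (Suc i) l r))"
    unfolding order_upto_step[OF step.hyps(2)] by auto
  ultimately show ?case unfolding step.IH by blast
qed

lemma distinct_order_upto: "i \<le> h \<Longrightarrow> distinct (order_upto h i l r)"
proof (induction i rule: inc_induct)
  case base
  show ?case by (simp add: order_upto_top)
next
  case (step i)
  then show ?case unfolding order_upto_step[OF step.hyps(2)] by auto
qed

text \<open>The bound \<open>6 * 2 ^ i = 12 * 2 ^ (i - 1)\<close> is what 12 steps per update
  achieve in \<open>2 ^ (i - 1)\<close> updates, and the 8 new elements of level 0 fit into a single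
  update.\<close>

lemma length_order_upto:
  assumes "r \<le> l + 2 * 2 ^ h" "1 \<le> h" "i < h"
  shows "length (order_upto h i l r) \<le> length (order_upto h (Suc i) l r) + 8 * 2 ^ i"
    and "1 \<le> i \<Longrightarrow> length (order_upto h i l r) \<le> length (order_upto h (Suc i) l r) + 6 * 2 ^ i"
proof -
  let ?f = "filter (\<lambda>x. x \<notin> set (order_upto h (Suc i) l r)) [lo i l..<hi i r]"
  have len: "length (order_upto h i l r) = length (order_upto h (Suc i) l r) + length ?f"
    unfolding order_upto_step[OF assms(3)] by simp
  have "set ?f \<subseteq> {lo i l..<lo (Suc i) l} \<union> {hi (Suc i) r..<hi i r}"
    using assms set_order_upto[of r l h "Suc i"] by auto
  then have "card (set ?f) \<le> card ({lo i l..<lo (Suc i) l} \<union> {hi (Suc i) r..<hi i r})"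
    by (intro card_mono) auto
  also have "\<dots> \<le> (lo (Suc i) l - lo i l) + (hi i r - hi (Suc i) r)"
    using card_Un_le[of "{lo i l..<lo (Suc i) l}" "{hi (Suc i) r..<hi i r}"] by simp
  finally have "length ?f \<le> (lo (Suc i) l - lo i l) + (hi i r - hi (Suc i) r)"
    by (simp add: distinct_card[symmetric])
  then show "length (order_upto h i l r) \<le> length (order_upto h (Suc i) l r) + 8 * 2 ^ i"
    and "1 \<le> i \<Longrightarrow> length (order_upto h i l r) \<le> length (order_upto h (Suc i) l r) + 6 * 2 ^ i"
    using len lo_gap[of i l] hi_gap[of i r] by linarith+
qed

lemma lo_hi_cong: "l div 2 ^ i = l' div 2 ^ i \<Longrightarrow> lo i l = lo i l'" "r div 2 ^ i = r' div 2 ^ i \<Longrightarrow> hi i r = hi i r'"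
  by (auto simp: lo_def hi_def)

lemma order_upto_cong:
  assumes "i \<le> h" "l div 2 ^ i = l' div 2 ^ i" "r div 2 ^ i = r' div 2 ^ i"
  shows "order_upto h i l r = order_upto h i l' r'"
  using assms
proof (induction i rule: inc_induct)
  case base
  show ?case by (simp add: order_upto_top)
next
  case (step i)
  have "x div 2 ^ Suc i = x div 2 ^ i div 2" for x :: nat
    by (simp add: div_mult2_eq[symmetric] mult.commute)
  then have "order_upto h (Suc i) l r = order_upto h (Suc i) l' r'" using step by simp
  moreover have "lo i l = lo i l'" "hi i r = hi i r'" using step.prems by (auto intro: lo_hi_cong)
  ultimately show ?case unfolding order_upto_step[OF step.hyps(2)] by simp
qed

section \<open>The schedule\<close>

definition shifts :: "nat \<Rightarrow> nat \<Rightarrow> nat \<Rightarrow> (nat \<times> nat) list" where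
  "shifts i l r = [(l, r), (l, r + 2 ^ i), (l + 2 ^ i, r), (l + 2 ^ i, r + 2 ^ i)]"

text \<open>Besides the order of the current window, the orders that windows of the near future may
  need at each level. The condition \<open>hi i r' \<le> r\<close> admits only orders whose elements
  have all arrived.\<close>

definition targets :: "nat \<Rightarrow> nat \<Rightarrow> nat \<Rightarrow> nat list list" where
  "targets h l r = order_upto h 0 l r #
     concat (map (\<lambda>i. map (\<lambda>(l', r'). order_upto h i l' r')
       (filter (\<lambda>(l', r'). hi i r' \<le> r) (shifts i l r))) [1..<h])"

definition known_len :: "nat list set \<Rightarrow> nat list \<Rightarrow> nat" where
  "known_len C \<rho> = Max {j. j \<le> length \<rho> \<and> take j \<rho> \<in> C}"

definition fresh :: "nat list set \<Rightarrow> nat list \<Rightarrow> nat list list" where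
  "fresh C \<rho> = map (\<lambda>j. take (Suc j) \<rho>) [known_len C \<rho>..<min (known_len C \<rho> + 12) (length \<rho>)]"

primrec todo :: "nat list set \<Rightarrow> nat list list \<Rightarrow> nat list list" where
  "todo C [] = []"
| "todo C (\<rho> # \<rho>s) = fresh C \<rho> @ todo (C \<union> set (fresh C \<rho>)) \<rho>s"

definition prefix_closed :: "nat list set \<Rightarrow> bool" where
  "prefix_closed C \<longleftrightarrow> [] \<in> C \<and> (\<forall>\<rho>\<in>C. \<forall>j. take j \<rho> \<in> C)"

text \<open>A valid order of computation: when a node is reached, the node without its last element
  has already been computed.\<close>

primrec extends_by :: "nat list set \<Rightarrow> nat list list \<Rightarrow> bool" where
  "extends_by C [] = True"
| "extends_by C (x # xs) = (x \<noteq> [] \<and> butlast x \<in> C \<and> extends_by (insert x C) xs)"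

lemma extends_by_append: "extends_by C (xs @ ys) \<longleftrightarrow> extends_by C xs \<and> extends_by (C \<union> set xs) ys"
  by (induction xs arbitrary: C) auto

lemma known_len:
  assumes "prefix_closed C"
  shows "known_len C \<rho> \<le> length \<rho>" "take (known_len C \<rho>) \<rho> \<in> C"
    "j \<le> length \<rho> \<Longrightarrow> take j \<rho> \<in> C \<Longrightarrow> j \<le> known_len C \<rho>"
proof -
  let ?S = "{j. j \<le> length \<rho> \<and> take j \<rho> \<in> C}"
  have fin: "finite ?S" by simp
  have "0 \<in> ?S" using assms by (simp add: prefix_closed_def)
  then have "Max ?S \<in> ?S" using fin by (intro Max_in) auto
  then show "known_len C \<rho> \<le> length \<rho>" "take (known_len C \<rho>) \<rho> \<in> C" by (auto simp: known_len_def)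
  show "j \<le> length \<rho> \<Longrightarrow> take j \<rho> \<in> C \<Longrightarrow> j \<le> known_len C \<rho>"
    unfolding known_len_def using fin by (intro Max_ge) auto
qed

lemma take_fresh:
  assumes C: "prefix_closed C" and j: "j \<le> known_len C \<rho> + 12" "j \<le> length \<rho>"
  shows "take j \<rho> \<in> C \<union> set (fresh C \<rho>)"
proof (cases "j \<le> known_len C \<rho>")
  case True
  then have "take j \<rho> = take j (take (known_len C \<rho>) \<rho>)" by (simp add: min_def)
  then show ?thesis using C known_len(2)[OF C, of \<rho>] unfolding prefix_closed_def by auto
next
  case False
  then obtain j' where "j = Suc j'" "known_len C \<rho> \<le> j'" by (cases j) auto
  then show ?thesis using j by (auto simp: fresh_def)
qed

lemma prefix_closed_fresh:
  assumes C: "prefix_closed C"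
  shows "prefix_closed (C \<union> set (fresh C \<rho>))"
  unfolding prefix_closed_def
proof (intro conjI ballI allI)
  show "[] \<in> C \<union> set (fresh C \<rho>)" using C by (simp add: prefix_closed_def)
  fix x j assume "x \<in> C \<union> set (fresh C \<rho>)"
  then show "take j x \<in> C \<union> set (fresh C \<rho>)"
  proof
    assume "x \<in> C"
    then show ?thesis using C by (auto simp: prefix_closed_def)
  next
    assume "x \<in> set (fresh C \<rho>)"
    then obtain i where i: "x = take (Suc i) \<rho>" "i < known_len C \<rho> + 12" "i < length \<rho>"
      by (auto simp: fresh_def)
    then have "take j x = take (min j (Suc i)) \<rho>" by simp
    moreover have "take (min j (Suc i)) \<rho> \<in> C \<union> set (fresh C \<rho>)"
      using i by (intro take_fresh[OF C]) auto
    ultimately show ?thesis by simp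
  qed
qed

lemma extends_by_fresh:
  assumes C: "prefix_closed C"
  shows "extends_by C (fresh C \<rho>)"
proof -
  have "extends_by D (map (\<lambda>j. take (Suc j) \<rho>) [p..<q])" if "take p \<rho> \<in> D" "q \<le> length \<rho>" for p q D
    using that
  proof (induction "q - p" arbitrary: p D)
    case (Suc d)
    then have pq: "p < q" by simp
    have "butlast (take (Suc p) \<rho>) = take p \<rho>" using pq Suc.prems by (simp add: butlast_take)
    moreover have "take (Suc p) \<rho> \<noteq> []" using pq Suc.prems by auto
    moreover have "extends_by (insert (take (Suc p) \<rho>) D) (map (\<lambda>j. take (Suc j) \<rho>) [Suc p..<q])"
      using Suc by (intro Suc.hyps(1)) auto
    ultimately show ?case using pq Suc.prems by (simp add: upt_conv_Cons)
  qed simp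
  from this[OF known_len(2)[OF C]] show ?thesis unfolding fresh_def by simp
qed

lemma todo_props:
  assumes "prefix_closed C"
  shows "prefix_closed (C \<union> set (todo C \<rho>s))" and "extends_by C (todo C \<rho>s)"
  using assms
proof (induction \<rho>s arbitrary: C)
  case (Cons \<rho> \<rho>s)
  {
    case 1
    then show ?case using Cons(1)[OF prefix_closed_fresh[OF 1]] by (simp add: Un_assoc)
  next
    case 2
    then show ?case using Cons(2)[OF prefix_closed_fresh[OF 2]] extends_by_fresh[OF 2]
      by (simp add: extends_by_append)
  }
qed simp_all

text \<open>Earlier targets only enlarge \<open>C\<close>, so when the turn of \<open>\<rho>\<close>
  comes, its known part has at least length \<open>j\<close>.\<close>

lemma todo_progress:
  assumes "prefix_closed C" "\<rho> \<in> set \<rho>s" "take j \<rho> \<in> C" "j \<le> length \<rho>" "i \<le> j + 12" "i \<le> length \<rho>"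
  shows "take i \<rho> \<in> C \<union> set (todo C \<rho>s)"
  using assms(1-3)
proof (induction \<rho>s arbitrary: C)
  case (Cons x \<rho>s)
  show ?case
  proof (cases "x = \<rho>")
    case True
    have "take i \<rho> \<in> C \<union> set (fresh C \<rho>)"
      using known_len(3)[OF Cons.prems(1) assms(4) Cons.prems(3)] assms by (intro take_fresh Cons.prems) auto
    then show ?thesis using True by auto
  next
    case False
    then have "take i \<rho> \<in> (C \<union> set (fresh C x)) \<union> set (todo (C \<union> set (fresh C x)) \<rho>s)"
      using Cons.prems by (intro Cons.IH prefix_closed_fresh) auto
    then show ?thesis by auto
  qed
qed simp

lemma length_todo: "length (todo C \<rho>s) \<le> 12 * length \<rho>s"
proof (induction \<rho>s arbitrary: C)
  case (Cons \<rho> \<rho>s)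
  have "length (fresh C \<rho>) \<le> 12" by (simp add: fresh_def)
  then show ?case using Cons[of "C \<union> set (fresh C \<rho>)"] by simp
qed simp

lemma set_todo: "x \<in> set (todo C \<rho>s) \<Longrightarrow> \<exists>\<rho>\<in>set \<rho>s. set x \<subseteq> set \<rho>"
  by (induction \<rho>s arbitrary: C) (fastforce simp: fresh_def dest: in_set_takeD)+

lemma length_targets: "length (targets h l r) \<le> 4 * h + 1"
proof -
  have "length (concat (map (\<lambda>i. map (\<lambda>(l', r'). order_upto h i l' r')
     (filter (\<lambda>(l', r'). hi i r' \<le> r) (shifts i l r))) is)) \<le> 4 * length is" for "is"
  proof (induction "is")
    case (Cons i "is")
    have "length (filter P (shifts i l r)) \<le> 4" for P
      using length_filter_le[of P "shifts i l r"] by (simp add: shifts_def)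
    then show ?case using Cons by (simp add: add_le_mono)
  qed simp
  from this[of "[1..<h]"] show ?thesis unfolding targets_def by simp
qed

lemma in_targets_iff:
  "\<rho> \<in> set (targets h l r) \<longleftrightarrow> \<rho> = order_upto h 0 l r \<or>
     (\<exists>i l' r'. 1 \<le> i \<and> i < h \<and> (l', r') \<in> set (shifts i l r) \<and> hi i r' \<le> r \<and> \<rho> = order_upto h i l' r')"
  unfolding targets_def by force

lemma set_targets:
  assumes "\<rho> \<in> set (targets h l r)" "r \<le> l + 2 ^ h" "1 \<le> h"
  shows "set \<rho> \<subseteq> {..<r}"
proof (cases "\<rho> = order_upto h 0 l r")
  case True
  then show ?thesis using assms set_order_upto[of r l h 0] by (auto simp: lo_def hi_def)
next
  case False
  then obtain i l' r' where i: "1 \<le> i" "i < h" "(l', r') \<in> set (shifts i l r)"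
    "hi i r' \<le> r" "\<rho> = order_upto h i l' r'"
    using assms(1) unfolding in_targets_iff by blast
  have r': "r' \<le> r + 2 ^ i" "l \<le> l'" using i(3) by (auto simp: shifts_def)
  have "(2::nat) ^ i \<le> 2 ^ h" using i by (intro power_increasing) auto
  then have "r' \<le> l' + 2 * 2 ^ h" using r' assms(2) by linarith
  then have "set \<rho> = {lo i l'..<hi i r'}" using i assms by (simp add: set_order_upto)
  then show ?thesis using i by auto
qed

text \<open>Within a distance of \<open>2 ^ i\<close> an end crosses at most one multiple of
  \<open>2 ^ i\<close>, so after rounding it agrees with the present end or with that end shifted by
  \<open>2 ^ i\<close>. The four shifts cover all cases.\<close>

lemma in_targets:
  assumes i: "1 \<le> i" "i < h" and l: "l \<le> l'" "l' \<le> l + 2 ^ i" and r: "r \<le> r'" "r' \<le> r + 2 ^ i"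
  shows "order_upto h i l' r' \<in> set (targets h l r)"
proof -
  have div: "x' div 2 ^ i = x div 2 ^ i \<or> x' div 2 ^ i = (x + 2 ^ i) div 2 ^ i"
    if "x \<le> x'" "x' \<le> x + 2 ^ i" for x x' :: nat
  proof -
    have "x div 2 ^ i \<le> x' div 2 ^ i" "x' div 2 ^ i \<le> (x + 2 ^ i) div 2 ^ i"
      by (rule div_le_mono[OF that(1)], rule div_le_mono[OF that(2)])
    moreover have "(x + 2 ^ i) div 2 ^ i = Suc (x div 2 ^ i)" by simp
    ultimately show ?thesis by linarith
  qed
  obtain l0 where l0: "l0 = l \<or> l0 = l + 2 ^ i" "l' div 2 ^ i = l0 div 2 ^ i" using div[OF l] by blast
  obtain r0 where r0: "r0 = r \<or> r0 = r + 2 ^ i" "r' div 2 ^ i = r0 div 2 ^ i" using div[OF r] by blast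
  have "order_upto h i l' r' = order_upto h i l0 r0" using i l0 r0 by (intro order_upto_cong) auto
  moreover have "hi i r0 \<le> r" using hi_bounds(1)[OF i(1), of r0] r0(1) by auto
  moreover have "(l0, r0) \<in> set (shifts i l r)" using l0(1) r0(1) by (auto simp: shifts_def)
  ultimately show ?thesis using i unfolding in_targets_iff by blast
qed

locale schedule =
  fixes h :: nat and L R :: "nat \<Rightarrow> nat" and C :: "nat \<Rightarrow> nat list set" and T :: nat
  assumes start: "L 0 = 0" "R 0 = 0" "C 0 = {[]}"
    and move: "\<And>t. t < T \<Longrightarrow> (L (Suc t) = Suc (L t) \<and> R (Suc t) = R t) \<or> (L (Suc t) = L t \<and> R (Suc t) = Suc (R t))"
    and width: "\<And>t. t \<le> T \<Longrightarrow> R t \<le> L t + 2 ^ h"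
    and C_Suc: "\<And>t. t < T \<Longrightarrow> C (Suc t) = C t \<union> set (todo (C t) (targets h (L (Suc t)) (R (Suc t))))"
    and h: "1 \<le> h"
begin

lemma closed: "t \<le> T \<Longrightarrow> prefix_closed (C t)"
proof (induction t)
  case 0
  then show ?case by (simp add: start prefix_closed_def)
next
  case (Suc t)
  then show ?case using todo_props(1)[of "C t"] C_Suc[of t] by simp
qed

lemma moved: "t \<le> t' \<Longrightarrow> t' \<le> T \<Longrightarrow> L t \<le> L t' \<and> R t \<le> R t' \<and> (L t' - L t) + (R t' - R t) = t' - t"
proof (induction t' rule: dec_induct)
  case (step t')
  then show ?case using move[of t'] by auto
qed simp

lemma progress:
  assumes "t + s \<le> T" "\<And>t'. t < t' \<Longrightarrow> t' \<le> t + s \<Longrightarrow> \<rho> \<in> set (targets h (L t') (R t'))"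
    "take j \<rho> \<in> C t" "j \<le> length \<rho>"
  shows "take (min (j + 12 * s) (length \<rho>)) \<rho> \<in> C (t + s)"
  using assms(1,2)
proof (induction s)
  case 0
  then show ?case using assms by simp
next
  case (Suc s)
  have IH: "take (min (j + 12 * s) (length \<rho>)) \<rho> \<in> C (t + s)" using Suc by auto
  have "take (min (j + 12 * Suc s) (length \<rho>)) \<rho> \<in>
      C (t + s) \<union> set (todo (C (t + s)) (targets h (L (Suc (t + s))) (R (Suc (t + s)))))"
  proof (rule todo_progress[OF _ _ IH])
    show "prefix_closed (C (t + s))" using Suc.prems(1) by (intro closed) simp
    show "\<rho> \<in> set (targets h (L (Suc (t + s))) (R (Suc (t + s))))" using Suc.prems(2)[of "Suc (t + s)"] by simp
  qed auto
  also have "\<dots> = C (Suc (t + s))" using Suc.prems(1) by (intro C_Suc[symmetric]) simp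
  finally show ?case by simp
qed

text \<open>From coarse to fine levels: a window within \<open>2 ^ (i - 1)\<close> moves was within
  \<open>2 ^ i\<close> moves \<open>2 ^ (i - 1)\<close> updates ago, when its order of level
  \<open>Suc i\<close> was ready. Since then its order of level \<open>i\<close> has been a target
  at every update, which gives time for \<open>12 * 2 ^ (i - 1)\<close> further elements.\<close>

lemma ready:
  assumes "1 \<le> i" "i \<le> h" "t \<le> T" "L t \<le> l'" "R t \<le> r'" "(l' - L t) + (r' - R t) \<le> 2 ^ (i - 1)"
  shows "order_upto h i l' r' \<in> C t"
  using assms(2,1,3-)
proof (induction i arbitrary: t rule: inc_induct)
  case base
  then show ?case using closed[of t] by (simp add: order_upto_top prefix_closed_def)
next
  case (step i)
  let ?s = "2 ^ (i - 1) :: nat"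
  have s: "2 * ?s = 2 ^ i" using step.prems(1) by (cases i) auto
  have "(2::nat) ^ i \<le> 2 ^ h" using step by (intro power_increasing) auto
  then have w: "r' \<le> l' + 2 * 2 ^ h" using width[OF step.prems(2)] step.prems s by linarith
  show ?case
  proof (cases "t < ?s")
    \<comment> \<open>Too early to look back that far; but then \<open>r'\<close> is below
      \<open>2 ^ i\<close> and the order of level \<open>i\<close> is empty.\<close>
    case True
    have "R t \<le> t" using moved[of 0 t] step.prems start by simp
    then have "r' < 2 ^ i" using True step.prems s by linarith
    then have "hi i r' = 0" using step.prems(1) by (simp add: hi_def)
    then have "set (order_upto h i l' r') = {}" using set_order_upto[OF w h, of i] step.hyps by simp
    then show ?thesis using closed[OF step.prems(2)] by (simp add: prefix_closed_def)
  next
    case False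
    define t0 where "t0 = t - ?s"
    have t0: "t0 + ?s = t" using False by (simp add: t0_def)
    let ?\<rho> = "order_upto h i l' r'" and ?p = "order_upto h (Suc i) l' r'"
    have near: "L t' \<le> l' \<and> R t' \<le> r' \<and> (l' - L t') + (r' - R t') \<le> 2 ^ i" if "t0 \<le> t'" "t' \<le> t" for t'
    proof -
      have "t - t' \<le> ?s" using that t0 by simp
      moreover have "L t' \<le> L t" "R t' \<le> R t" "(L t - L t') + (R t - R t') = t - t'"
        using moved[of t' t] step.prems(2) that by auto
      moreover have "(l' - L t) + (r' - R t) \<le> ?s" using step.prems(5) .
      ultimately show ?thesis using step.prems(3,4) s by linarith
    qed
    have "?p \<in> C t0" using near[of t0] step.prems t0 by (intro step.IH) auto
    moreover have "take (length ?p) ?\<rho> = ?p" unfolding order_upto_step[OF step.hyps(2)] by simp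
    moreover have "length ?p \<le> length ?\<rho>" unfolding order_upto_step[OF step.hyps(2)] by simp
    moreover have "?\<rho> \<in> set (targets h (L t') (R t'))" if "t0 < t'" "t' \<le> t0 + ?s" for t'
      using near[of t'] that t0 step.hyps step.prems(1) by (intro in_targets) auto
    ultimately have "take (min (length ?p + 12 * ?s) (length ?\<rho>)) ?\<rho> \<in> C (t0 + ?s)"
      using step.prems(2) t0 by (intro progress) auto
    moreover have "length ?\<rho> \<le> length ?p + 12 * ?s"
      using length_order_upto(2)[OF w h, of i] step.hyps step.prems(1) s by simp
    ultimately show ?thesis using t0 by (simp add: min_def split: if_splits)
  qed
qed

text \<open>The level 1 order of the new window is one move away and hence known before the update;
  the update itself adds the at most 8 elements of level 0.\<close>

theorem window_ready:
  assumes "t < T"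
  shows "order_upto h 0 (L (Suc t)) (R (Suc t)) \<in> C (Suc t)"
proof -
  let ?l = "L (Suc t)" and ?r = "R (Suc t)"
  let ?\<rho> = "order_upto h 0 ?l ?r" and ?p = "order_upto h (Suc 0) ?l ?r"
  have "?p \<in> C t" using moved[of t "Suc t"] assms h by (intro ready) auto
  moreover have eq: "take (length ?p) ?\<rho> = ?p" "length ?p \<le> length ?\<rho>"
    using order_upto_step[of 0 h ?l ?r] h by simp_all
  moreover have "?r \<le> ?l + 2 * 2 ^ h" using width[of "Suc t"] assms by simp
  then have "length ?\<rho> \<le> length ?p + 12" using length_order_upto(1)[of ?r ?l h 0] h by simp
  moreover have "?\<rho> \<in> set (targets h ?l ?r)" by (simp add: targets_def)
  ultimately have "take (length ?\<rho>) ?\<rho> \<in> C t \<union> set (todo (C t) (targets h ?l ?r))"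
    using closed[of t] assms by (intro todo_progress[where j = "length ?p"]) auto
  then show ?thesis using C_Suc[OF assms] by simp
qed

end

section \<open>Computations\<close>

primrec bind_comp :: "'a comp \<Rightarrow> ('a \<Rightarrow> 'b comp) \<Rightarrow> 'b comp" where
  "bind_comp (Done r) k = k r"
| "bind_comp (Value_Query S c) k = Value_Query S (\<lambda>v. bind_comp (c v) k)"
| "bind_comp (Indep_Query S c) k = Indep_Query S (\<lambda>b. bind_comp (c b) k)"
| "bind_comp (Coin c) k = Coin (\<lambda>b. bind_comp (c b) k)"

lemma exec_bind_comp:
  "exec val ind (bind_comp c k) =
     exec val ind c \<bind> (\<lambda>(r, q). map_pmf (\<lambda>(r', q'). (r', q + q')) (exec val ind (k r)))"
proof (induction c)
  case (Done r)
  show ?case by (simp add: bind_return_pmf case_prod_beta')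
next
  case (Value_Query S c)
  then show ?case
    by (simp add: map_bind_pmf bind_map_pmf map_pmf_comp case_prod_beta' o_def)
next
  case (Coin c)
  then show ?case by (simp add: bind_assoc_pmf)
qed simp

lemma exec_map_comp:
  "exec val ind (map_comp g c) = map_pmf (\<lambda>(r, q). (g r, q)) (exec val ind c)"
  by (induction c) (simp_all add: map_pmf_comp case_prod_beta' map_bind_pmf)

text \<open>A distribution that a computation can generate with fair coins at no query cost and
  independently of the oracles. Closure under the usual operations replaces explicit
  samplers.\<close>

definition coinable :: "'a pmf \<Rightarrow> bool" where
  "coinable p \<longleftrightarrow> (\<exists>c. \<forall>val ind. exec val ind c = map_pmf (\<lambda>r. (r, 0)) p)"

definition coin_comp :: "'a pmf \<Rightarrow> 'a comp" where
  "coin_comp p = (SOME c. \<forall>val ind. exec val ind c = map_pmf (\<lambda>r. (r, 0)) p)"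

lemma exec_coin_comp: "coinable p \<Longrightarrow> exec val ind (coin_comp p) = map_pmf (\<lambda>r. (r, 0)) p"
  unfolding coinable_def coin_comp_def by (rule someI2_ex) auto

lemma exec_bind_coin_comp:
  "coinable p \<Longrightarrow> exec val ind (bind_comp (coin_comp p) k) = p \<bind> (\<lambda>r. exec val ind (k r))"
  by (simp add: exec_bind_comp exec_coin_comp bind_map_pmf case_prod_beta')

lemma coinable_return: "coinable (return_pmf x)"
  unfolding coinable_def by (rule exI[of _ "Done x"]) simp

lemma coinable_bernoulli: "coinable (bernoulli_pmf (1/2))"
  unfolding coinable_def by (rule exI[of _ "Coin Done"]) (simp add: map_pmf_def)

lemma coinable_bind:
  fixes p :: "'a pmf" and g :: "'a \<Rightarrow> 'b pmf"
  assumes "coinable p" "\<And>x. coinable (g x)"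
  shows "coinable (p \<bind> g)"
proof -
  have "exec val ind (bind_comp (coin_comp p) (\<lambda>x. coin_comp (g x))) = map_pmf (\<lambda>r. (r, 0)) (p \<bind> g)" for val ind
    using assms by (simp add: exec_bind_coin_comp exec_coin_comp map_bind_pmf)
  then show ?thesis unfolding coinable_def by blast
qed

lemma coinable_map: "coinable p \<Longrightarrow> coinable (map_pmf g p)"
  unfolding map_pmf_def by (intro coinable_bind coinable_return)

text \<open>One coin chooses the leading bit. This is where \<open>H\<close> being a power of two is
  used.\<close>

lemma coinable_uniform: "coinable (pmf_of_set {..<(2::nat) ^ c})"
proof (induction c)
  case 0
  have "pmf_of_set {..<(2::nat) ^ 0} = return_pmf 0"
    by (simp add: lessThan_Suc pmf_of_set_singleton)
  then show ?case by (simp add: coinable_return)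
next
  case (Suc c)
  let ?U = "pmf_of_set {..<(2::nat) ^ c}"
  let ?V = "bernoulli_pmf (1/2) \<bind> (\<lambda>b. map_pmf (\<lambda>x. if b then x + 2 ^ c else x) ?U)"
  have ne: "{..<(2::nat) ^ c} \<noteq> {}" "{..<2 * (2::nat) ^ c} \<noteq> {}" by (auto simp: lessThan_empty_iff)
  have T: "map_pmf (\<lambda>x. x + 2 ^ c) ?U = pmf_of_set {2 ^ c..<2 * 2 ^ c}"
  proof -
    have "(\<lambda>x. x + (2::nat) ^ c) ` {..<2 ^ c} = {2 ^ c..<2 * 2 ^ c}"
      using image_add_atLeastLessThan'[of "2 ^ c" 0 "2 ^ c"] by (simp only: lessThan_atLeast0 add_0 mult_2)
    then show ?thesis using ne by (subst map_pmf_of_set_inj) (auto simp: inj_on_def)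
  qed
  have "?V = pmf_of_set {..<2 ^ Suc c}"
  proof (rule pmf_eqI)
    fix i
    have "pmf ?V i = (pmf (map_pmf (\<lambda>x. x + 2 ^ c) ?U) i + pmf ?U i) / 2"
      unfolding pmf_bind by (simp add: field_simps)
    also have "\<dots> = pmf (pmf_of_set {..<2 ^ Suc c}) i"
      unfolding T using ne by (auto simp: indicator_def field_simps)
    finally show "pmf ?V i = pmf (pmf_of_set {..<2 ^ Suc c}) i" .
  qed
  moreover have "coinable ?V" by (intro coinable_bind coinable_bernoulli coinable_map Suc)
  ultimately show ?case by simp
qed

lemma coinable_Pi: "finite A \<Longrightarrow> (\<And>x. coinable (p x)) \<Longrightarrow> coinable (Pi_pmf A d p)"
proof (induction A rule: finite_induct)
  case empty
  then show ?case by (simp add: coinable_return)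
next
  case (insert x A)
  then show ?case by (subst Pi_pmf_insert') (auto intro!: coinable_bind coinable_return)
qed

lemma coinable_replicate: "coinable p \<Longrightarrow> coinable (replicate_pmf m p)"
  by (induction m) (auto intro!: coinable_bind coinable_return)

lemma coinable_merge: "coinable (merge M i B C)"
proof (induction i arbitrary: B C)
  case (Suc i)
  then have "coinable (if b then merge M i B' C' else merge M i B'' C'')" for b B' C' B'' C''
    by simp
  then show ?case
    by (auto simp: case_prod_beta' intro!: coinable_return coinable_bind coinable_bernoulli)
qed (simp add: coinable_return)

lemma coinable_swap_round: "coinable (swap_round M i p T j)"
  by (induction p arbitrary: j) (auto intro!: coinable_return coinable_bind coinable_merge)

lemma coinable_round: "coinable (round_pmf k M st)"
  unfolding round_pmf_def by (cases st) (simp add: coinable_swap_round)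

lemma coinable_seed: "finite N \<Longrightarrow> coinable (seed_pmf N (2 ^ c) s n)"
  unfolding seed_pmf_def sample_pmf_def point_pmf_def
  by (intro coinable_Pi coinable_uniform) auto

text \<open>The answers are collected in a function with default 0; the continuations used later
  depend only on its values at the queried sets.\<close>

primrec query_list :: "nat set list \<Rightarrow> ((nat set \<Rightarrow> real) \<Rightarrow> 'r comp) \<Rightarrow> 'r comp" where
  "query_list [] k = k (\<lambda>_. 0)"
| "query_list (S # Ss) k = Value_Query S (\<lambda>v. query_list Ss (\<lambda>g. k (g(S := v))))"

lemma exec_query_list:
  "exec val ind (query_list Ss k) =
     map_pmf (\<lambda>(r, q). (r, q + length Ss)) (exec val ind (k (\<lambda>S. if S \<in> set Ss then val S else 0)))"
proof (induction Ss arbitrary: k)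
  case Nil
  show ?case by (simp add: case_prod_beta')
next
  case (Cons S Ss)
  have "(\<lambda>T. if T \<in> set Ss then val T else 0)(S := val S) = (\<lambda>T. if T \<in> set (S # Ss) then val T else 0)"
    by auto
  then show ?case by (simp add: Cons map_pmf_comp case_prod_beta')
qed

primrec indep_list :: "nat set list \<Rightarrow> (nat set set \<Rightarrow> 'r comp) \<Rightarrow> 'r comp" where
  "indep_list [] k = k {}"
| "indep_list (S # Ss) k = Indep_Query S (\<lambda>b. indep_list Ss (\<lambda>M. k (if b then insert S M else M)))"

lemma exec_indep_list:
  "exec val ind (indep_list Ss k) = exec val ind (k {S \<in> set Ss. ind S})"
proof (induction Ss arbitrary: k)
  case (Cons S Ss)
  have "(if ind S then insert S {S \<in> set Ss. ind S} else {S \<in> set Ss. ind S}) = {T \<in> set (S # Ss). ind T}"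
    by auto
  then show ?case by (simp add: Cons)
qed simp

section \<open>The dynamic algorithm\<close>

text \<open>Nodes are lists of arrival numbers; the table holds the state of the streaming algorithm
  after every computed node.\<close>

primrec compute :: "nat \<Rightarrow> nat \<Rightarrow> nat \<Rightarrow> (nat \<Rightarrow> nat \<Rightarrow> nat \<Rightarrow> nat) \<Rightarrow> nat list \<Rightarrow> nat set set \<Rightarrow> nat list list \<Rightarrow>
    (nat list \<Rightarrow> state) \<Rightarrow> ((nat list \<Rightarrow> state) \<Rightarrow> 'r comp) \<Rightarrow> 'r comp" where
  "compute k H s \<omega> arr M [] tab kont = kont tab"
| "compute k H s \<omega> arr M (x # xs) tab kont =
     (let st = tab (butlast x); u = arr ! last x; zs = \<omega> (length (butlast x)) in
      query_list (step_queries H s zs st u)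
        (\<lambda>g. compute k H s \<omega> arr M xs (tab(x := step k H s g M zs st u)) kont))"

definition node_state :: "nat \<Rightarrow> nat \<Rightarrow> nat \<Rightarrow> (nat set \<Rightarrow> real) \<Rightarrow> nat set set \<Rightarrow> (nat \<Rightarrow> nat \<Rightarrow> nat \<Rightarrow> nat) \<Rightarrow>
    nat list \<Rightarrow> nat list \<Rightarrow> state" where
  "node_state k H s f M \<omega> arr x = process k H s f M \<omega> (map ((!) arr) x)"

text \<open>\<open>W\<close> is the set of elements seen, on whose subsets the oracle answers agree
  with \<open>f\<close> and \<open>M'\<close> agrees with \<open>M\<close>. Steps look at nothing
  outside \<open>W\<close>, so the computed states are those of the true objective and
  matroid.\<close>

lemma exec_compute:
  assumes W: "\<forall>S. S \<subseteq> W \<longrightarrow> val S = f S" and M': "{S \<in> M'. S \<subseteq> W} = {S \<in> M. S \<subseteq> W}"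
    and arr: "set arr \<subseteq> W"
    and "extends_by C xs" "\<forall>y\<in>C. tab y = node_state k H s f M \<omega> arr y"
    and "\<forall>x\<in>set xs. set x \<subseteq> {..<length arr}"
  shows "exec val ind (compute k H s \<omega> arr M' xs tab kont) =
    map_pmf (\<lambda>(r, q). (r, q + length xs * (1 + 2 * s)))
      (exec val ind (kont (\<lambda>y. if y \<in> set xs then node_state k H s f M \<omega> arr y else tab y)))"
  using assms(4-)
proof (induction xs arbitrary: C tab)
  case Nil
  show ?case by (simp add: case_prod_beta')
next
  case (Cons x xs)
  let ?st = "tab (butlast x)" and ?u = "arr ! last x" and ?zs = "\<omega> (length (butlast x))"
  have x: "x \<noteq> []" "butlast x \<in> C" "extends_by (insert x C) xs" using Cons.prems(1) by auto
  have x_eq: "x = butlast x @ [last x]" using x by simp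
  have st: "?st = process k H s f M \<omega> (map ((!) arr) (butlast x))"
    using Cons.prems(2) x by (simp add: node_state_def)
  have sub: "set x \<subseteq> {..<length arr}" using Cons.prems(3) by simp
  have u: "?u \<in> W" using sub x arr by (metis last_in_set lessThan_iff nth_mem subsetD)
  have "set (fst ?st) \<subseteq> W"
  proof
    fix v assume "v \<in> set (fst ?st)"
    then obtain i where "i \<in> set (butlast x)" "v = arr ! i" unfolding st fst_process by auto
    then show "v \<in> W" using sub arr in_set_butlastD[of i x] by (metis lessThan_iff nth_mem subsetD)
  qed
  then have V: "insert ?u (set (fst ?st)) \<subseteq> W" using u by simp
  define g where "g S = (if S \<in> set (step_queries H s ?zs ?st ?u) then val S else 0)" for S
  have "step k H s g M' ?zs ?st ?u = step k H s f M' ?zs ?st ?u"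
  proof (intro step_cong ballI)
    fix S assume S: "S \<in> set (step_queries H s ?zs ?st ?u)"
    then have "S \<subseteq> W" using step_queries_subset V by blast
    then have "val S = f S" using W by blast
    then show "g S = f S" using S unfolding g_def by (simp only: if_True)
  qed
  also have "\<dots> = step k H s f {S \<in> M'. S \<subseteq> W} ?zs ?st ?u" using step_restrict[OF V] by simp
  also have "\<dots> = step k H s f M ?zs ?st ?u" unfolding M' using step_restrict[OF V] by simp
  also have "\<dots> = node_state k H s f M \<omega> arr x"
  proof -
    have "map ((!) arr) x = map ((!) arr) (butlast x) @ [?u]" by (subst x_eq) simp
    then show ?thesis unfolding node_state_def st by (simp add: process_snoc)
  qed
  finally have step: "step k H s g M' ?zs ?st ?u = node_state k H s f M \<omega> arr x" .
  have "exec val ind (compute k H s \<omega> arr M' (x # xs) tab kont) =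
     map_pmf (\<lambda>(r, q). (r, q + (1 + 2 * s)))
       (exec val ind (compute k H s \<omega> arr M' xs (tab(x := node_state k H s f M \<omega> arr x)) kont))"
    unfolding compute.simps Let_def exec_query_list length_step_queries g_def[symmetric] step ..
  also have "exec val ind (compute k H s \<omega> arr M' xs (tab(x := node_state k H s f M \<omega> arr x)) kont) =
     map_pmf (\<lambda>(r, q). (r, q + length xs * (1 + 2 * s)))
      (exec val ind (kont (\<lambda>y. if y \<in> set xs then node_state k H s f M \<omega> arr y else (tab(x := node_state k H s f M \<omega> arr x)) y)))"
    using Cons.prems x by (intro Cons.IH[of "insert x C"]) auto
  also have "(\<lambda>y. if y \<in> set xs then node_state k H s f M \<omega> arr y else (tab(x := node_state k H s f M \<omega> arr x)) y) =
     (\<lambda>y. if y \<in> set (x # xs) then node_state k H s f M \<omega> arr y else tab y)" by auto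
  finally show ?case by (simp add: map_pmf_comp case_prod_beta' algebra_simps)
qed

type_synonym memory = "nat list \<times> nat \<times> nat list set \<times> (nat list \<Rightarrow> state)"

fun arrive :: "nat list \<times> nat \<Rightarrow> update \<Rightarrow> nat list \<times> nat" where
  "arrive (arr, l) (Insert e) = (arr @ [e], l)"
| "arrive (arr, l) (Delete e) = (arr, Suc l)"

text \<open>Independence queries are not counted, so the whole family visible through the oracle is
  read at every update.\<close>

definition ground_list :: "nat \<Rightarrow> nat set list" where
  "ground_list n = map set (List.subseqs [1..<Suc n])"

fun react :: "nat \<Rightarrow> nat \<Rightarrow> nat \<Rightarrow> nat \<Rightarrow> nat \<Rightarrow> nat \<Rightarrow> (nat \<Rightarrow> nat \<Rightarrow> nat \<Rightarrow> nat) \<Rightarrow> memory \<Rightarrow> update \<Rightarrow> (nat set \<times> memory) comp" where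
  "react n k H s m h \<omega> (arr, l, C, tab) u =
    (case arrive (arr, l) u of (arr', l') \<Rightarrow>
      let new = todo C (targets h l' (length arr')); w = order_upto h 0 l' (length arr') in
      indep_list (ground_list n) (\<lambda>M. compute k H s \<omega> arr' M new tab (\<lambda>tab'.
        bind_comp (coin_comp (replicate_pmf m (round_pmf k {S \<in> M. S \<subseteq> (!) arr' ` set w} (tab' w))))
          (\<lambda>Ss. query_list Ss (\<lambda>g. Done (best g Ss, (arr', l', C \<union> set new, tab')))))))"

primcorec machine :: "('m \<Rightarrow> update \<Rightarrow> (nat set \<times> 'm) comp) \<Rightarrow> 'm \<Rightarrow> dyn_alg" where
  "on_update (machine stp x) = (\<lambda>u. map_comp (map_prod id (machine stp)) (stp x u))"

definition start_memory :: memory where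
  "start_memory = ([], 0, {[]}, (\<lambda>_. init))"

text \<open>An algorithm can toss coins only while reacting, so the seed is drawn at the first
  update and then kept for good; the coins for rounding are fresh at each update.\<close>

definition sliding_alg :: "nat \<Rightarrow> nat \<Rightarrow> nat \<Rightarrow> nat \<Rightarrow> nat \<Rightarrow> nat \<Rightarrow> dyn_alg" where
  "sliding_alg n k c s m h = Dyn_Alg (\<lambda>u. bind_comp (coin_comp (seed_pmf {1..n} (2 ^ c) s n))
     (\<lambda>\<omega>. on_update (machine (react n k (2 ^ c) s m h \<omega>) start_memory) u))"

section \<open>Runs of the dynamic algorithm\<close>

definition position :: "update list \<Rightarrow> nat list \<times> nat" where
  "position us = foldl arrive ([], 0) us"

text \<open>The present elements form the suffix of \<open>arr\<close> from \<open>l\<close> on. As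
  deletions are FIFO they remove the head of this suffix, so it suffices to advance
  \<open>l\<close>; an element inserted again gets a new arrival number.\<close>

lemma fifo_step:
  assumes "fifo_from N (drop l arr) (u # us)" "distinct (drop l arr)" "set arr \<subseteq> N" "l \<le> length arr"
    and "arrive (arr, l) u = (arr', l')"
  shows "(fifo_from N (drop l' arr') us \<and> distinct (drop l' arr') \<and> set arr' \<subseteq> N \<and> l' \<le> length arr' \<and>
      present_step u (set (drop l arr)) = set (drop l' arr')) \<and>
    insert (mentioned u) (set arr) = set arr' \<and> take (length arr) arr' = arr \<and>
    (l' = Suc l \<and> length arr' = length arr \<or> l' = l \<and> length arr' = Suc (length arr))"
proof (cases u)
  case (Insert e)
  then have "arr' = arr @ [e]" "l' = l" using assms(5) by auto
  then show ?thesis using assms Insert by auto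
next
  case (Delete e)
  then have a: "arr' = arr" "l' = Suc l" using assms(5) by auto
  have ne: "drop l arr \<noteq> []" and e: "e = hd (drop l arr)" and ff: "fifo_from N (tl (drop l arr)) us"
    using assms(1) Delete by auto
  have d: "drop l arr = e # drop (Suc l) arr"
    using ne e by (metis drop_Suc list.collapse tl_drop)
  have "l < length arr" using ne by simp
  moreover have "e \<in> set arr" using d by (metis in_set_dropD list.set_intros(1))
  moreover have "tl (drop l arr) = drop (Suc l) arr" using d by simp
  ultimately show ?thesis using assms(2,3) ff Delete d a by (auto simp: d)
qed

lemma process_restrict:
  "set es \<subseteq> V \<Longrightarrow> process k H s f {S \<in> M. S \<subseteq> V} \<omega> es = process k H s f M \<omega> es"
proof (induction es rule: rev_induct)
  case (snoc u es)
  then show ?case by (simp add: process_snoc) (rule step_restrict, auto simp: fst_process)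
qed (simp add: process_Nil)

locale window_run =
  fixes n k c s m h :: nat and f :: "nat set \<Rightarrow> real" and M :: "nat set set" and us :: "update list"
  assumes fifo: "sliding_window_stream {1..n} us"
    and nonneg: "\<forall>S\<subseteq>{1..n}. 0 \<le> f S" and mono: "mono_on (Pow {1..n}) f" and sub: "submodular_on {1..n} f"
    and mat: "matroid {1..n} M" and rank: "matroid_rank M = k" and k: "0 < k" and n: "0 < n"
    and h: "1 \<le> h" "n \<le> 2 ^ h" and m: "0 < m" and s: "0 < s"
begin

abbreviation "N \<equiv> {1..n}"
abbreviation "H \<equiv> (2::nat) ^ c"

definition arr :: "nat \<Rightarrow> nat list" where "arr t = fst (position (take t us))"
definition lft :: "nat \<Rightarrow> nat" where "lft t = snd (position (take t us))"
abbreviation "rgt t \<equiv> length (arr t)"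
definition win :: "nat \<Rightarrow> nat set" where "win t = set (drop (lft t) (arr t))"

primrec computed :: "nat \<Rightarrow> nat list set" where
  "computed 0 = {[]}"
| "computed (Suc t) = computed t \<union> set (todo (computed t) (targets h (lft (Suc t)) (rgt (Suc t))))"

definition order :: "nat \<Rightarrow> nat list" where "order t = order_upto h 0 (lft t) (rgt t)"
definition elems :: "nat \<Rightarrow> nat list" where "elems t = map ((!) (arr t)) (order t)"

lemma arrive_pos: "t < length us \<Longrightarrow> arrive (arr t, lft t) (us ! t) = (arr (Suc t), lft (Suc t))"
  by (simp add: arr_def lft_def position_def take_Suc_conv_app_nth)

lemma pos_props:
  "t \<le> length us \<Longrightarrow> fifo_from N (drop (lft t) (arr t)) (drop t us) \<and> distinct (drop (lft t) (arr t)) \<and>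
     set (arr t) \<subseteq> N \<and> lft t \<le> rgt t \<and> present (take t us) = win t"
proof (induction t)
  case 0
  then show ?case using fifo by (simp add: arr_def lft_def position_def win_def present_def)
next
  case (Suc t)
  then have d: "drop t us = us ! t # drop (Suc t) us" by (simp add: Cons_nth_drop_Suc)
  have IH: "fifo_from N (drop (lft t) (arr t)) (us ! t # drop (Suc t) us)" "distinct (drop (lft t) (arr t))"
    "set (arr t) \<subseteq> N" "lft t \<le> rgt t" "present (take t us) = win t"
    using Suc d by auto
  have "present (take (Suc t) us) = present_step (us ! t) (present (take t us))"
    using Suc.prems by (simp add: present_def take_Suc_conv_app_nth)
  then show ?case
    using fifo_step[OF IH(1-4) arrive_pos] Suc.prems IH(5) by (simp add: win_def)
qed

lemma fifo_at: "t < length us \<Longrightarrow> fifo_from N (drop (lft t) (arr t)) (us ! t # drop (Suc t) us)"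
  using pos_props[of t] by (simp add: Cons_nth_drop_Suc)

lemma step_props:
  assumes "t < length us"
  shows "insert (mentioned (us ! t)) (set (arr t)) = set (arr (Suc t))"
    and "take (rgt t) (arr (Suc t)) = arr t"
    and "(lft (Suc t) = Suc (lft t) \<and> rgt (Suc t) = rgt t) \<or> (lft (Suc t) = lft t \<and> rgt (Suc t) = Suc (rgt t))"
  using fifo_step[OF fifo_at[OF assms] _ _ _ arrive_pos[OF assms]] pos_props[of t] assms by auto

lemma window_size: "t \<le> length us \<Longrightarrow> rgt t \<le> lft t + n"
proof -
  assume t: "t \<le> length us"
  have "length (drop (lft t) (arr t)) = card (win t)"
    using pos_props[OF t] by (simp add: win_def distinct_card)
  also have "\<dots> \<le> card N" using pos_props[OF t] set_drop_subset[of "lft t" "arr t"]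
    by (intro card_mono) (auto simp: win_def)
  finally show ?thesis by simp
qed

lemma width': "t \<le> length us \<Longrightarrow> rgt t \<le> lft t + 2 ^ h"
  using window_size[of t] h by simp

sublocale schedule h lft "\<lambda>t. rgt t" computed "length us"
proof unfold_locales
  show "lft 0 = 0" "rgt 0 = 0" by (simp_all add: arr_def lft_def position_def)
qed (use step_props(3) width' h in auto)

lemma computed_bounded: "t \<le> length us \<Longrightarrow> y \<in> computed t \<Longrightarrow> set y \<subseteq> {..<rgt t}"
proof (induction t arbitrary: y)
  case 0
  then show ?case by simp
next
  case (Suc t)
  show ?case
  proof (cases "y \<in> computed t")
    case True
    then have "set y \<subseteq> {..<rgt t}" using Suc by simp
    moreover have "rgt t \<le> rgt (Suc t)" using step_props(3)[of t] Suc.prems by auto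
    ultimately show ?thesis by auto
  next
    case False
    then have "y \<in> set (todo (computed t) (targets h (lft (Suc t)) (rgt (Suc t))))"
      using Suc.prems by simp
    from set_todo[OF this] obtain \<rho> where
      "\<rho> \<in> set (targets h (lft (Suc t)) (rgt (Suc t)))" "set y \<subseteq> set \<rho>" by blast
    then show ?thesis using set_targets[of \<rho> h] width'[of "Suc t"] Suc.prems h by blast
  qed
qed

lemma elems: "t \<le> length us \<Longrightarrow> distinct (elems t) \<and> set (elems t) = win t \<and> length (elems t) \<le> n"
proof -
  assume t: "t \<le> length us"
  have so: "set (order t) = {lft t..<rgt t}"
    unfolding order_def using width'[OF t] h by (subst set_order_upto) (auto simp: lo_def hi_def)
  have do: "distinct (order t)" unfolding order_def by (rule distinct_order_upto) simp
  have l: "lft t \<le> rgt t" using pos_props[OF t] by simp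
  have dd: "distinct (drop (lft t) (arr t))" using pos_props[OF t] by simp
  have "inj_on ((!) (arr t)) {lft t..<rgt t}"
  proof (rule inj_onI)
    fix i j assume ij: "i \<in> {lft t..<rgt t}" "j \<in> {lft t..<rgt t}" "arr t ! i = arr t ! j"
    then have "drop (lft t) (arr t) ! (i - lft t) = drop (lft t) (arr t) ! (j - lft t)" by simp
    moreover have "i - lft t < length (drop (lft t) (arr t))" "j - lft t < length (drop (lft t) (arr t))"
      using ij by auto
    ultimately have "i - lft t = j - lft t" using dd nth_eq_iff_index_eq by blast
    then show "i = j" using ij by auto
  qed
  then have d: "distinct (elems t)" using do so by (simp add: elems_def distinct_map)
  have "set (elems t) = (!) (arr t) ` {lft t..<rgt t}" by (simp add: elems_def so)
  also have "\<dots> = win t"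
  proof -
    have "drop (lft t) (arr t) = map ((!) (arr t)) [lft t..<rgt t]" by (rule nth_equalityI) simp_all
    then show ?thesis by (simp add: win_def)
  qed
  finally have w: "set (elems t) = win t" .
  have "length (elems t) = card {lft t..<rgt t}" using do so by (metis distinct_card elems_def length_map)
  then show ?thesis using d w window_size[OF t] by simp
qed

lemma win_sub: "t \<le> length us \<Longrightarrow> win t \<subseteq> set (arr t) \<and> win t \<subseteq> N"
  using pos_props[of t] set_drop_subset[of "lft t" "arr t"] by (auto simp: win_def)

abbreviation "Mw t \<equiv> {S \<in> M. S \<subseteq> win t}"

lemma matroid_restrict:
  shows "matroid N {S \<in> M. S \<subseteq> V}"
proof -
  interpret M: matroid_on N M by unfold_locales (rule mat)
  show ?thesis
    unfolding matroid_def
  proof (intro conjI ballI allI impI)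
    show "{S \<in> M. S \<subseteq> V} \<subseteq> Pow N" using M.indep_sub by blast
    show "{} \<in> {S \<in> M. S \<subseteq> V}" using M.indep_empty by simp
    fix I J assume I: "I \<in> {S \<in> M. S \<subseteq> V}"
    show "J \<in> {S \<in> M. S \<subseteq> V}" if "J \<subseteq> I"
      using I that M.indep_down[of I J] by auto
    assume J: "J \<in> {S \<in> M. S \<subseteq> V}" and "card I < card J"
    then obtain x where "x \<in> J - I" "insert x I \<in> M" using M.augment[of I J] I by auto
    then show "\<exists>x\<in>J - I. insert x I \<in> {S \<in> M. S \<subseteq> V}" using I J by blast
  qed simp
qed

lemma streaming_win: "t \<le> length us \<Longrightarrow> streaming N f (Mw t) k H"
proof unfold_locales
  show "\<And>S. S \<subseteq> N \<Longrightarrow> 0 \<le> f S" using nonneg by auto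
  assume t: "t \<le> length us"
  then show "matroid N (Mw t)" by (intro matroid_restrict)
  fix I assume "I \<in> Mw t"
  moreover have "finite M" using mat finite_subset[of M "Pow N"] by (auto simp: matroid_def)
  ultimately show "card I \<le> k" using rank unfolding matroid_rank_def by (auto intro!: Max_ge)
qed (use mono sub k in auto)

definition out :: "(nat \<Rightarrow> nat \<Rightarrow> nat \<Rightarrow> nat) \<Rightarrow> nat \<Rightarrow> nat set pmf" where
  "out \<omega> t = map_pmf (best f) (replicate_pmf m (round_pmf k (Mw t) (process k H s f M \<omega> (elems t))))"

lemma round_support:
  assumes "t \<le> length us" "Ss \<in> set_pmf (replicate_pmf m (round_pmf k (Mw t) (process k H s f M \<omega> (elems t))))"
  shows "length Ss = m" "\<forall>S\<in>set Ss. S \<in> Mw t"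
proof -
  interpret S: streaming N f "Mw t" k H by (rule streaming_win) fact
  have "set Ss \<subseteq> set_pmf (round_pmf k (Mw t) (process k H s f M \<omega> (elems t)))" and "length Ss = m"
    using assms(2) by (auto simp: set_replicate_pmf lists_eq_set)
  then show "length Ss = m" "\<forall>S\<in>set Ss. S \<in> Mw t"
    using S.set_round_pmf by blast+
qed

lemma set_out: "t \<le> length us \<Longrightarrow> S \<in> set_pmf (out \<omega> t) \<Longrightarrow> S \<in> M \<and> S \<subseteq> win t"
proof -
  assume t: "t \<le> length us" and "S \<in> set_pmf (out \<omega> t)"
  then obtain Ss where Ss: "Ss \<in> set_pmf (replicate_pmf m (round_pmf k (Mw t) (process k H s f M \<omega> (elems t))))"
    "S = best f Ss" unfolding out_def by auto
  have "Ss \<noteq> []" using round_support(1)[OF t Ss(1)] m by auto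
  then show ?thesis using best_in[of Ss f] round_support(2)[OF t Ss(1)] Ss(2) by auto
qed

definition table_ok :: "(nat \<Rightarrow> nat \<Rightarrow> nat \<Rightarrow> nat) \<Rightarrow> nat \<Rightarrow> (nat list \<Rightarrow> state) \<Rightarrow> bool" where
  "table_ok \<omega> t tab \<longleftrightarrow> (\<forall>y\<in>computed t. tab y = node_state k H s f M \<omega> (arr t) y)"

definition query_bound :: nat where "query_bound = 12 * (4 * h + 1) * (1 + 2 * s) + m"

text \<open>For a fixed seed only the solution is random: the next memory and the number of queries
  appear as constants under the distribution.\<close>

lemma exec_react:
  assumes t: "t < length us" and tab: "table_ok \<omega> t tab"
  shows "\<exists>tab' q. table_ok \<omega> (Suc t) tab' \<and> q \<le> query_bound \<and>
    exec (\<lambda>S. f (S \<inter> set (arr (Suc t)))) (\<lambda>S. S \<inter> set (arr (Suc t)) \<in> M)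
      (react n k H s m h \<omega> (arr t, lft t, computed t, tab) (us ! t)) =
    map_pmf (\<lambda>S. ((S, (arr (Suc t), lft (Suc t), computed (Suc t), tab')), q)) (out \<omega> (Suc t))"
proof -
  define W where "W = set (arr (Suc t))"
  define new where "new = todo (computed t) (targets h (lft (Suc t)) (rgt (Suc t)))"
  define M' where "M' = {S \<in> set (ground_list n). S \<inter> W \<in> M}"
  define tab' where "tab' y = (if y \<in> set new then node_state k H s f M \<omega> (arr (Suc t)) y else tab y)" for y
  let ?val = "\<lambda>S. f (S \<inter> W)" and ?ind = "\<lambda>S. S \<inter> W \<in> M"
  have t': "Suc t \<le> length us" using t by simp
  have WN: "W \<subseteq> N" using pos_props[OF t'] by (simp add: W_def)
  have ground: "set (ground_list n) = Pow N"
  proof -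
    have "{1..<Suc n} = N" by auto
    then show ?thesis unfolding ground_list_def by (simp add: subseqs_powset del: upt_Suc)
  qed
  have M'W: "{S \<in> M'. S \<subseteq> W} = {S \<in> M. S \<subseteq> W}"
    using WN by (auto simp: M'_def ground Int_absorb2)
  have M'V: "{S \<in> M'. S \<subseteq> V} = {S \<in> M. S \<subseteq> V}" if "V \<subseteq> W" for V
    using M'W that by blast
  have bounded: "set x \<subseteq> {..<rgt (Suc t)}" if "x \<in> set new" for x
    using that by (intro computed_bounded[OF t']) (simp add: new_def)
  \<comment> \<open>Arrival numbers are never reassigned, so the states of old nodes stay valid when
    \<open>arr\<close> grows.\<close>
  have tab_old: "tab y = node_state k H s f M \<omega> (arr (Suc t)) y" if y: "y \<in> computed t" for y
  proof -
    have "map ((!) (arr t)) y = map ((!) (arr (Suc t))) y"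
    proof (rule map_cong)
      fix i assume "i \<in> set y"
      then have "i < rgt t" using computed_bounded[of t y] y t by auto
      then show "arr t ! i = arr (Suc t) ! i" using step_props(2)[OF t] by (metis nth_take)
    qed simp
    then show ?thesis using tab y unfolding table_ok_def node_state_def by metis
  qed
  have ok: "table_ok \<omega> (Suc t) tab'"
    using tab_old by (auto simp: table_ok_def tab'_def new_def)
  have img: "(!) (arr (Suc t)) ` set (order (Suc t)) = win (Suc t)"
    using elems[OF t'] by (simp add: elems_def)
  have MV: "{S \<in> M'. S \<subseteq> (!) (arr (Suc t)) ` set (order (Suc t))} = Mw (Suc t)"
    unfolding img using win_sub[OF t'] by (intro M'V) (simp add: W_def)
  have ready: "order (Suc t) \<in> computed (Suc t)" unfolding order_def by (rule window_ready[OF t])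
  have st: "tab' (order (Suc t)) = process k H s f M \<omega> (elems (Suc t))"
    using ok ready by (simp add: table_ok_def node_state_def elems_def)
  define p where "p = replicate_pmf m (round_pmf k (Mw (Suc t)) (process k H s f M \<omega> (elems (Suc t))))"
  let ?\<sigma> = "(arr (Suc t), lft (Suc t), computed (Suc t), tab')"
  define finish where "finish tab' = bind_comp (coin_comp (replicate_pmf m
      (round_pmf k {S \<in> M'. S \<subseteq> (!) (arr (Suc t)) ` set (order (Suc t))} (tab' (order (Suc t))))))
      (\<lambda>Ss. query_list Ss (\<lambda>g. Done (best g Ss, (arr (Suc t), lft (Suc t), computed t \<union> set new, tab'))))"
    for tab' :: "nat list \<Rightarrow> state"
  have fin: "exec ?val ?ind (finish tab') = map_pmf (\<lambda>S. ((S, ?\<sigma>), m)) (out \<omega> (Suc t))"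
  proof -
    have "exec ?val ?ind (finish tab') = p \<bind> (\<lambda>Ss. exec ?val ?ind
        (query_list Ss (\<lambda>g. Done (best g Ss, ?\<sigma>))))"
      unfolding finish_def MV st p_def
      by (subst exec_bind_coin_comp) (simp_all add: coinable_replicate coinable_round new_def)
    also have "\<dots> = p \<bind> (\<lambda>Ss. return_pmf ((best f Ss, ?\<sigma>), m))"
    proof (rule bind_pmf_cong[OF refl])
      fix Ss assume "Ss \<in> set_pmf p"
      note sup = round_support[OF t' this[unfolded p_def]]
      have "best (\<lambda>S. if S \<in> set Ss then ?val S else 0) Ss = best f Ss"
      proof (rule best_cong)
        fix S assume S: "S \<in> set Ss"
        then have "S \<subseteq> W" using sup(2) win_sub[OF t'] unfolding W_def by blast
        then show "(if S \<in> set Ss then ?val S else 0) = f S" using S by (simp add: Int_absorb2)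
      qed
      then show "exec ?val ?ind (query_list Ss (\<lambda>g. Done (best g Ss, ?\<sigma>))) = return_pmf ((best f Ss, ?\<sigma>), m)"
        using sup(1) by (simp add: exec_query_list)
    qed
    also have "\<dots> = map_pmf (\<lambda>S. ((S, ?\<sigma>), m)) (out \<omega> (Suc t))"
      by (simp add: out_def p_def[symmetric] map_pmf_comp map_pmf_def[symmetric])
    finally show ?thesis .
  qed
  have "exec ?val ?ind (react n k H s m h \<omega> (arr t, lft t, computed t, tab) (us ! t)) =
      exec ?val ?ind (compute k H s \<omega> (arr (Suc t)) M' new tab finish)"
    unfolding finish_def[abs_def]
    by (simp only: react.simps arrive_pos[OF t] prod.case Let_def exec_indep_list new_def[symmetric]
        M'_def[symmetric] order_def[symmetric])
  also have "\<dots> = map_pmf (\<lambda>(r, q). (r, q + length new * (1 + 2 * s))) (exec ?val ?ind (finish tab'))"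
    unfolding tab'_def[abs_def]
  proof (rule exec_compute[where C = "computed t" and W = W])
    show "\<forall>S. S \<subseteq> W \<longrightarrow> ?val S = f S" by (auto simp: Int_absorb2)
    show "extends_by (computed t) new" unfolding new_def using closed[of t] t by (intro todo_props) simp
  qed (use M'W tab_old bounded in \<open>auto simp: W_def\<close>)
  also have "\<dots> = map_pmf (\<lambda>S. ((S, ?\<sigma>), m + length new * (1 + 2 * s))) (out \<omega> (Suc t))"
    unfolding fin by (simp add: map_pmf_comp)
  finally have ex: "exec ?val ?ind (react n k H s m h \<omega> (arr t, lft t, computed t, tab) (us ! t)) =
     map_pmf (\<lambda>S. ((S, ?\<sigma>), m + length new * (1 + 2 * s))) (out \<omega> (Suc t))" .
  have "length new \<le> 12 * (4 * h + 1)"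
    unfolding new_def using length_todo[of "computed t"] length_targets[of h]
    by (meson le_trans mult_le_mono2)
  then have "m + length new * (1 + 2 * s) \<le> query_bound"
    unfolding query_bound_def by (simp only: add.commute[of m] add_le_mono1 mult_le_mono1)
  then show ?thesis using ok ex unfolding W_def by blast
qed

abbreviation "run_at \<omega> t tab \<equiv>
  run f M (set (arr t)) (machine (react n k H s m h \<omega>) (arr t, lft t, computed t, tab)) (drop t us)"

text \<open>As the memory does not depend on the rounding coins, earlier solutions do not influence
  later ones once the seed is fixed; each solution has the law \<open>out\<close>.\<close>

lemma run_at:
  assumes "t + j < length us" "table_ok \<omega> t tab"
  shows "(\<forall>tr\<in>set_pmf (run_at \<omega> t tab). snd (tr ! j) \<le> query_bound) \<and>
    map_pmf (\<lambda>tr. fst (tr ! j)) (run_at \<omega> t tab) = out \<omega> (Suc (t + j))"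
  using assms
proof (induction j arbitrary: t tab)
  have unfold: "\<exists>tab' q. table_ok \<omega> (Suc t) tab' \<and> q \<le> query_bound \<and>
     run_at \<omega> t tab = out \<omega> (Suc t) \<bind> (\<lambda>S. map_pmf ((#) (S, q)) (run_at \<omega> (Suc t) tab'))"
    if t: "t < length us" and tab: "table_ok \<omega> t tab" for t tab
  proof -
    obtain tab' q where q: "table_ok \<omega> (Suc t) tab'" "q \<le> query_bound"
      "exec (\<lambda>S. f (S \<inter> set (arr (Suc t)))) (\<lambda>S. S \<inter> set (arr (Suc t)) \<in> M)
        (react n k H s m h \<omega> (arr t, lft t, computed t, tab) (us ! t)) =
       map_pmf (\<lambda>S. ((S, (arr (Suc t), lft (Suc t), computed (Suc t), tab')), q)) (out \<omega> (Suc t))"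
      using exec_react[OF t tab] by blast
    have d: "drop t us = us ! t # drop (Suc t) us" using t by (simp add: Cons_nth_drop_Suc)
    have "run_at \<omega> t tab = out \<omega> (Suc t) \<bind> (\<lambda>S. map_pmf ((#) (S, q)) (run_at \<omega> (Suc t) tab'))"
      unfolding d run.simps step_props(1)[OF t] Let_def machine.simps exec_map_comp q(3)
      by (simp add: map_pmf_comp bind_map_pmf)
    then show ?thesis using q by blast
  qed
  {
    case 0
    then obtain tab' q where q: "q \<le> query_bound"
      "run_at \<omega> t tab = out \<omega> (Suc t) \<bind> (\<lambda>S. map_pmf ((#) (S, q)) (run_at \<omega> (Suc t) tab'))"
      using unfold[of t tab] by auto
    show ?case unfolding q(2) using q(1) by (auto simp: map_bind_pmf map_pmf_comp bind_return_pmf')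
  next
    case (Suc j)
    then obtain tab' q where q: "table_ok \<omega> (Suc t) tab'" "q \<le> query_bound"
      "run_at \<omega> t tab = out \<omega> (Suc t) \<bind> (\<lambda>S. map_pmf ((#) (S, q)) (run_at \<omega> (Suc t) tab'))"
      using unfold[of t tab] by auto
    have IH: "\<forall>tr\<in>set_pmf (run_at \<omega> (Suc t) tab'). snd (tr ! j) \<le> query_bound"
      "map_pmf (\<lambda>tr. fst (tr ! j)) (run_at \<omega> (Suc t) tab') = out \<omega> (Suc (t + Suc j))"
      using Suc.IH[of "Suc t" tab'] Suc.prems q(1) by auto
    show ?case unfolding q(3) using IH by (auto simp: map_bind_pmf map_pmf_comp)
  }
qed

lemma table_ok_start: "table_ok \<omega> 0 (\<lambda>_. init)"
  by (simp add: table_ok_def node_state_def process_Nil)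

lemma run_sliding_alg:
  assumes "us \<noteq> []"
  shows "run f M {} (sliding_alg n k c s m h) us = seed_pmf N H s n \<bind> (\<lambda>\<omega>. run_at \<omega> 0 (\<lambda>_. init))"
proof -
  have start: "(arr 0, lft 0, computed 0, \<lambda>_. init) = start_memory" "arr 0 = []"
    by (simp_all add: arr_def lft_def position_def start_memory_def)
  have "run f M {} (sliding_alg n k c s m h) (u # us') =
      seed_pmf N H s n \<bind> (\<lambda>\<omega>. run f M {} (machine (react n k H s m h \<omega>) start_memory) (u # us'))" for u us'
    unfolding sliding_alg_def
    by (simp add: Let_def exec_bind_coin_comp coinable_seed bind_assoc_pmf del: machine.simps)
  then have "run f M {} (sliding_alg n k c s m h) us =
      seed_pmf N H s n \<bind> (\<lambda>\<omega>. run f M {} (machine (react n k H s m h \<omega>) start_memory) us)"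
    using assms by (cases us) simp_all
  then show ?thesis unfolding start(1) unfolding start(2) drop_0 list.set .
qed

theorem run_correct:
  assumes t: "t < length us" and H': "n \<le> eps * H"
    and d: "n * (2 * exp (- (2 * s * eps ^ 4 / k ^ 2))) + (1 - 1 / 10 ^ 5) ^ m \<le> \<delta>"
  shows "\<forall>tr\<in>set_pmf (run f M {} (sliding_alg n k c s m h) us).
       fst (tr ! t) \<in> M \<and> fst (tr ! t) \<subseteq> present (take (Suc t) us) \<and> snd (tr ! t) \<le> query_bound"
    and "measure_pmf.prob (run f M {} (sliding_alg n k c s m h) us)
       {tr. 3178 / 10000 * opt f M (present (take (Suc t) us)) \<le> f (fst (tr ! t))} \<ge> 1 - \<delta>"
proof -
  have us: "us \<noteq> []" and t': "Suc t \<le> length us" using t by auto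
  have V: "present (take (Suc t) us) = win (Suc t)" using pos_props[OF t'] by simp
  note R = run_at[of 0 t, OF _ table_ok_start, simplified, OF t]
  show "\<forall>tr\<in>set_pmf (run f M {} (sliding_alg n k c s m h) us).
       fst (tr ! t) \<in> M \<and> fst (tr ! t) \<subseteq> present (take (Suc t) us) \<and> snd (tr ! t) \<le> query_bound"
  proof
    fix tr assume "tr \<in> set_pmf (run f M {} (sliding_alg n k c s m h) us)"
    then obtain \<omega> where tr: "tr \<in> set_pmf (run_at \<omega> 0 (\<lambda>_. init))"
      unfolding run_sliding_alg[OF us] by auto
    then have "fst (tr ! t) \<in> set_pmf (map_pmf (\<lambda>tr. fst (tr ! t)) (run_at \<omega> 0 (\<lambda>_. init)))" by auto
    then have "fst (tr ! t) \<in> set_pmf (out \<omega> (Suc t))" using R[of \<omega>] by simp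
    then show "fst (tr ! t) \<in> M \<and> fst (tr ! t) \<subseteq> present (take (Suc t) us) \<and> snd (tr ! t) \<le> query_bound"
      using set_out[OF t'] R[of \<omega>] tr unfolding V by auto
  qed
  define E where "E = opt f M (win (Suc t))"
  have fin: "finite (Mw (Suc t))" using mat finite_subset[of M "Pow N"] by (auto simp: matroid_def)
  have "{} \<in> Mw (Suc t)" using mat by (simp add: matroid_def)
  then have "E \<in> f ` Mw (Suc t)" unfolding E_def opt_def using fin by (intro Max_in) auto
  then obtain I where I: "I \<in> Mw (Suc t)" "E = f I" by auto
  have le: "f J \<le> E" if "J \<in> Mw (Suc t)" for J unfolding E_def opt_def using fin that by (intro Max_ge) auto
  interpret S: streaming N f "Mw (Suc t)" k H by (rule streaming_win) fact
  note el = elems[OF t']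
  let ?p = "seed_pmf N H s n \<bind> (\<lambda>\<omega>. map_pmf (best f) (replicate_pmf m (round_pmf k (Mw (Suc t))
      (process k H s f (Mw (Suc t)) \<omega> (elems (Suc t))))))"
  \<comment> \<open>The success bound is stated for the matroid restricted to the window; all
    processed elements lie in the window, so the states are the same.\<close>
  have p: "?p = seed_pmf N H s n \<bind> (\<lambda>\<omega>. out \<omega> (Suc t))"
    unfolding out_def using el by (simp add: process_restrict)
  have "measure_pmf.prob ?p {S. \<not> 3178 / 10000 * E \<le> f S} \<le>
      n * (2 * exp (- (2 * s * eps ^ 4 / k ^ 2))) + (1 - 1 / 10 ^ 5) ^ m"
    using el win_sub[OF t'] I le H' m s by (intro S.output_success[of _ n]) auto
  then have "measure_pmf.prob ?p {S. \<not> 3178 / 10000 * E \<le> f S} \<le> \<delta>" using d by linarith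
  moreover have "{S. \<not> 3178 / 10000 * E \<le> f S} = UNIV - {S. 3178 / 10000 * E \<le> f S}" by auto
  ultimately have 1: "1 - \<delta> \<le> measure_pmf.prob ?p {S. 3178 / 10000 * E \<le> f S}"
    using measure_pmf.prob_compl[of "{S. 3178 / 10000 * E \<le> f S}" ?p] by simp
  have "?p = map_pmf (\<lambda>tr. fst (tr ! t)) (run f M {} (sliding_alg n k c s m h) us)"
    unfolding p run_sliding_alg[OF us] map_bind_pmf using R by simp
  then show "measure_pmf.prob (run f M {} (sliding_alg n k c s m h) us)
       {tr. 3178 / 10000 * opt f M (present (take (Suc t) us)) \<le> f (fst (tr ! t))} \<ge> 1 - \<delta>"
    using 1 unfolding V E_def by (simp add: vimage_def)
qed

end

section \<open>Choice of the parameters\<close>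

lemma poly2_pCons: "poly2 (pCons p P) x y = poly p x + y * poly2 P x y"
  unfolding poly2_def by (cases "p = 0 \<and> P = 0") (auto simp: map_poly_pCons)

lemma poly2_0: "poly2 0 x y = 0"
  by (simp add: poly2_def)

definition suitable :: "nat \<Rightarrow> nat \<Rightarrow> nat \<Rightarrow> real \<Rightarrow> nat \<Rightarrow> nat \<Rightarrow> nat \<Rightarrow> nat \<Rightarrow> bool" where
  "suitable c n k b h s m d \<longleftrightarrow> 1 \<le> h \<and> n \<le> 2 ^ h \<and> 0 < m \<and> 0 < s \<and> n \<le> eps * real (2 ^ d) \<and>
     n * (2 * exp (- (2 * real s * eps ^ 4 / k ^ 2))) + (1 - 1 / 10 ^ 5) ^ m \<le> 1 / real (n + 1) ^ c \<and>
     real (12 * (4 * h + 1) * (1 + 2 * s) + m) \<le> b"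

text \<open>Inaccurate estimates and unlucky rounding each get half of the failure probability. For
  fixed \<open>c\<close>, both \<open>h\<close> and \<open>m\<close> are logarithmic in
  \<open>n\<close> and \<open>s\<close> is \<open>k ^ 2\<close> times a logarithm, so the query
  bound is of order \<open>k ^ 2\<close> times a squared logarithm.\<close>

lemma parameters_exist:
  "\<exists>P :: real poly poly. \<forall>n k. n > 0 \<longrightarrow> k > 0 \<longrightarrow>
     (\<exists>h s m d. suitable c n k (poly2 P (real k) (ln (real n))) h s m d)"
proof -
  define K1 where "K1 = (real c + 4) / (2 * eps ^ 4) + 2"
  define K2 where "K2 = 10 ^ 5 * (1 + real c) + 2"
  define K where "K = 12 * 17 * (1 + 2 * K1) + K2"
  \<comment> \<open>This is \<open>K * x ^ 2 * (1 + y) ^ 2\<close>; the summand 1 is there because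
    \<open>y = ln n\<close> vanishes at \<open>n = 1\<close>.\<close>
  define P where "P = [:[:0, 0, K:], [:0, 0, 2 * K:], [:0, 0, K:]:]"
  have e: "0 < eps ^ 4" by (simp add: eps_def)
  have K1: "2 \<le> K1" using e by (simp add: K1_def)
  show ?thesis
  proof (intro exI[of _ P] allI impI)
    fix n k :: nat assume n: "0 < n" and k: "0 < k"
    define y where "y = ln (real n)"
    have y: "0 \<le> y" using n by (simp add: y_def)
    have ln2: "ln 2 \<le> (1::real)" using ln_le_minus_one[of "2::real"] by simp
    have "ln (real (n + 1)) \<le> ln (2 * real n)" using n by simp
    also have "\<dots> = ln 2 + y" using n by (simp add: ln_mult y_def)
    finally have ln1: "ln (real (n + 1)) \<le> 1 + y" using ln2 by simp
    have ln0: "0 \<le> ln (real (n + 1))" by simp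
    have k1: "1 \<le> real k ^ 2" using k by simp
    define h where "h = nat \<lceil>log 2 (real n)\<rceil> + 1"
    \<comment> \<open>Solves \<open>2 * x * eps ^ 4 / k ^ 2 = ln 4 + (c + 1) * ln (n + 1)\<close>.
      The \<open>ln 4\<close> pays for the factor 2 of Hoeffding's bound and for the halving, the
      extra 1 in \<open>c + 1\<close> for the union bound over positions.\<close>
    define x where "x = real k ^ 2 / (2 * eps ^ 4) * (ln 4 + (real c + 1) * ln (real (n + 1)))"
    define s where "s = nat \<lceil>x\<rceil> + 1"
    \<comment> \<open>Makes \<open>exp (- z / 10 ^ 5)\<close>, which bounds the probability that
      \<open>z\<close> roundings all fail, equal to \<open>1 / (2 * (n + 1) ^ c)\<close>.\<close>
    define z where "z = 10 ^ 5 * (ln 2 + real c * ln (real (n + 1)))"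
    define m where "m = nat \<lceil>z\<rceil> + 1"
    define d where "d = nat \<lceil>real n / eps\<rceil>"
    have l0: "0 \<le> log 2 (real n)" using n by simp
    have hr: "real h \<le> log 2 (real n) + 2" "log 2 (real n) \<le> real h" using l0 unfolding h_def by linarith+
    have nh: "n \<le> 2 ^ h"
    proof -
      have "real n = 2 powr (log 2 (real n))" using n by simp
      also have "\<dots> \<le> 2 powr (real h)" using hr by (intro powr_mono) auto
      also have "\<dots> = 2 ^ h" by (simp add: powr_realpow)
      finally show ?thesis by (metis of_nat_le_iff of_nat_numeral of_nat_power)
    qed
    have nd: "n \<le> eps * real (2 ^ d)"
    proof -
      have "real n / eps \<le> real d" unfolding d_def by linarith
      also have "d \<le> 2 ^ d" by (rule less_imp_le, rule less_exp)
      finally have "real n / eps \<le> real (2 ^ d)" by simp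
      then show ?thesis by (simp add: eps_def)
    qed
    have x0: "0 \<le> x" using e ln0 unfolding x_def by (intro mult_nonneg_nonneg add_nonneg_nonneg) auto
    have z0: "0 \<le> z" using ln0 unfolding z_def by (intro mult_nonneg_nonneg add_nonneg_nonneg) auto
    have sx: "x \<le> real s" "real s \<le> x + 2" using x0 unfolding s_def by linarith+
    have mz: "z \<le> real m" "real m \<le> z + 2" using z0 unfolding m_def by linarith+
    have pc: "exp (real j * ln (real (n + 1))) = real (n + 1) ^ j" for j
      by (simp add: exp_of_nat_mult)
    have d1: "n * (2 * exp (- (2 * real s * eps ^ 4 / k ^ 2))) \<le> 1 / (2 * real (n + 1) ^ c)"
    proof -
      have "ln 4 + (real c + 1) * ln (real (n + 1)) = 2 * x * eps ^ 4 / k ^ 2"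
        using e k by (simp add: x_def)
      also have "\<dots> \<le> 2 * real s * eps ^ 4 / k ^ 2"
        using sx e by (intro divide_right_mono mult_right_mono) auto
      finally have "exp (- (2 * real s * eps ^ 4 / k ^ 2)) \<le> exp (- (ln 4 + real (c + 1) * ln (real (n + 1))))"
        by (simp add: add.commute)
      also have "\<dots> = 1 / (4 * real (n + 1) ^ (c + 1))"
        by (simp only: exp_minus exp_add pc) (simp add: field_simps)
      finally have "n * (2 * exp (- (2 * real s * eps ^ 4 / k ^ 2))) \<le> n * (2 * (1 / (4 * real (n + 1) ^ (c + 1))))"
        by (intro mult_left_mono) auto
      also have "\<dots> = (n / real (n + 1)) * (1 / (2 * real (n + 1) ^ c))"
      proof -
        have "v * (2 * (1 / (4 * (b * a)))) = (v / a) * (1 / (2 * b))" if "a \<noteq> 0" "b \<noteq> 0" for v a b :: real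
          using that by (simp add: field_simps)
        then show ?thesis unfolding power_add power_one_right by (metis of_nat_neq_0 Suc_eq_plus1 power_not_zero)
      qed
      also have "\<dots> \<le> 1 * (1 / (2 * real (n + 1) ^ c))" by (intro mult_right_mono) auto
      finally show ?thesis by simp
    qed
    have d2: "(1 - 1 / 10 ^ 5) ^ m \<le> 1 / (2 * real (n + 1) ^ c)"
    proof -
      have "(1 - 1 / 10 ^ 5 :: real) ^ m \<le> exp (- (1 / 10 ^ 5)) ^ m"
        using exp_ge_add_one_self[of "- (1 / 10 ^ 5) :: real"] by (intro power_mono) auto
      also have "\<dots> = exp (- (real m / 10 ^ 5))" by (simp add: exp_of_nat_mult[symmetric])
      also have "\<dots> \<le> exp (- (ln 2 + real c * ln (real (n + 1))))"
        using mz by (simp add: z_def)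
      also have "\<dots> = 1 / (2 * real (n + 1) ^ c)"
        by (simp only: exp_minus exp_add pc) (simp add: field_simps)
      finally show ?thesis .
    qed
    have dd: "n * (2 * exp (- (2 * real s * eps ^ 4 / k ^ 2))) + (1 - 1 / 10 ^ 5) ^ m \<le> 1 / real (n + 1) ^ c"
      using d1 d2 by simp
    \<comment> \<open>From \<open>ln 2 \<ge> 1 / 2\<close> and \<open>h \<le> log 2 n + 2\<close>
      follows \<open>4 * h + 1 \<le> 8 * y + 9\<close>, and 17 is the sum of these
      coefficients.\<close>
    have hb: "real (12 * (4 * h + 1)) \<le> 12 * 17 * (1 + y)"
    proof -
      have "1 / 2 \<le> ln (2::real)" using ln_ge_iff[of 2 "1/2"] exp_half_le2 by simp
      then have "y * (1 / 2) \<le> y * ln 2" using y by (rule mult_left_mono)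
      then have "y \<le> 2 * y * ln 2" by linarith
      then have "y / ln 2 \<le> 2 * y" by (simp only: pos_divide_le_eq ln_gt_zero one_less_numeral semiring_norm)
      then have "log 2 (real n) \<le> 2 * y" by (simp only: log_def y_def)
      then show ?thesis using hr y by simp
    qed
    have sb: "real s \<le> K1 * real k ^ 2 * (1 + y)"
    proof -
      have "ln 4 = 2 * ln (2::real)" using ln_realpow[of "2::real" 2] by simp
      then have "ln 4 \<le> (2::real)" using ln2 by simp
      moreover have "(real c + 1) * ln (real (n + 1)) \<le> (real c + 1) * (1 + y)" using ln1 by (intro mult_left_mono) auto
      ultimately have "ln 4 + (real c + 1) * ln (real (n + 1)) \<le> (real c + 4) * (1 + y)"
        using y by (simp add: algebra_simps)
      then have "x \<le> real k ^ 2 / (2 * eps ^ 4) * ((real c + 4) * (1 + y))"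
        unfolding x_def using e by (intro mult_left_mono) auto
      moreover have "2 * 1 \<le> 2 * (real k ^ 2 * (1 + y))"
        using mult_mono[OF k1, of 1 "1 + y"] y by simp
      ultimately have "real s \<le> real k ^ 2 / (2 * eps ^ 4) * ((real c + 4) * (1 + y)) + 2 * (real k ^ 2 * (1 + y))"
        using sx by simp
      also have "\<dots> = K1 * real k ^ 2 * (1 + y)"       proof -
        have "u / b * (a * v) + 2 * (u * v) = (a / b + 2) * u * v" for u b a v :: real
          by (cases "b = 0") (simp_all add: field_simps)
        then show ?thesis unfolding K1_def .
      qed
      finally show ?thesis .
    qed
    define X where "X = real k ^ 2 * (1 + y)"
    have X: "1 \<le> X" using mult_mono[OF k1, of 1 "1 + y"] y by (simp add: X_def)
    have mb: "real m \<le> K2 * (1 + y)"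
    proof -
      have "real c * ln (real (n + 1)) \<le> real c * (1 + y)" using ln1 by (intro mult_left_mono) auto
      then have "ln 2 + real c * ln (real (n + 1)) \<le> (1 + real c) * (1 + y)"
        using ln2 y by (simp add: algebra_simps)
      then have "z \<le> 10 ^ 5 * ((1 + real c) * (1 + y))" by (simp add: z_def)
      then show ?thesis using mz y by (simp add: K2_def algebra_simps)
    qed
    have "real (12 * (4 * h + 1) * (1 + 2 * s) + m) = real (12 * (4 * h + 1)) * (1 + 2 * real s) + real m"
      by (simp add: algebra_simps)
    also have "\<dots> \<le> (12 * 17 * (1 + y)) * ((1 + 2 * K1) * X) + K2 * (1 + y) * X"
    proof (intro add_mono mult_mono)
      show "1 + 2 * real s \<le> (1 + 2 * K1) * X" using sb X by (simp add: X_def algebra_simps)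
      show "real m \<le> K2 * (1 + y) * X"
      proof -
        have "0 \<le> K2 * (1 + y)" using y by (simp add: K2_def)
        from mult_left_mono[OF X this] show ?thesis using mb by linarith
      qed
    qed (use hb y in auto)
    also have "\<dots> = poly2 P (real k) y"
      unfolding P_def by (simp add: poly2_pCons poly2_0 X_def K_def algebra_simps power2_eq_square)
    finally have b: "real (12 * (4 * h + 1) * (1 + 2 * s) + m) \<le> poly2 P (real k) (ln (real n))"
      by (simp add: y_def)
    have "suitable c n k (poly2 P (real k) (ln (real n))) h s m d"
      unfolding suitable_def using nh nd dd b by (simp add: h_def s_def m_def)
    then show "\<exists>h s m d. suitable c n k (poly2 P (real k) (ln (real n))) h s m d" by blast
  qed
qed

theorem theorem4p2:
  "\<forall>c::nat. \<exists>P :: real poly poly. \<forall>n k :: nat. n > 0 \<longrightarrow> k > 0 \<longrightarrow>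
     (\<exists>A. sliding_window_approx {1..n} k 0.3178 (1 / real (n + 1) ^ c)
            (poly2 P (real k) (ln (real n))) A)"
proof
  fix c :: nat
  obtain P :: "real poly poly" where P: "\<forall>n k. n > 0 \<longrightarrow> k > 0 \<longrightarrow>
     (\<exists>h s m d. suitable c n k (poly2 P (real k) (ln (real n))) h s m d)"
    using parameters_exist by blast
  show "\<exists>P :: real poly poly. \<forall>n k :: nat. n > 0 \<longrightarrow> k > 0 \<longrightarrow>
     (\<exists>A. sliding_window_approx {1..n} k 0.3178 (1 / real (n + 1) ^ c)
            (poly2 P (real k) (ln (real n))) A)"
  proof (intro exI[of _ P] allI impI)
    fix n k :: nat assume n: "0 < n" and k: "0 < k"
    then obtain h s m d where "suitable c n k (poly2 P (real k) (ln (real n))) h s m d"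
      using P by blast
    note par = this[unfolded suitable_def]
    have "sliding_window_approx {1..n} k 0.3178 (1 / real (n + 1) ^ c)
            (poly2 P (real k) (ln (real n))) (sliding_alg n k d s m h)"
      unfolding sliding_window_approx_def Let_def
    proof (intro allI impI)
      fix f M us t
      assume a: "(\<forall>S\<subseteq>{1..n}. 0 \<le> f S) \<and> mono_on (Pow {1..n}) f \<and> submodular_on {1..n} f \<and>
        matroid {1..n} M \<and> matroid_rank M = k \<and> sliding_window_stream {1..n} us"
        and t: "t < length us"
      interpret window_run n k d s m h f M us
        using a n k par by unfold_locales auto
      have qb: "real q \<le> poly2 P (real k) (ln (real n))" if "q \<le> query_bound" for q
        using that par unfolding query_bound_def by (meson of_nat_mono order_trans)
      have "n * (2 * exp (- (real (2 * s) * eps ^ 4 / real (k ^ 2)))) + (1 - 1 / 10 ^ 5) ^ m \<le> 1 / real (n + 1) ^ c"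
        using par by simp
      note R = run_correct[OF t _ this]
      show "(\<forall>tr\<in>set_pmf (run f M {} (sliding_alg n k d s m h) us).
          fst (tr ! t) \<in> M \<and> fst (tr ! t) \<subseteq> present (take (Suc t) us) \<and>
          real (snd (tr ! t)) \<le> poly2 P (real k) (ln (real n))) \<and>
        1 - 1 / real (n + 1) ^ c \<le> measure_pmf.prob (run f M {} (sliding_alg n k d s m h) us)
          {tr. 0.3178 * opt f M (present (take (Suc t) us)) \<le> f (fst (tr ! t))}"
        using R par qb by simp
    qed
    then show "\<exists>A. sliding_window_approx {1..n} k 0.3178 (1 / real (n + 1) ^ c)
            (poly2 P (real k) (ln (real n))) A" by blast
  qed
qed

end
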